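(* Let $x:M^2\to\mathbb{R}^3$ be a Calabi extremal surface. Then the second variation of its area integral with respect to the Calabi metric is negative definite; that is, for every admissible compactly supported variation $x_t$ of $x=x_0$ with variation vector field $\frac{\partial x_t}{\partial t}\big|_{t=0}=\varphi\,Y+(\text{tangential part})$, $\varphi\in C_0^\infty(M)$, the second derivative $V''(0)$ is a quadratic form in $\varphi$ satisfying $V''(0)\le 0$, with equality only if $\varphi\equiv 0$.
   Context: A Calabi surface is a locally strongly convex immersion $x:M^2\to\mathbb{R}^3$ of a smooth connected surface equipped with the constant transversal field $Y=(0,0,1)$ (the Calabi affine normalization). Writing $D$ for the flat connection of $\mathbb{R}^3$, the Calabi metric $G$ is defined by $D_X x_*Z=x_*(\nabla_XZ)+G(X,Z)Y$, and the orientation is chosen so that $G$ is positive definite. Locally $x(M^2)$ is the graph $x_3=f(x_1,x_2)$ of a strictly convex function $f$, and $G=\sum f_{ij}\,dx_i\,dx_j$, $f_{ij}=\frac{\partial^2 f}{\partial x_i\partial x_j}$. The Calabi surface is called Calabi extremal if $\Delta\ln\det(f_{ij})=0$, where $\Delta$ is the Laplacian of $G$; this is the Euler-Lagrange equation of the area integral $\int_M dV$, $dV$ being the volume element of $G$. An admissible compactly supported variation is a smooth family $x_t:M^2\to\mathbb{R}^3$, $t\in(-\epsilon,\epsilon)$, of Calabi surfaces with $x_0=x$ and $x_t=x$ outside a fixed compact subset of the interior of $M$. (For example, locally $x_t=(x_1,x_2,f(x_1,x_2,t))$ with $f(\cdot,t)$ strictly convex, in which case $\varphi=\partial_t f|_{t=0}$.)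 $V(t)$ denotes the area, over that compact set, of the Calabi metric of $x_t$, and $V''(0)$ is its second derivative at $t=0$. *)

theory Defs
  imports "HOL-Analysis.Analysis"
begin

section \<open>Smooth functions on open sets\<close>

text \<open>Meant for open \<open>S\<close>: \<open>Ck_on n S f\<close> says that \<open>f\<close> is \<open>n\<close> times continuously
  differentiable on \<open>S\<close>.\<close>

primrec Ck_on ::
  "nat \<Rightarrow> 'a::real_normed_vector set \<Rightarrow> ('a \<Rightarrow> 'b::real_normed_vector) \<Rightarrow> bool"
where
  "Ck_on 0 S f \<longleftrightarrow> continuous_on S f"
| "Ck_on (Suc n) S f \<longleftrightarrow>
     (\<forall>u\<in>S. f differentiable (at u)) \<and>
     (\<forall>v. Ck_on n S (\<lambda>u. frechet_derivative f (at u) v))"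

definition smooth_on ::
  "'a::real_normed_vector set \<Rightarrow> ('a \<Rightarrow> 'b::real_normed_vector) \<Rightarrow> bool"
where
  "smooth_on S f \<longleftrightarrow> (\<forall>n. Ck_on n S f)"

definition partial_deriv :: "'n::finite \<Rightarrow> (real^'n \<Rightarrow> 'b::real_normed_vector) \<Rightarrow> real^'n \<Rightarrow> 'b"
where
  "partial_deriv i f u = frechet_derivative f (at u) (axis i 1)"

definition hessian :: "(real^'n \<Rightarrow> real) \<Rightarrow> real^'n \<Rightarrow> real^'n^'n"
where
  "hessian f u = (\<chi> i j. partial_deriv i (partial_deriv j f) u)"

definition laplace_beltrami ::
  "(real^'n \<Rightarrow> real^'n^'n) \<Rightarrow> (real^'n \<Rightarrow> real) \<Rightarrow> real^'n \<Rightarrow> real"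
where
  "laplace_beltrami g h u =
     (1 / sqrt (det (g u))) *
     (\<Sum>i\<in>UNIV. partial_deriv i
        (\<lambda>w. sqrt (det (g w)) * (\<Sum>j\<in>UNIV. matrix_inv (g w) $ i $ j * partial_deriv j h w)) u)"


section \<open>Smooth surfaces\<close>

text \<open>A smooth surface is a Hausdorff second countable type \<open>'m\<close> (all of \<open>UNIV\<close>) with an atlas,
  not necessarily maximal. A chart is given by its domain and its coordinate map; values of the
  coordinate map outside the domain are irrelevant.\<close>

type_synonym 'm chart = "'m set \<times> ('m \<Rightarrow> real^2)"

abbreviation dom_of :: "'m chart \<Rightarrow> 'm set" where
  "dom_of \<kappa> \<equiv> fst \<kappa>"

abbreviation coord :: "'m chart \<Rightarrow> 'm \<Rightarrow> real^2" where
  "coord \<kappa> \<equiv> snd \<kappa>"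

abbreviation cod_of :: "'m chart \<Rightarrow> (real^2) set" where
  "cod_of \<kappa> \<equiv> coord \<kappa> ` dom_of \<kappa>"

abbreviation param :: "'m chart \<Rightarrow> real^2 \<Rightarrow> 'm" where
  "param \<kappa> \<equiv> inv_into (dom_of \<kappa>) (coord \<kappa>)"

definition smooth_atlas :: "'m::topological_space chart set \<Rightarrow> bool"
where
  "smooth_atlas \<A> \<longleftrightarrow>
     (\<Union>\<kappa>\<in>\<A>. dom_of \<kappa>) = UNIV \<and>
     (\<forall>\<kappa>\<in>\<A>. open (dom_of \<kappa>) \<and> open (cod_of \<kappa>) \<and>
        homeomorphism (dom_of \<kappa>) (cod_of \<kappa>) (coord \<kappa>) (param \<kappa>)) \<and>
     (\<forall>\<kappa>\<in>\<A>. \<forall>\<mu>\<in>\<A>.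
        smooth_on (coord \<kappa> ` (dom_of \<kappa> \<inter> dom_of \<mu>)) (coord \<mu> \<circ> param \<kappa>))"

definition smooth_map :: "'m chart set \<Rightarrow> ('m \<Rightarrow> 'b::real_normed_vector) \<Rightarrow> bool"
where
  "smooth_map \<A> h \<longleftrightarrow> (\<forall>\<kappa>\<in>\<A>. smooth_on (cod_of \<kappa>) (h \<circ> param \<kappa>))"

definition test_functions :: "'m::topological_space chart set \<Rightarrow> ('m \<Rightarrow> real) set"
where
  "test_functions \<A> = {\<phi>. smooth_map \<A> \<phi> \<and> compact (closure {q. \<phi> q \<noteq> 0})}"


section \<open>Calabi surfaces\<close>

definition calabi_normal :: "real^3"
where
  "calabi_normal = vector [0, 0, 1]"

text \<open>Here \<open>X\<close> is a local parametrization and \<open>v\<close>, \<open>w\<close> stand for vector fields with constant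
  coefficients in its coordinates, so that \<open>D\<^sub>v x\<^sub>*w\<close> is the iterated directional derivative of
  \<open>X\<close>; the tangential remainder is \<open>x\<^sub>*(\<nabla>\<^sub>v w)\<close>. The number is unique as soon as the
  normal is transversal.\<close>

definition calabi_metric :: "(real^2 \<Rightarrow> real^3) \<Rightarrow> real^2 \<Rightarrow> real^2 \<Rightarrow> real^2 \<Rightarrow> real"
where
  "calabi_metric X u v w =
     (THE g. frechet_derivative (\<lambda>u'. frechet_derivative X (at u') w) (at u) v
               - g *\<^sub>R calabi_normal \<in> range (frechet_derivative X (at u)))"

definition calabi_gram :: "(real^2 \<Rightarrow> real^3) \<Rightarrow> real^2 \<Rightarrow> real^2^2"
where
  "calabi_gram X u = (\<chi> i j. calabi_metric X u (axis i 1) (axis j 1))"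

text \<open>Local strong convexity is definiteness of \<open>G\<close>; it is contained in the last conjunct,
  which also fixes the sign (orientation) convention.\<close>

definition calabi_surface :: "'m chart set \<Rightarrow> ('m \<Rightarrow> real^3) \<Rightarrow> bool"
where
  "calabi_surface \<A> x \<longleftrightarrow>
     smooth_map \<A> x \<and>
     (\<forall>\<kappa>\<in>\<A>. \<forall>u\<in>cod_of \<kappa>.
        inj (frechet_derivative (x \<circ> param \<kappa>) (at u)) \<and>
        calabi_normal \<notin> range (frechet_derivative (x \<circ> param \<kappa>) (at u)) \<and>
        (\<forall>v. v \<noteq> 0 \<longrightarrow> calabi_metric (x \<circ> param \<kappa>) u v v > 0))"

definition base_point :: "real^3 \<Rightarrow> real^2"
where
  "base_point p = vector [p $ 1, p $ 2]"

definition local_graph ::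
  "('m::topological_space \<Rightarrow> real^3) \<Rightarrow> 'm set \<Rightarrow> (real^2) set \<Rightarrow> (real^2 \<Rightarrow> real) \<Rightarrow> bool"
where
  "local_graph x W \<Omega> f \<longleftrightarrow>
     open W \<and> open \<Omega> \<and> bij_betw (base_point \<circ> x) W \<Omega> \<and>
     (\<forall>q\<in>W. x q $ 3 = f (base_point (x q)))"

text \<open>The quantity \<open>det (f\<^sub>i\<^sub>j)\<close> refers to the graph coordinates \<open>(x\<^sub>1, x\<^sub>2)\<close>, not to
  arbitrary coordinates on the surface. The base projection of a Calabi surface is a local
  diffeomorphism, so every point lies in the domain of some local graph.\<close>

definition calabi_extremal :: "('m::topological_space \<Rightarrow> real^3) \<Rightarrow> bool"
where
  "calabi_extremal x \<longleftrightarrow>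
     (\<forall>W \<Omega> f. local_graph x W \<Omega> f \<longrightarrow>
        (\<forall>y\<in>\<Omega>. laplace_beltrami (hessian f) (\<lambda>z. ln (det (hessian f z))) y = 0))"


section \<open>Area and variations\<close>

definition chart_volume ::
  "'m::topological_space chart \<Rightarrow> ('m \<Rightarrow> real^3) \<Rightarrow> 'm measure"
where
  "chart_volume \<kappa> x =
     distr (density (restrict_space lborel (cod_of \<kappa>))
              (\<lambda>u. ennreal (sqrt (det (calabi_gram (x \<circ> param \<kappa>) u)))))
           borel (param \<kappa>)"

text \<open>The measures \<open>sqrt (det G) du\<close> of two charts agree on the overlap of the chart domains and
  vanish outside them, so their supremum in the lattice of Borel measures is the measure
  \<open>dV\<close> that restricts to each of them.\<close>

definition calabi_volume ::
  "'m::topological_space chart set \<Rightarrow> ('m \<Rightarrow> real^3) \<Rightarrow> 'm measure"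
where
  "calabi_volume \<A> x = (SUP \<kappa>\<in>\<A>. chart_volume \<kappa> x)"

definition admissible_variation ::
  "'m::topological_space chart set \<Rightarrow> ('m \<Rightarrow> real^3) \<Rightarrow> real \<Rightarrow> 'm set \<Rightarrow>
   (real \<Rightarrow> 'm \<Rightarrow> real^3) \<Rightarrow> bool"
where
  "admissible_variation \<A> x \<epsilon> K F \<longleftrightarrow>
     \<epsilon> > 0 \<and> compact K \<and>
     (\<forall>\<kappa>\<in>\<A>. smooth_on ({-\<epsilon><..<\<epsilon>} \<times> cod_of \<kappa>) (\<lambda>(t, u). F t (param \<kappa> u))) \<and>
     (\<forall>t\<in>{-\<epsilon><..<\<epsilon>}. calabi_surface \<A> (F t)) \<and>
     F 0 = x \<and>
     (\<forall>t\<in>{-\<epsilon><..<\<epsilon>}. \<forall>q. q \<notin> K \<longrightarrow> F t q = x q)"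

text \<open>The variation field of \<open>F\<close> along \<open>x\<close> is \<open>\<phi> Y\<close> plus a tangential part.\<close>

definition normal_part ::
  "'m chart set \<Rightarrow> ('m \<Rightarrow> real^3) \<Rightarrow> (real \<Rightarrow> 'm \<Rightarrow> real^3) \<Rightarrow> ('m \<Rightarrow> real) \<Rightarrow> bool"
where
  "normal_part \<A> x F \<phi> \<longleftrightarrow>
     (\<forall>\<kappa>\<in>\<A>. \<forall>q\<in>dom_of \<kappa>.
        vector_derivative (\<lambda>t. F t q) (at 0) - \<phi> q *\<^sub>R calabi_normal
          \<in> range (frechet_derivative (x \<circ> param \<kappa>) (at (coord \<kappa> q))))"

definition has_second_derivative :: "(real \<Rightarrow> real) \<Rightarrow> real \<Rightarrow> real \<Rightarrow> bool"
where
  "has_second_derivative V c a \<longleftrightarrow>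
     (\<exists>V'. (\<forall>\<^sub>F t in nhds a. (V has_real_derivative V' t) (at t)) \<and>
           (V' has_real_derivative c) (at a))"

definition quadratic_form_on :: "('m \<Rightarrow> real) set \<Rightarrow> (('m \<Rightarrow> real) \<Rightarrow> real) \<Rightarrow> bool"
where
  "quadratic_form_on S Q \<longleftrightarrow>
     (\<exists>B. (\<forall>\<phi>\<in>S. \<forall>\<psi>\<in>S. B \<phi> \<psi> = B \<psi> \<phi>) \<and>
          (\<forall>\<phi>\<in>S. \<forall>\<psi>\<in>S. \<forall>\<theta>\<in>S. \<forall>a b.
             B (\<lambda>q. a * \<phi> q + b * \<psi> q) \<theta> = a * B \<phi> \<theta> + b * B \<psi> \<theta>) \<and>
          (\<forall>\<phi>\<in>S. Q \<phi> = B \<phi> \<phi>))"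

end

theory Submission
  imports Defs
begin

text \<open>The base projection \<open>P = (x\<^sub>1, x\<^sub>2)\<close> of a Calabi surface is a local diffeomorphism onto
  \<open>\<real>\<^sup>2\<close>, so \<open>P\<close> provides coordinates whose transition maps are identities. Partial derivatives and
  Lebesgue measure then make sense globally on the surface, and integrals of derivatives of compactly
  supported functions vanish. If \<open>f\<^sub>t = h + t\<phi> + t\<^sup>2\<psi>/2 + \<dots>\<close> are the graph functions of a variation,
  the area density \<open>\<sigma> = sqrt (det D\<^sup>2f)\<close> has second derivative
  \<open>\<sigma> tr(H\<^sup>-\<^sup>1D\<^sup>2\<psi>)/2 + (det D\<^sup>2\<phi> - (tr(H\<^sup>-\<^sup>1D\<^sup>2\<phi>))\<^sup>2 det H / 4) / \<sigma>\<close>, where \<open>H = D\<^sup>2h\<close>, and moving the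
  points of the surface along the base adds divergences only. The term with \<open>\<psi>\<close> integrates to zero by
  the extremal equation. In terms of the eigenvalues of \<open>D\<^sup>2\<phi>\<close> relative to \<open>H\<close> what remains is
  \<open>- \<sigma> (\<lambda>\<^sub>1 - \<lambda>\<^sub>2)\<^sup>2 / 4 \<le> 0\<close>. It vanishes identically only if \<open>D\<^sup>2\<phi> = \<mu> H\<close>; then \<open>\<mu>\<close> is constant,
  hence zero because the surface is not compact, and \<open>\<phi>\<close> is zero.\<close>


section \<open>Continuously differentiable functions\<close>

text \<open>Admissible variations may move points tangentially, and \<open>P\<close> need not be
  injective, so neither the surface nor its variation can be replaced by one global graph. All
  surfaces \<open>F t\<close> are therefore described in the base coordinates of the initial surface
  \<open>x\<close>: the set \<open>K\<close> and the reference measure stay fixed, and time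
  derivatives pass under the integral. The price is that for t \<noteq> 0 the first two components
  of \<open>F t\<close> are no longer the coordinates, so the metric is a Hessian corrected by
  connection coefficients. These vanish at t = 0, but their time derivatives do not, and the
  corrections are exactly what turns the variation of the metric into Lie derivatives along fields
  on the base. The determinant of the metric is a density of weight two and its square root one of
  weight one; for the latter a Lie derivative is a divergence. This is why only \<phi> survives in
  the second derivative of the area. On the side of measures, the volume is given as a supremum over
  charts, and it has to be recognized as the density \<open>rho\<close> against one global measure
  before anything can be differentiated.\<close>

lemma has_derivative_cong_open:
  assumes "open S" "u \<in> S" "\<And>w. w \<in> S \<Longrightarrow> f w = g w"
  shows "(f has_derivative D) (at u) \<longleftrightarrow> (g has_derivative D) (at u)"
  using assms has_derivative_transform_within_open[of f D u UNIV S g]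
    has_derivative_transform_within_open[of g D u UNIV S f] by auto

lemma differentiable_cong_open:
  assumes "open S" "u \<in> S" "\<And>w. w \<in> S \<Longrightarrow> f w = g w"
  shows "f differentiable (at u) \<longleftrightarrow> g differentiable (at u)"
  unfolding differentiable_def using has_derivative_cong_open[OF assms] by simp

lemma frechet_derivative_cong_open:
  assumes "open S" "u \<in> S" "\<And>w. w \<in> S \<Longrightarrow> f w = g w"
  shows "frechet_derivative f (at u) = frechet_derivative g (at u)"
  unfolding frechet_derivative_def using has_derivative_cong_open[OF assms] by simp

lemma frechet_derivative_eqI:
  "(f has_derivative D) (at u) \<Longrightarrow> frechet_derivative f (at u) = D"
  using frechet_derivative_at by metis

section \<open>Closure properties of the classes \<open>Ck_on\<close>\<close>

lemma Ck_on_subset: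
  "Ck_on n S f \<Longrightarrow> T \<subseteq> S \<Longrightarrow> Ck_on n T f"
  by (induction n arbitrary: f) (auto intro: continuous_on_subset)

lemma Ck_on_cong:
  "open S \<Longrightarrow> (\<And>u. u \<in> S \<Longrightarrow> f u = g u) \<Longrightarrow> Ck_on n S f \<longleftrightarrow> Ck_on n S g"
proof (induction n arbitrary: f g)
  case 0
  then show ?case by (auto cong: continuous_on_cong)
next
  case (Suc n)
  have "Ck_on n S (\<lambda>u. frechet_derivative f (at u) v) =
    Ck_on n S (\<lambda>u. frechet_derivative g (at u) v)" for v
    using Suc.prems by (intro Suc.IH) (auto simp: frechet_derivative_cong_open[of S _ f g])
  then show ?case using Suc.prems by (auto simp: differentiable_cong_open[of S _ f g])
qed

text \<open>Derivatives at a point are unique, so a family \<open>f'\<close> computed by hand may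
  stand for \<open>frechet_derivative\<close>. The product and chain rules and the cases of
  \<open>inverse\<close> and \<open>sqrt\<close> enter through this rule.\<close>

lemma Ck_on_SucI:
  assumes "open S" "\<And>u. u \<in> S \<Longrightarrow> (f has_derivative f' u) (at u)"
    "\<And>v. Ck_on n S (\<lambda>u. f' u v)"
  shows "Ck_on (Suc n) S f"
proof -
  have "Ck_on n S (\<lambda>u. frechet_derivative f (at u) v)" for v
  proof (rule Ck_on_cong[OF assms(1), THEN iffD1])
    show "Ck_on n S (\<lambda>u. f' u v)" by (rule assms(3))
    show "f' u v = frechet_derivative f (at u) v" if "u \<in> S" for u
      using frechet_derivative_eqI[OF assms(2)[OF that]] by simp
  qed
  then show ?thesis using assms(2) by (auto simp: differentiable_def)
qed

lemma Ck_on_SucD: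
  assumes "Ck_on (Suc n) S f" "u \<in> S"
  shows "(f has_derivative frechet_derivative f (at u)) (at u)"
  using assms frechet_derivative_works by auto

lemma Ck_on_imp_continuous_on: "Ck_on n S f \<Longrightarrow> continuous_on S f"
  by (cases n) (auto intro!: continuous_at_imp_continuous_on differentiable_imp_continuous_within)

lemma Ck_on_lower: "Ck_on (Suc n) S f \<Longrightarrow> Ck_on n S f"
proof (induction n arbitrary: f)
  case 0
  then show ?case using Ck_on_imp_continuous_on[of "Suc 0" S f] by simp
next
  case (Suc n)
  have "f differentiable (at u)" if "u \<in> S" for u
    using Suc.prems that by (simp del: Ck_on.simps add: Ck_on.simps(2)[of "Suc n"])
  moreover have "Ck_on n S (\<lambda>u. frechet_derivative f (at u) v)" for v
    using Suc.prems by (intro Suc.IH) (simp only: Ck_on.simps(2)[of "Suc n"])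
  ultimately show ?case by (simp only: Ck_on.simps(2)) simp
qed

text \<open>The derivatives in \<open>Ck_on\<close> are taken in the full space, so the class is
  determined by neighbourhoods. This makes it possible to pass between overlapping sheets
  later.\<close>

lemma Ck_on_local:
  assumes "\<And>u. u \<in> S \<Longrightarrow> \<exists>T. open T \<and> u \<in> T \<and> Ck_on n T f"
  shows "Ck_on n S f"
  using assms
proof (induction n arbitrary: f)
  case 0
  then show ?case
    by (auto intro!: continuous_at_imp_continuous_on)
       (metis continuous_on_eq_continuous_at)
next
  case (Suc n)
  have "f differentiable (at u)" if "u \<in> S" for u using Suc.prems[OF that] by auto
  moreover have "Ck_on n S (\<lambda>u. frechet_derivative f (at u) v)" for v
  proof (rule Suc.IH)
    fix u assume "u \<in> S"
    from Suc.prems[OF this] obtain T where "open T" "u \<in> T" "Ck_on (Suc n) T f" by blast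
    then show "\<exists>T. open T \<and> u \<in> T \<and> Ck_on n T (\<lambda>u. frechet_derivative f (at u) v)"
      by (intro exI[of _ T]) auto
  qed
  ultimately show ?case by simp
qed

lemma Ck_on_const: "Ck_on n S (\<lambda>u. c)"
proof (induction n arbitrary: c)
  case (Suc n)
  then show ?case by (simp add: frechet_derivative_const)
qed simp

lemma Ck_on_bounded_linear:
  assumes "open S" "bounded_linear L" "Ck_on n S f"
  shows "Ck_on n S (\<lambda>u. L (f u))"
  using assms(3)
proof (induction n arbitrary: f)
  case 0
  then show ?case
    using assms(2) by (auto intro: linear_continuous_on_compose bounded_linear.continuous_on)
next
  case (Suc n)
  show ?case
  proof (rule Ck_on_SucI[OF assms(1)])
    fix u assume "u \<in> S"
    from bounded_linear.has_derivative[OF assms(2) Ck_on_SucD[OF Suc.prems this]]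
    show "((\<lambda>u. L (f u)) has_derivative (\<lambda>v. L (frechet_derivative f (at u) v))) (at u)" .
  next
    fix v show "Ck_on n S (\<lambda>u. L (frechet_derivative f (at u) v))"
      using Suc.prems by (intro Suc.IH) auto
  qed
qed

lemma Ck_on_id: "open S \<Longrightarrow> Ck_on n S (\<lambda>u. u)"
proof (cases n)
  case (Suc m)
  assume "open S"
  then show ?thesis unfolding Suc
    by (intro Ck_on_SucI[where f'="\<lambda>u v. v"]) (auto intro: Ck_on_const)
qed auto

lemma Ck_on_linear: "open S \<Longrightarrow> bounded_linear L \<Longrightarrow> Ck_on n S L"
  using Ck_on_bounded_linear[OF _ _ Ck_on_id] by blast

lemma Ck_on_add:
  assumes "open S" "Ck_on n S f" "Ck_on n S g"
  shows "Ck_on n S (\<lambda>u. f u + g u)"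
  using assms(2,3)
proof (induction n arbitrary: f g)
  case 0
  then show ?case by (auto intro: continuous_intros)
next
  case (Suc n)
  show ?case
  proof (rule Ck_on_SucI[OF assms(1)])
    fix u assume "u \<in> S"
    from has_derivative_add[OF Ck_on_SucD[OF Suc.prems(1) this] Ck_on_SucD[OF Suc.prems(2) this]]
    show "((\<lambda>u. f u + g u) has_derivative
      (\<lambda>v. frechet_derivative f (at u) v + frechet_derivative g (at u) v)) (at u)" .
  next
    fix v show "Ck_on n S (\<lambda>u. frechet_derivative f (at u) v + frechet_derivative g (at u) v)"
      using Suc.prems by (intro Suc.IH) auto
  qed
qed

lemma Ck_on_bounded_bilinear:
  assumes "open S" "bounded_bilinear B" "Ck_on n S f" "Ck_on n S g"
  shows "Ck_on n S (\<lambda>u. B (f u) (g u))"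
  using assms(3,4)
proof (induction n arbitrary: f g)
  case 0
  then show ?case using bounded_bilinear.continuous_on[OF assms(2)] by auto
next
  case (Suc n)
  show ?case
  proof (rule Ck_on_SucI[OF assms(1)])
    fix u assume "u \<in> S"
    from bounded_bilinear.FDERIV[OF assms(2) Ck_on_SucD[OF Suc.prems(1) this] Ck_on_SucD[OF Suc.prems(2) this]]
    show "((\<lambda>u. B (f u) (g u)) has_derivative
      (\<lambda>v. B (f u) (frechet_derivative g (at u) v) + B (frechet_derivative f (at u) v) (g u))) (at u)" .
  next
    fix v show "Ck_on n S (\<lambda>u. B (f u) (frechet_derivative g (at u) v) + B (frechet_derivative f (at u) v) (g u))"
      using Suc.prems Ck_on_lower[OF Suc.prems(1)] Ck_on_lower[OF Suc.prems(2)]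
      by (intro Ck_on_add[OF assms(1)] Suc.IH) auto
  qed
qed

lemma Ck_on_sum:
  assumes "open S" "\<And>i. i \<in> I \<Longrightarrow> Ck_on n S (f i)"
  shows "Ck_on n S (\<lambda>u. \<Sum>i\<in>I. f i u)"
  using assms(2)
  by (induction I rule: infinite_finite_induct) (auto intro: Ck_on_const Ck_on_add[OF assms(1)])

lemma Ck_on_minus: "open S \<Longrightarrow> Ck_on n S f \<Longrightarrow> Ck_on n S (\<lambda>u. - f u)"
  by (rule Ck_on_bounded_linear) (auto intro: bounded_linear_minus bounded_linear_ident)

lemma Ck_on_diff: "open S \<Longrightarrow> Ck_on n S f \<Longrightarrow> Ck_on n S g \<Longrightarrow> Ck_on n S (\<lambda>u. f u - g u)"
  using Ck_on_add[of S n f "\<lambda>u. - g u"] Ck_on_minus[of S n g] by simp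

lemma Ck_on_mult:
  fixes f g :: "'a::real_normed_vector \<Rightarrow> 'b::real_normed_algebra"
  shows "open S \<Longrightarrow> Ck_on n S f \<Longrightarrow> Ck_on n S g \<Longrightarrow> Ck_on n S (\<lambda>u. f u * g u)"
  by (rule Ck_on_bounded_bilinear[OF _ bounded_bilinear_mult])

lemma Ck_on_scaleR:
  "open S \<Longrightarrow> Ck_on n S f \<Longrightarrow> Ck_on n S g \<Longrightarrow> Ck_on n S (\<lambda>u. f u *\<^sub>R g u)"
  by (rule Ck_on_bounded_bilinear[OF _ bounded_bilinear_scaleR])

text \<open>In the chain rule the direction in which \<open>g\<close> is differentiated depends on
  the point, whereas \<open>Ck_on\<close> controls derivatives in fixed directions only. Expanding
  that direction in \<open>Basis\<close> leaves a finite sum of products to which the induction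
  hypothesis applies.\<close>

lemma Ck_on_compose:
  fixes f :: "'a::real_normed_vector \<Rightarrow> 'b::euclidean_space"
  assumes "open S" "open T" "f ` S \<subseteq> T" "Ck_on n S f" "Ck_on n T g"
  shows "Ck_on n S (\<lambda>u. g (f u))"
  using assms(4,5)
proof (induction n arbitrary: g)
  case 0
  then show ?case using assms(3) by (auto intro: continuous_on_compose2)
next
  case (Suc n)
  have "((\<lambda>u. g (f u)) has_derivative (\<lambda>v. \<Sum>b\<in>Basis. (frechet_derivative f (at u) v \<bullet> b) *\<^sub>R
      frechet_derivative g (at (f u)) b)) (at u)" if "u \<in> S" for u
  proof -
    let ?F = "frechet_derivative f (at u)" and ?G = "frechet_derivative g (at (f u))"
    have F: "(f has_derivative ?F) (at u)" using Ck_on_SucD[OF Suc.prems(1) that] .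
    have G: "(g has_derivative ?G) (at (f u))"
      using assms(3) that by (intro Ck_on_SucD[OF Suc.prems(2)]) auto
    have lin: "linear ?G" using G has_derivative_linear by blast
    have eq: "?G w = (\<Sum>b\<in>Basis. (w \<bullet> b) *\<^sub>R ?G b)" for w
    proof -
      have "?G w = ?G (\<Sum>b\<in>Basis. (w \<bullet> b) *\<^sub>R b)" by (simp add: euclidean_representation)
      also have "\<dots> = (\<Sum>b\<in>Basis. ?G ((w \<bullet> b) *\<^sub>R b))" by (rule linear_sum[OF lin])
      also have "\<dots> = (\<Sum>b\<in>Basis. (w \<bullet> b) *\<^sub>R ?G b)" by (simp only: linear_scale[OF lin])
      finally show ?thesis .
    qed
    have "(\<lambda>v. ?G (?F v)) = (\<lambda>v. \<Sum>b\<in>Basis. (?F v \<bullet> b) *\<^sub>R ?G b)"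
      by (rule ext) (rule eq)
    then show ?thesis using has_derivative_compose[OF F G] by (simp only:)
  qed
  moreover have "Ck_on n S (\<lambda>u. \<Sum>b\<in>Basis. (frechet_derivative f (at u) v \<bullet> b) *\<^sub>R
      frechet_derivative g (at (f u)) b)" for v
  proof (intro Ck_on_sum Ck_on_scaleR assms(1))
    fix b :: 'b
    show "Ck_on n S (\<lambda>u. frechet_derivative f (at u) v \<bullet> b)"
      using Suc.prems(1) by (intro Ck_on_bounded_linear[OF assms(1) bounded_linear_inner_left]) auto
    show "Ck_on n S (\<lambda>u. frechet_derivative g (at (f u)) b)"
      using Suc.prems Ck_on_lower[OF Suc.prems(1)] by (intro Suc.IH) auto
  qed
  ultimately show ?case by (rule Ck_on_SucI[OF assms(1)])
qed

text \<open>The derivative of \<open>inverse\<close> is a polynomial in \<open>inverse\<close>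
  itself, so regularity of order n reproduces itself at order n + 1.\<close>

lemma Ck_on_inverse_aux: "Ck_on n {x::real. x \<noteq> 0} inverse"
proof (induction n)
  case 0
  then show ?case by (auto intro!: continuous_intros)
next
  case (Suc n)
  have o: "open {x::real. x \<noteq> 0}" by (simp add: open_Collect_neq)
  show ?case
  proof (rule Ck_on_SucI[OF o])
    fix x :: real assume "x \<in> {x. x \<noteq> 0}"
    then show "(inverse has_derivative (\<lambda>v. - (inverse x * v * inverse x))) (at x)"
      using has_derivative_inverse'[of x] by simp
  next
    fix v :: real
    show "Ck_on n {x. x \<noteq> 0} (\<lambda>x. - (inverse x * v * inverse x))"
      by (intro Ck_on_minus Ck_on_mult Suc Ck_on_const o)
  qed
qed

lemma Ck_on_inverse:
  fixes f :: "'a::real_normed_vector \<Rightarrow> real"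
  assumes "open S" "Ck_on n S f" "\<And>u. u \<in> S \<Longrightarrow> f u \<noteq> 0"
  shows "Ck_on n S (\<lambda>u. inverse (f u))"
  by (rule Ck_on_compose[OF assms(1) _ _ assms(2) Ck_on_inverse_aux])
     (auto simp: assms(3) simp: open_Collect_neq)

lemma Ck_on_divide:
  fixes f :: "'a::real_normed_vector \<Rightarrow> real"
  assumes "open S" "Ck_on n S f" "Ck_on n S g" "\<And>u. u \<in> S \<Longrightarrow> g u \<noteq> 0"
  shows "Ck_on n S (\<lambda>u. f u / g u)"
  unfolding divide_inverse by (intro Ck_on_mult Ck_on_inverse assms)

lemma Ck_on_sqrt_aux: "Ck_on n {0<..} sqrt"
proof (induction n)
  case 0
  then show ?case by (auto intro!: continuous_intros)
next
  case (Suc n)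
  have o: "open {0::real<..}" by simp
  show ?case
  proof (rule Ck_on_SucI[OF o])
    fix x :: real assume x: "x \<in> {0<..}"
    then have "(sqrt has_real_derivative inverse (sqrt x) / 2) (at x)" by (auto intro: DERIV_real_sqrt)
    then show "(sqrt has_derivative (\<lambda>v. (inverse (sqrt x) / 2) * v)) (at x)"
      by (simp only: has_field_derivative_def)
  next
    fix v :: real
    show "Ck_on n {0<..} (\<lambda>x. inverse (sqrt x) / 2 * v)"
      by (intro Ck_on_divide Ck_on_inverse Ck_on_mult Suc Ck_on_const o) auto
  qed
qed

lemma Ck_on_sqrt:
  fixes f :: "'a::real_normed_vector \<Rightarrow> real"
  assumes "open S" "Ck_on n S f" "\<And>u. u \<in> S \<Longrightarrow> f u > 0"
  shows "Ck_on n S (\<lambda>u. sqrt (f u))"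
  by (rule Ck_on_compose[OF assms(1) _ _ assms(2) Ck_on_sqrt_aux]) (auto simp: assms(3))

lemma Ck_on_Pair:
  assumes "open S" "Ck_on n S f" "Ck_on n S g"
  shows "Ck_on n S (\<lambda>u. (f u, g u))"
proof -
  have l: "bounded_linear (\<lambda>x::'b. (x, 0::'c))" "bounded_linear (\<lambda>x::'c. (0::'b, x))"
    by (auto intro!: bounded_linear_Pair bounded_linear_ident bounded_linear_zero)
  have "Ck_on n S (\<lambda>u. (f u, 0) + (0, g u))"
    by (intro Ck_on_add Ck_on_bounded_linear[OF assms(1) l(1)] Ck_on_bounded_linear[OF assms(1) l(2)] assms)
  then show ?thesis by simp
qed

lemma Ck_on_vec:
  fixes f :: "'a::real_normed_vector \<Rightarrow> 'b::euclidean_space^'n"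
  assumes "open S" "\<And>i. Ck_on n S (\<lambda>u. f u $ i)"
  shows "Ck_on n S f"
proof -
  have l: "bounded_linear (axis i :: 'b \<Rightarrow> 'b^'n)" for i
    by (rule linear_conv_bounded_linear[THEN iffD1])
      (auto intro!: linearI simp: vec_eq_iff axis_def)
  have "Ck_on n S (\<lambda>u. \<Sum>i\<in>UNIV. axis i (f u $ i))"
    by (intro Ck_on_sum Ck_on_bounded_linear[OF assms(1) l] assms)
  moreover have "(\<Sum>i\<in>UNIV. axis i (f u $ i)) = f u" for u
    by (simp add: vec_eq_iff axis_def if_distrib cong: if_cong)
  ultimately show ?thesis by simp
qed

lemma Ck_on_nth: "open S \<Longrightarrow> Ck_on n S f \<Longrightarrow> Ck_on n S (\<lambda>u. f u $ i)"
  by (rule Ck_on_bounded_linear[OF _ bounded_linear_vec_nth])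

lemma smooth_on_imp_Ck_on: "smooth_on S f \<Longrightarrow> Ck_on n S f"
  by (simp add: smooth_on_def)

lemma smooth_on_has_derivative:
  "smooth_on S f \<Longrightarrow> u \<in> S \<Longrightarrow> (f has_derivative frechet_derivative f (at u)) (at u)"
  by (rule Ck_on_SucD[of 0]) (rule smooth_on_imp_Ck_on)

lemma smooth_on_frechet_derivative:
  "smooth_on S f \<Longrightarrow> smooth_on S (\<lambda>u. frechet_derivative f (at u) v)"
  unfolding smooth_on_def by (metis Ck_on.simps(2))

section \<open>Symmetry of second derivatives\<close>

lemma has_derivative_along_line:
  fixes f :: "'a::real_normed_vector \<Rightarrow> real"
  assumes "(f has_derivative D) (at (a + t *\<^sub>R v))"
  shows "((\<lambda>s. f (a + s *\<^sub>R v)) has_real_derivative D v) (at t)"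
proof -
  have "((\<lambda>s. a + s *\<^sub>R v) has_derivative (\<lambda>s. s *\<^sub>R v)) (at t)"
    by (auto intro!: derivative_eq_intros)
  from has_derivative_compose[OF this assms]
  have "((\<lambda>s. f (a + s *\<^sub>R v)) has_derivative (\<lambda>s. D (s *\<^sub>R v))) (at t)" .
  moreover have "D (s *\<^sub>R v) = D v * s" for s
    using has_derivative_linear[OF assms] by (simp add: linear_scale)
  ultimately show ?thesis by (simp add: has_field_derivative_def)
qed

text \<open>Both iterated derivatives are limits of the same second difference quotient.\<close>

lemma frechet_derivative_commute:
  fixes f :: "'a::real_normed_vector \<Rightarrow> real"
  assumes "open S" "u \<in> S" "Ck_on 2 S f"
  shows "frechet_derivative (\<lambda>x. frechet_derivative f (at x) v) (at u) w =
    frechet_derivative (\<lambda>x. frechet_derivative f (at x) w) (at u) v"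
proof -
  define D where "D v x = frechet_derivative f (at x) v" for v x
  define E where "E v w x = frechet_derivative (D v) (at x) w" for v w x
  have Suc2: "Ck_on (Suc (Suc 0)) S f" using assms(3) by (simp add: numeral_2_eq_2)
  have fD: "(f has_derivative (\<lambda>v. D v x)) (at x)" if "x \<in> S" for x
    using Ck_on_SucD[OF Suc2 that] by (simp add: D_def)
  have CD: "Ck_on (Suc 0) S (D v)" for v
    using Suc2 unfolding D_def by simp
  have DE: "(D v has_derivative (\<lambda>w. E v w x)) (at x)" if "x \<in> S" for x v
    using Ck_on_SucD[OF CD that] by (simp add: E_def)
  have contE: "continuous_on S (E v w)" for v w
    using CD[of v] by (simp add: E_def[abs_def])
  obtain r where r: "r > 0" "ball u r \<subseteq> S" using assms(1,2) open_contains_ball by blast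
  \<comment> \<open>The summand 1 keeps \<open>N\<close> positive even for v = w = 0;
    \<open>s * N\<close> bounds every displacement with coefficients of size at most
    \<open>s\<close>.\<close>
  define N where "N = norm v + norm w + 1"
  have N: "N > 0" by (simp add: N_def add_nonneg_pos)
  have in_ball: "u + (a *\<^sub>R p + b *\<^sub>R q) \<in> ball u \<delta>"
    if "\<bar>a\<bar> \<le> s" "\<bar>b\<bar> \<le> s" "s > 0" "s * N < \<delta>" "norm p + norm q + 1 = N" for a b p q \<delta> s
  proof -
    have "norm (a *\<^sub>R p + b *\<^sub>R q) \<le> s * norm p + s * norm q"
      using that by (intro norm_triangle_le add_mono) (auto intro: mult_right_mono)
    also have "\<dots> \<le> s * N" using that by (simp add: that(5)[symmetric] algebra_simps)
    finally have "dist (u + (a *\<^sub>R p + b *\<^sub>R q)) u < \<delta>" using that by (simp add: dist_norm)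
    then show ?thesis by (simp add: dist_commute)
  qed
  define \<Delta> where "\<Delta> s = f (u + (s *\<^sub>R v + s *\<^sub>R w)) - f (u + s *\<^sub>R v) - f (u + s *\<^sub>R w) + f u" for s
  \<comment> \<open>The mean value theorem is applied along \<open>p\<close> and then along
    \<open>q\<close>. Exchanging \<open>p\<close> and \<open>q\<close> leaves the second difference
    unchanged, so it equals values of both mixed derivatives, at possibly different points of the
    ball.\<close>
  have key: "\<exists>x \<in> ball u \<delta>. f (u + (s *\<^sub>R p + s *\<^sub>R q)) - f (u + s *\<^sub>R p) - f (u + s *\<^sub>R q) + f u = s * (s * E p q x)"
    if s: "s > 0" "s * N < \<delta>" and \<delta>: "\<delta> \<le> r" and pq: "norm p + norm q + 1 = N" for s p q \<delta>
  proof -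
    define \<phi> where "\<phi> a = f ((u + s *\<^sub>R q) + a *\<^sub>R p) - f (u + a *\<^sub>R p)" for a
    have inS: "u + (a *\<^sub>R p + b *\<^sub>R q) \<in> S" if "\<bar>a\<bar> \<le> s" "\<bar>b\<bar> \<le> s" for a b
      using in_ball[OF that s pq] r(2) \<delta> subset_ball[of \<delta> r u] by blast
    have d\<phi>: "(\<phi> has_real_derivative (D p ((u + s *\<^sub>R q) + a *\<^sub>R p) - D p (u + a *\<^sub>R p))) (at a)"
      if "0 \<le> a" "a \<le> s" for a
      unfolding \<phi>_def
      using inS[of a s] inS[of a 0] that
      by (intro DERIV_diff has_derivative_along_line fD) (auto simp: algebra_simps)
    obtain a where a: "0 < a" "a < s" "\<phi> s - \<phi> 0 = (s - 0) * (D p ((u + s *\<^sub>R q) + a *\<^sub>R p) - D p (u + a *\<^sub>R p))"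
      using MVT2[OF s(1) d\<phi>] by auto
    have d2: "((\<lambda>b. D p ((u + a *\<^sub>R p) + b *\<^sub>R q)) has_real_derivative E p q ((u + a *\<^sub>R p) + b *\<^sub>R q)) (at b)"
      if "0 \<le> b" "b \<le> s" for b
      using inS[of a b] that a by (intro has_derivative_along_line DE) (auto simp: algebra_simps)
    obtain b where b: "0 < b" "b < s" "D p ((u + a *\<^sub>R p) + s *\<^sub>R q) - D p ((u + a *\<^sub>R p) + 0 *\<^sub>R q) =
       (s - 0) * E p q ((u + a *\<^sub>R p) + b *\<^sub>R q)"
      using MVT2[OF s(1) d2] by auto
    have "(u + a *\<^sub>R p) + b *\<^sub>R q \<in> ball u \<delta>"
      using in_ball[of a s b \<delta> p q] a b s pq by (simp add: add.assoc)
    moreover have "f (u + (s *\<^sub>R p + s *\<^sub>R q)) - f (u + s *\<^sub>R p) - f (u + s *\<^sub>R q) + f u = \<phi> s - \<phi> 0"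
      by (simp add: \<phi>_def algebra_simps)
    moreover have "\<dots> = s * (s * E p q ((u + a *\<^sub>R p) + b *\<^sub>R q))"
      using a(3) b(3) by (simp add: add_ac)
    ultimately show ?thesis by auto
  qed
  have "dist (E v w u) (E w v u) < e" if e: "e > 0" for e
  proof -
    obtain d1 where d1: "d1 > 0" "\<And>x. x \<in> S \<Longrightarrow> dist x u < d1 \<Longrightarrow> dist (E v w x) (E v w u) < e/2"
      using contE[of v w] assms(2) e unfolding continuous_on_iff by (meson half_gt_zero)
    obtain d2 where d2: "d2 > 0" "\<And>x. x \<in> S \<Longrightarrow> dist x u < d2 \<Longrightarrow> dist (E w v x) (E w v u) < e/2"
      using contE[of w v] assms(2) e unfolding continuous_on_iff by (meson half_gt_zero)
    define \<delta> where "\<delta> = min r (min d1 d2)"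
    have \<delta>: "\<delta> > 0" "\<delta> \<le> r" using r d1 d2 by (auto simp: \<delta>_def)
    define s where "s = \<delta> / (2 * N)"
    have s: "s > 0" "s * N < \<delta>" using \<delta> N by (auto simp: s_def field_simps)
    obtain x where x: "x \<in> ball u \<delta>" "\<Delta> s = s * (s * E v w x)"
      using key[OF s \<delta>(2), of v w] by (auto simp: \<Delta>_def N_def)
    obtain y where y: "y \<in> ball u \<delta>" "\<Delta> s = s * (s * E w v y)"
      using key[OF s \<delta>(2), of w v] by (auto simp: \<Delta>_def N_def algebra_simps)
    have "E v w x = E w v y" using x(2) y(2) s by simp
    moreover have "x \<in> S" "y \<in> S" using x(1) y(1) r(2) \<delta>(2) by auto
    moreover have "dist x u < d1" "dist y u < d2"
      using x(1) y(1) by (auto simp: \<delta>_def dist_commute)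
    ultimately have "dist (E v w x) (E v w u) < e/2" "dist (E v w x) (E w v u) < e/2"
      using d1(2)[of x] d2(2)[of y] by (simp_all only:)
    then show ?thesis using dist_triangle_half_r by blast
  qed
  then have "E v w u = E w v u"
    using dist_pos_lt by blast
  then show ?thesis by (simp add: E_def D_def[abs_def])
qed


section \<open>Inverse functions, integrals and measures\<close>

lemma linear_vec2: "linear M \<Longrightarrow> M v = v $ 1 *\<^sub>R M (axis 1 1) + v $ 2 *\<^sub>R M (axis 2 1)"
  for M :: "real^2 \<Rightarrow> 'b::real_vector"
proof -
  assume l: "linear M"
  have "v = v $ 1 *\<^sub>R axis 1 1 + v $ 2 *\<^sub>R axis 2 1"
    by (simp add: vec_eq_iff forall_2 axis_def)
  then have "M v = M (v $ 1 *\<^sub>R axis 1 1 + v $ 2 *\<^sub>R axis 2 1)" by simp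
  then show ?thesis by (simp add: linear_add[OF l] linear_scale[OF l])
qed

lemma det_matrix_2:
  "det (matrix M) = M (axis 1 1) $ 1 * M (axis 2 1) $ 2 - M (axis 2 1) $ 1 * M (axis 1 1) $ 2"
  for M :: "real^2 \<Rightarrow> real^2"
  by (simp add: det_2 matrix_def)

text \<open>Cramer's rule. The explicit form shows that the inverse depends smoothly on the matrix
  entries, which drives the bootstrap in \<open>smooth_local_inverse\<close>.\<close>

lemma inv_linear_2:
  fixes M :: "real^2 \<Rightarrow> real^2"
  assumes M: "linear M" "inj M"
  shows "inv M v = vector [(M (axis 2 1) $ 2 * v $ 1 - M (axis 2 1) $ 1 * v $ 2) / det (matrix M),
    (M (axis 1 1) $ 1 * v $ 2 - M (axis 1 1) $ 2 * v $ 1) / det (matrix M)]" (is "_ = ?w")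
proof (rule inv_f_eq[OF M(2)])
  have d: "det (matrix M) \<noteq> 0" using M det_nz_iff_inj by blast
  show "M ?w = v"
    by (subst linear_vec2[OF M(1)], use d in \<open>simp add: vec_eq_iff forall_2 field_simps\<close>)
       (simp add: det_matrix_2 algebra_simps)
qed

text \<open>The inverse function theorem gives a differentiable inverse \<open>r\<close> whose
  derivative at \<open>y\<close> is the inverse of \<open>T' (r y)\<close>. If \<open>r\<close> is n
  times continuously differentiable, so is this expression, hence \<open>r\<close> gains one order;
  induction makes it smooth.\<close>

lemma smooth_local_inverse:
  fixes T :: "real^2 \<Rightarrow> real^2"
  assumes U: "open U" "smooth_on U T" "u0 \<in> U" and inj0: "inj (frechet_derivative T (at u0))"
  obtains U' V r where "open U'" "U' \<subseteq> U" "u0 \<in> U'" "open V" "homeomorphism U' V T r" "smooth_on V r"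
proof -
  define T' where "T' u = frechet_derivative T (at u)" for u
  have T': "(T has_derivative T' u) (at u)" if "u \<in> U" for u
    unfolding T'_def using smooth_on_has_derivative[OF U(2) that] .
  have T'c: "smooth_on U (\<lambda>u. T' u v)" for v
    unfolding T'_def using smooth_on_frechet_derivative[OF U(2)] .
  have bl: "bounded_linear (T' u)" if "u \<in> U" for u
    using T'[OF that] has_derivative_bounded_linear by blast
  define B where "B u = Blinfun (T' u)" for u
  have B: "blinfun_apply (B u) = T' u" if "u \<in> U" for u
    unfolding B_def using bounded_linear_Blinfun_apply[OF bl[OF that]] .
  \<comment> \<open>The inverse function theorem asks for a derivative that is continuous in
    operator norm; in finite dimension continuity in each fixed direction is enough.\<close>
  have contB: "continuous_on U B"
  proof (rule continuous_on_blinfun_componentwise)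
    fix i :: "real^2"
    have "continuous_on U (\<lambda>u. T' u i)" using smooth_on_imp_Ck_on[OF T'c, of 0 i] by simp
    then show "continuous_on U (\<lambda>x. blinfun_apply (B x) i)"
      using B by (simp cong: continuous_on_cong)
  qed
  have lin0: "linear (T' u0)" using bl[OF U(3)] bounded_linear.linear by blast
  obtain g where g: "linear g" "g \<circ> T' u0 = id"
    using linear_injective_left_inverse[OF lin0] inj0 by (auto simp: T'_def)
  have "Blinfun g o\<^sub>L B u0 = id_blinfun"
  proof (rule blinfun_eqI)
    fix i
    have "bounded_linear g" using g(1) linear_conv_bounded_linear by blast
    then show "blinfun_apply (Blinfun g o\<^sub>L B u0) i = blinfun_apply id_blinfun i"
      using g(2) by (simp add: bounded_linear_Blinfun_apply B[OF U(3)] o_def fun_eq_iff)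
  qed
  then obtain U' V r r' where r: "open U'" "U' \<subseteq> U" "u0 \<in> U'" "open V" "homeomorphism U' V T r"
    and r': "\<And>y. y \<in> V \<Longrightarrow> (r has_derivative (r' y)) (at y)"
      "\<And>y. y \<in> V \<Longrightarrow> r' y = inv (blinfun_apply (B (r y)))"
      "\<And>y. y \<in> V \<Longrightarrow> bij (blinfun_apply (B (r y)))"
    using inverse_function_theorem[OF U(1) _ contB U(3), of T "Blinfun g"] T' B by metis
  have rV: "r y \<in> U" if "y \<in> V" for y
    using r(2,5) that unfolding homeomorphism_def by auto
  have linr: "linear (T' (r y))" "inj (T' (r y))" "det (matrix (T' (r y))) \<noteq> 0" if "y \<in> V" for y
  proof -
    show 1: "linear (T' (r y))" using bl[OF rV[OF that]] bounded_linear.linear by blast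
    show 2: "inj (T' (r y))" using r'(3)[OF that] B[OF rV[OF that]] bij_is_inj by metis
    show "det (matrix (T' (r y))) \<noteq> 0" using 1 2 det_nz_iff_inj by blast
  qed
  have "Ck_on n V r" for n
  proof (induction n)
    case 0
    then show ?case using r(5) unfolding homeomorphism_def by simp
  next
    case (Suc n)
    define w :: "real^2 \<Rightarrow> real^2 \<Rightarrow> real^2" where "w y v =
      vector [(T' (r y) (axis 2 1) $ 2 * v $ 1 - T' (r y) (axis 2 1) $ 1 * v $ 2) / det (matrix (T' (r y))),
        (T' (r y) (axis 1 1) $ 1 * v $ 2 - T' (r y) (axis 1 1) $ 2 * v $ 1) / det (matrix (T' (r y)))]" for y v
    have C: "Ck_on n V (\<lambda>y. T' (r y) v $ i)" for v i
      using rV by (intro Ck_on_nth[OF r(4)] Ck_on_compose[OF r(4) U(1) _ Suc smooth_on_imp_Ck_on[OF T'c]]) auto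
    have D: "Ck_on n V (\<lambda>y. det (matrix (T' (r y))))"
      unfolding det_matrix_2 by (intro Ck_on_diff Ck_on_mult C r(4))
    show ?case
    proof (rule Ck_on_SucI[OF r(4)])
      fix y assume y: "y \<in> V"
      have "r' y = w y"
        using r'(2)[OF y] B[OF rV[OF y]] inv_linear_2[OF linr(1,2)[OF y]]
        by (auto simp: w_def)
      then show "(r has_derivative w y) (at y)" using r'(1)[OF y] by simp
    next
      fix v
      show "Ck_on n V (\<lambda>y. w y v)"
      proof (rule Ck_on_vec[OF r(4)])
        fix i :: 2
        consider "i = 1" | "i = 2" using exhaust_2 by blast
        then show "Ck_on n V (\<lambda>y. w y v $ i)"
          by cases (simp_all add: w_def, (intro Ck_on_diff Ck_on_mult C D r(4) Ck_on_divide linr(3) Ck_on_const; assumption)+)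
      qed
    qed
  qed
  then show ?thesis using r that[of U' V r] by (simp add: smooth_on_def)
qed

section \<open>Differentiation under the integral and change of variables\<close>

lemma has_real_derivative_integral_lipschitz:
  fixes f :: "real \<Rightarrow> 'a \<Rightarrow> real"
  assumes d: "d > 0" and int: "\<And>t. \<bar>t - a\<bar> < d \<Longrightarrow> integrable M (f t)"
    and der: "\<And>q. q \<in> space M \<Longrightarrow> ((\<lambda>t. f t q) has_real_derivative f' q) (at a)"
    and lip: "\<And>t q. \<bar>t - a\<bar> < d \<Longrightarrow> q \<in> space M \<Longrightarrow> \<bar>f t q - f a q\<bar> \<le> \<bar>t - a\<bar> * w q"
    and w: "integrable M w"
  shows "integrable M f'"
    and "((\<lambda>t. \<integral>q. f t q \<partial>M) has_real_derivative (\<integral>q. f' q \<partial>M)) (at a)"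
proof -
  \<comment> \<open>Along a null sequence the difference quotients converge pointwise and are
    dominated by \<open>w\<close>, so dominated convergence applies. Measurability of
    \<open>f'\<close> is obtained from the same limit.\<close>
  have main: "integrable M f' \<and>
      (\<lambda>n. ((\<integral>q. f (a + s n) q \<partial>M) - (\<integral>q. f a q \<partial>M)) / s n) \<longlonglongrightarrow> (\<integral>q. f' q \<partial>M)"
    if s: "\<And>n. s n \<noteq> 0" "\<And>n. \<bar>s n\<bar> < d" "s \<longlonglongrightarrow> 0" for s
  proof -
    let ?g = "\<lambda>n q. (f (a + s n) q - f a q) / s n"
    have lim: "(\<lambda>n. ?g n q) \<longlonglongrightarrow> f' q" if "q \<in> space M" for q
      using der[OF that] s(1,3) unfolding DERIV_def LIMSEQ_SEQ_conv[symmetric] by blast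
    have g[measurable]: "?g n \<in> borel_measurable M" for n
      using int[of "a + s n"] int[of a] s(2)[of n] d
      by (intro borel_measurable_divide borel_measurable_diff borel_measurable_const) auto
    have m: "f' \<in> borel_measurable M"
      by (rule borel_measurable_LIMSEQ_real[OF lim g])
    have b: "norm (?g n q) \<le> w q" if "q \<in> space M" for n q
      using lip[OF _ that, of "a + s n"] s(1,2)[of n]
      by (simp add: abs_divide divide_le_eq mult.commute)
    have i: "integrable M f'"
      by (rule integrable_dominated_convergence[where s="?g", OF m g w]) (use lim b in \<open>auto simp del: real_norm_def\<close>)
    have "(\<lambda>n. \<integral>q. ?g n q \<partial>M) \<longlonglongrightarrow> (\<integral>q. f' q \<partial>M)"
      by (rule integral_dominated_convergence[where s="?g", OF m g w]) (use lim b in \<open>auto simp del: real_norm_def\<close>)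
    moreover have "(\<integral>q. ?g n q \<partial>M) = ((\<integral>q. f (a + s n) q \<partial>M) - (\<integral>q. f a q \<partial>M)) / s n" for n
      using int[of "a + s n"] int[of a] s(2)[of n] d by simp
    ultimately show ?thesis using i by (simp only: simp_thms)
  qed
  \<comment> \<open>One concrete null sequence is enough for the integrability of \<open>f'\<close>;
    the shift by 2 keeps all terms strictly below \<open>d\<close>, including the one for n =
    0.\<close>
  have lim0: "(\<lambda>n. d / real (n + 2)) \<longlonglongrightarrow> 0"
    using LIMSEQ_ignore_initial_segment[OF lim_const_over_n[of d], of 2] by simp
  show "integrable M f'"
  proof (rule main[of "\<lambda>n. d / real (n + 2)", THEN conjunct1, OF _ _ lim0])
    fix n
    show "d / real (n + 2) \<noteq> 0" using d by simp
    have "d / real (n + 2) < d / 1" using d by (intro divide_strict_left_mono) auto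
    then show "\<bar>d / real (n + 2)\<bar> < d" using d by simp
  qed
  show "((\<lambda>t. \<integral>q. f t q \<partial>M) has_real_derivative (\<integral>q. f' q \<partial>M)) (at a)"
    unfolding DERIV_def LIMSEQ_SEQ_conv[symmetric]
  proof (intro allI impI)
    fix s :: "nat \<Rightarrow> real" assume s: "(\<forall>n. s n \<noteq> 0) \<and> s \<longlonglongrightarrow> 0"
    then have "eventually (\<lambda>n. \<bar>s n\<bar> < d) sequentially"
      using d by (auto simp: tendsto_iff dist_real_def)
    then obtain N where N: "\<And>n. n \<ge> N \<Longrightarrow> \<bar>s n\<bar> < d" by (auto simp: eventually_sequentially)
    show "(\<lambda>n. ((\<integral>q. f (a + s n) q \<partial>M) - (\<integral>q. f a q \<partial>M)) / s n) \<longlonglongrightarrow> (\<integral>q. f' q \<partial>M)"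
      by (rule LIMSEQ_offset[of _ N])
        (use main[of "\<lambda>n. s (n + N)"] s N LIMSEQ_ignore_initial_segment in auto)
  qed
qed

text \<open>The library formula concerns images of finite measure. The infinite case follows by
  contraposition: a finite integral of the Jacobian would force the image to have finite
  measure.\<close>

lemma emeasure_lborel_image:
  fixes T :: "real^'n::{finite,wellorder} \<Rightarrow> real^'n::_"
  assumes B: "B \<in> sets borel" "T ` B \<in> sets borel"
    and der: "\<And>u. u \<in> B \<Longrightarrow> (T has_derivative T' u) (at u)" and inj: "inj_on T B"
    and meas: "(\<lambda>u. indicator B u * \<bar>det (matrix (T' u))\<bar>) \<in> borel_measurable borel"
  shows "emeasure lborel (T ` B) = (\<integral>\<^sup>+u. indicator B u * ennreal \<bar>det (matrix (T' u))\<bar> \<partial>lborel)"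
proof -
  have BL: "B \<in> sets lebesgue" using B by simp
  have der': "(T has_derivative T' u) (at u within B)" if "u \<in> B" for u
    using der[OF that] has_derivative_at_withinI by blast
  note hm = has_measure_differentiable_image[OF BL der' inj]
  have ieq: "(\<integral>\<^sup>+u. indicator B u * ennreal \<bar>det (matrix (T' u))\<bar> \<partial>lborel) =
     (\<integral>\<^sup>+u. ennreal (indicator B u * \<bar>det (matrix (T' u))\<bar>) \<partial>lborel)"
    by (intro nn_integral_cong) (simp split: split_indicator)
  show ?thesis
  proof (cases "emeasure lborel (T ` B) = \<infinity>")
    case False
    then have "T ` B \<in> lmeasurable" using B(2) by (auto simp: fmeasurable_def top.not_eq_extremum)
    then have "((\<lambda>x. \<bar>det (matrix (T' x))\<bar>) has_integral measure lebesgue (T ` B)) B"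
      using hm by blast
    from nn_integral_has_integral_lebesgue[OF _ this]
    have "(\<integral>\<^sup>+u. indicator B u * ennreal \<bar>det (matrix (T' u))\<bar> \<partial>lborel) = ennreal (measure lebesgue (T ` B))"
      unfolding ieq by simp
    moreover have "emeasure lborel (T ` B) = ennreal (measure lborel (T ` B))"
      using False by (simp add: emeasure_eq_ennreal_measure)
    ultimately show ?thesis using B(2) by simp
  next
    case True
    have "(\<integral>\<^sup>+u. ennreal (indicator B u * \<bar>det (matrix (T' u))\<bar>) \<partial>lborel) = \<infinity>"
    proof (rule ccontr)
      assume "\<not> ?thesis"
      then have "(\<lambda>u. indicator B u * \<bar>det (matrix (T' u))\<bar>) integrable_on UNIV"
        using meas by (intro nn_integral_integrable_on) (auto simp: top.not_eq_extremum)
      then have "(\<lambda>u. \<bar>det (matrix (T' u))\<bar>) integrable_on B"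
        by (subst integrable_restrict_UNIV[symmetric])
           (auto elim!: integrable_eq simp: indicator_def)
      then have "T ` B \<in> lmeasurable"
        using measurable_differentiable_image_eq[OF BL der' inj] by blast
      then show False using True B(2) by (simp add: fmeasurable_def)
    qed
    then show ?thesis using True ieq by simp
  qed
qed

text \<open>The auxiliary measure is infinite on sets not contained in \<open>W\<close>, hence an upper bound.\<close>

lemma emeasure_SUP_local:
  fixes m :: "'i \<Rightarrow> 'a::topological_space measure"
  assumes sets_m: "\<And>i. i \<in> I \<Longrightarrow> sets (m i) = sets borel" and N: "sets N = sets borel"
    and le: "\<And>i A. i \<in> I \<Longrightarrow> A \<in> sets borel \<Longrightarrow> A \<subseteq> W \<Longrightarrow> emeasure (m i) A \<le> emeasure N A"
    and i0: "i0 \<in> I" "\<And>A. A \<in> sets borel \<Longrightarrow> A \<subseteq> W \<Longrightarrow> emeasure (m i0) A = emeasure N A"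
    and A: "A \<in> sets borel" "A \<subseteq> W"
  shows "emeasure (SUP i\<in>I. m i) A = emeasure N A"
proof -
  have sets_S: "sets (SUP i\<in>I. m i) = sets borel"
    by (rule sets_SUP) (use sets_m i0 in auto)
  define \<mu> where "\<mu> A = (if A \<subseteq> W then emeasure N A else \<infinity>)" for A
  define L where "L = measure_of UNIV (sets borel) \<mu>"
  have sets_L: "sets L = sets (borel :: 'a measure)"
    unfolding L_def by (metis sets.sigma_sets_eq sets_measure_of space_borel subset_Pow_Union top_greatest sets.space_closed)
  have L: "emeasure L B = \<mu> B" if "B \<in> sets borel" for B
  proof (rule emeasure_measure_of[OF L_def])
    show "sets borel \<subseteq> Pow (UNIV :: 'a set)" by simp
    show "B \<in> sets L" using that sets_L by simp
    show "positive (sets L) \<mu>" by (simp add: positive_def \<mu>_def)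
    show "countably_additive (sets L) \<mu>"
    proof (rule countably_additiveI)
      fix C :: "nat \<Rightarrow> 'a set"
      assume C: "range C \<subseteq> sets L" "disjoint_family C" "\<Union> (range C) \<in> sets L"
      show "(\<Sum>i. \<mu> (C i)) = \<mu> (\<Union> (range C))"
      proof (cases "\<Union> (range C) \<subseteq> W")
        case True
        then have "\<mu> (C i) = emeasure N (C i)" for i by (auto simp: \<mu>_def)
        then show ?thesis
          using True C suminf_emeasure[of C N] sets_L N by (simp add: \<mu>_def)
      next
        case False
        then obtain i where "\<not> C i \<subseteq> W" by auto
        then have "\<mu> (C i) = \<infinity>" by (simp add: \<mu>_def)
        moreover have "\<mu> (C i) \<le> (\<Sum>i. \<mu> (C i))"
          using sum_le_suminf[of "\<lambda>i. \<mu> (C i)" "{i}"] by simp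
        ultimately show ?thesis using False by (simp add: \<mu>_def top_unique)
      qed
    qed
  qed
  have "(SUP i\<in>I. m i) \<le> L"
  proof (rule SUP_least)
    fix i assume "i \<in> I"
    then show "m i \<le> L"
      using sets_m sets_L L le by (subst le_measure) (auto simp: \<mu>_def)
  qed
  then have "emeasure (SUP i\<in>I. m i) A \<le> emeasure L A"
    by (rule le_measureD3) (simp add: sets_S sets_L)
  moreover have "m i0 \<le> (SUP i\<in>I. m i)" by (rule SUP_upper[OF i0(1)])
  then have "emeasure (m i0) A \<le> emeasure (SUP i\<in>I. m i) A"
    by (rule le_measureD3) (simp add: sets_S sets_m[OF i0(1)])
  ultimately show ?thesis using L[OF A(1)] i0(2)[OF A] A(2) by (simp add: \<mu>_def)
qed


section \<open>Local homeomorphisms onto a Euclidean space\<close>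

text \<open>Separated from the surface because it serves for two maps: the base projection of the
  surface, and the product of that projection with the time axis.\<close>

locale etale =
  fixes P :: "'m::t2_space \<Rightarrow> 'b::euclidean_space"
  assumes cont: "continuous_on UNIV P"
    and open_map: "open U \<Longrightarrow> open (P ` U)"
    and loc_inj: "\<exists>W. open W \<and> q \<in> W \<and> inj_on P W"
begin

definition sheet :: "'m set \<Rightarrow> bool" where
  "sheet W \<longleftrightarrow> open W \<and> inj_on P W"

lemma ex_sheet: "open U \<Longrightarrow> q \<in> U \<Longrightarrow> \<exists>W. sheet W \<and> q \<in> W \<and> W \<subseteq> U"
proof -
  assume "open U" "q \<in> U"
  moreover obtain W where "open W" "q \<in> W" "inj_on P W" using loc_inj by blast
  ultimately show ?thesis
    by (intro exI[of _ "W \<inter> U"]) (auto simp: sheet_def intro: inj_on_subset)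
qed

lemma sheet_subset: "sheet W \<Longrightarrow> open W' \<Longrightarrow> W' \<subseteq> W \<Longrightarrow> sheet W'"
  by (auto simp: sheet_def intro: inj_on_subset)

lemma open_sheet: "sheet W \<Longrightarrow> open W" by (simp add: sheet_def)

lemma open_image_sheet: "sheet W \<Longrightarrow> open (P ` W)"
  by (simp add: sheet_def open_map)

lemma inv_P: "sheet W \<Longrightarrow> q \<in> W \<Longrightarrow> inv_into W P (P q) = q"
  by (simp add: sheet_def)

lemma P_inv: "y \<in> P ` W \<Longrightarrow> P (inv_into W P y) = y"
  by (rule f_inv_into_f)

lemma inv_in: "y \<in> P ` W \<Longrightarrow> inv_into W P y \<in> W"
  by (rule inv_into_into)

text \<open>The point \<open>y\<close> has to come from a common point of the two sheets: distinct
  sheets can lie over the same part of the base, and there the two inverses disagree.\<close>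

lemma inv_subset:
  assumes "sheet W" "sheet W'" "y \<in> P ` (W \<inter> W')"
  shows "inv_into W' P y = inv_into W P y"
proof -
  obtain q where "q \<in> W" "q \<in> W'" "y = P q" using assms(3) by auto
  then show ?thesis using inv_P assms(1,2) by simp
qed

lemma image_eq_vimage: "sheet W \<Longrightarrow> P ` (A \<inter> W) = inv_into W P -` A \<inter> P ` W"
  using inv_P by (auto intro: P_inv[symmetric] inv_in simp: image_iff)

lemma continuous_on_inv: "sheet W \<Longrightarrow> continuous_on (P ` W) (inv_into W P)"
  using image_eq_vimage[of W] open_map open_image_sheet[of W] open_sheet[of W]
  by (metis continuous_on_open_vimage open_Int)

lemma sheet_image_borel:
  assumes "sheet W" "A \<in> sets borel" "A \<subseteq> W"
  shows "P ` A \<in> sets borel"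
proof -
  have "inv_into W P -` A \<inter> P ` W \<in> sets borel"
    using measurable_sets[OF borel_measurable_continuous_on_restrict[OF continuous_on_inv[OF assms(1)]] assms(2)]
      open_image_sheet[OF assms(1)]
    by (simp add: space_restrict_space sets_restrict_space_iff)
  then show ?thesis
    using image_eq_vimage[OF assms(1), of A] assms(3) by (simp add: Int_absorb2)
qed

section \<open>Smoothness and derivatives read through sheets\<close>

definition base_Ck :: "nat \<Rightarrow> 'm set \<Rightarrow> ('m \<Rightarrow> real) \<Rightarrow> bool" where
  "base_Ck n U g \<longleftrightarrow> (\<forall>W. sheet W \<and> W \<subseteq> U \<longrightarrow> Ck_on n (P ` W) (\<lambda>y. g (inv_into W P y)))"

text \<open>The choice of the sheet is immaterial by \<open>base_deriv_sheet\<close>, since the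
  inverses of two sheets through \<open>q\<close> agree near \<open>P q\<close>.\<close>

definition base_deriv :: "'b \<Rightarrow> ('m \<Rightarrow> real) \<Rightarrow> 'm \<Rightarrow> real" where
  "base_deriv v g q =
     frechet_derivative (\<lambda>y. g (inv_into (SOME W. sheet W \<and> q \<in> W) P y)) (at (P q)) v"

text \<open>\<open>base_Ck\<close> quantifies over all sheets in \<open>U\<close>, which makes
  restriction trivial; here one sheet around each point is shown to be enough, because on overlaps
  the local inverses coincide.\<close>

lemma base_Ck_local:
  assumes "\<And>q. q \<in> U \<Longrightarrow> \<exists>W. sheet W \<and> q \<in> W \<and> Ck_on n (P ` W) (\<lambda>y. g (inv_into W P y))"
  shows "base_Ck n U g"
  unfolding base_Ck_def
proof (intro allI impI, elim conjE)
  fix W assume W: "sheet W" "W \<subseteq> U"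
  show "Ck_on n (P ` W) (\<lambda>y. g (inv_into W P y))"
  proof (rule Ck_on_local)
    fix y assume y: "y \<in> P ` W"
    define q where "q = inv_into W P y"
    have q: "q \<in> W" "P q = y" using inv_in[OF y] P_inv[OF y] by (auto simp: q_def)
    obtain W' where W': "sheet W'" "q \<in> W'" "Ck_on n (P ` W') (\<lambda>y. g (inv_into W' P y))"
      using assms q W(2) by blast
    have o: "open (P ` (W \<inter> W'))" using W W' by (intro open_map) (auto simp: open_sheet)
    have "Ck_on n (P ` (W \<inter> W')) (\<lambda>y. g (inv_into W' P y))"
      by (rule Ck_on_subset[OF W'(3)]) auto
    then have "Ck_on n (P ` (W \<inter> W')) (\<lambda>y. g (inv_into W P y))"
      using Ck_on_cong[OF o, of "\<lambda>y. g (inv_into W' P y)" "\<lambda>y. g (inv_into W P y)" n]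
        inv_subset[OF W(1) W'(1)] by auto
    then show "\<exists>T. open T \<and> y \<in> T \<and> Ck_on n T (\<lambda>y. g (inv_into W P y))"
      using o q W'(2) by (intro exI[of _ "P ` (W \<inter> W')"]) auto
  qed
qed

lemma base_Ck_sheet:
  "base_Ck n U g \<Longrightarrow> sheet W \<Longrightarrow> W \<subseteq> U \<Longrightarrow> Ck_on n (P ` W) (\<lambda>y. g (inv_into W P y))"
  by (simp add: base_Ck_def)

lemma base_Ck_subset: "base_Ck n U g \<Longrightarrow> V \<subseteq> U \<Longrightarrow> base_Ck n V g"
  by (auto simp: base_Ck_def)

lemma base_Ck_cong:
  assumes "\<And>q. q \<in> U \<Longrightarrow> f q = g q"
  shows "base_Ck n U f \<longleftrightarrow> base_Ck n U g"
proof -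
  have "Ck_on n (P ` W) (\<lambda>y. f (inv_into W P y)) \<longleftrightarrow> Ck_on n (P ` W) (\<lambda>y. g (inv_into W P y))"
    if "sheet W" "W \<subseteq> U" for W
    by (rule Ck_on_cong[OF open_image_sheet[OF that(1)]]) (use assms inv_in that in blast)
  then show ?thesis by (auto simp: base_Ck_def)
qed

lemma base_Ck_open_cover:
  assumes "\<And>q. q \<in> U \<Longrightarrow> \<exists>V. open V \<and> q \<in> V \<and> base_Ck n V g"
  shows "base_Ck n U g"
proof (rule base_Ck_local)
  fix q assume "q \<in> U"
  then obtain V where V: "open V" "q \<in> V" "base_Ck n V g" using assms by blast
  then obtain W where "sheet W" "q \<in> W" "W \<subseteq> V" using ex_sheet by blast
  then show "\<exists>W. sheet W \<and> q \<in> W \<and> Ck_on n (P ` W) (\<lambda>y. g (inv_into W P y))"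
    using V(3) base_Ck_sheet by blast
qed

lemma base_Ck_const: "base_Ck n U (\<lambda>q. c)"
  by (auto simp: base_Ck_def intro: Ck_on_const)

lemma base_Ck_add: "base_Ck n U f \<Longrightarrow> base_Ck n U g \<Longrightarrow> base_Ck n U (\<lambda>q. f q + g q)"
  by (auto simp: base_Ck_def intro!: Ck_on_add open_image_sheet)

lemma base_Ck_diff: "base_Ck n U f \<Longrightarrow> base_Ck n U g \<Longrightarrow> base_Ck n U (\<lambda>q. f q - g q)"
  by (auto simp: base_Ck_def intro!: Ck_on_diff open_image_sheet)

lemma base_Ck_minus: "base_Ck n U f \<Longrightarrow> base_Ck n U (\<lambda>q. - f q)"
  by (auto simp: base_Ck_def intro!: Ck_on_minus open_image_sheet)

lemma base_Ck_mult: "base_Ck n U f \<Longrightarrow> base_Ck n U g \<Longrightarrow> base_Ck n U (\<lambda>q. f q * g q)"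
  by (auto simp: base_Ck_def intro!: Ck_on_mult open_image_sheet)

lemma base_Ck_power2: "base_Ck n U f \<Longrightarrow> base_Ck n U (\<lambda>q. (f q)\<^sup>2)"
  unfolding power2_eq_square by (rule base_Ck_mult)

lemma base_Ck_sum: "(\<And>i. i \<in> I \<Longrightarrow> base_Ck n U (f i)) \<Longrightarrow> base_Ck n U (\<lambda>q. \<Sum>i\<in>I. f i q)"
  by (induction I rule: infinite_finite_induct) (auto intro: base_Ck_const base_Ck_add)

lemma base_Ck_divide:
  "base_Ck n U f \<Longrightarrow> base_Ck n U g \<Longrightarrow> (\<And>q. q \<in> U \<Longrightarrow> g q \<noteq> 0) \<Longrightarrow> base_Ck n U (\<lambda>q. f q / g q)"
  unfolding base_Ck_def
  by (intro allI impI Ck_on_divide) (use inv_in open_image_sheet in \<open>auto simp: subset_iff\<close>)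

lemma base_Ck_sqrt:
  "base_Ck n U f \<Longrightarrow> (\<And>q. q \<in> U \<Longrightarrow> f q > 0) \<Longrightarrow> base_Ck n U (\<lambda>q. sqrt (f q))"
  unfolding base_Ck_def
  by (intro allI impI Ck_on_sqrt) (use inv_in open_image_sheet in \<open>auto simp: subset_iff\<close>)

lemma base_Ck_of_base:
  assumes "Ck_on n UNIV f"
  shows "base_Ck n U (\<lambda>q. f (P q))"
  unfolding base_Ck_def
proof (intro allI impI, elim conjE)
  fix W assume W: "sheet W"
  have "Ck_on n (P ` W) f" by (rule Ck_on_subset[OF assms]) simp
  then show "Ck_on n (P ` W) (\<lambda>y. f (P (inv_into W P y)))"
    using Ck_on_cong[OF open_image_sheet[OF W], of f "\<lambda>y. f (P (inv_into W P y))" n]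
    by (simp add: P_inv)
qed

lemma base_Ck_imp_continuous_on:
  assumes "base_Ck n U g" "open U"
  shows "continuous_on U g"
proof (rule continuous_at_imp_continuous_on, rule ballI)
  fix q assume "q \<in> U"
  then obtain W where W: "sheet W" "q \<in> W" "W \<subseteq> U" using ex_sheet[OF assms(2)] by blast
  have "continuous_on (P ` W) (\<lambda>y. g (inv_into W P y))"
    using Ck_on_imp_continuous_on base_Ck_sheet[OF assms(1) W(1,3)] by blast
  then have "continuous_on W (\<lambda>q. g (inv_into W P (P q)))"
    by (rule continuous_on_compose2[OF _ continuous_on_subset[OF cont]]) auto
  then have "continuous_on W g"
    by (rule continuous_on_eq) (simp add: inv_P[OF W(1)])
  then show "isCont g q" using W open_sheet continuous_on_eq_continuous_at by blast
qed

lemma base_deriv_sheet: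
  assumes "sheet W" "q \<in> W"
  shows "base_deriv v g q = frechet_derivative (\<lambda>y. g (inv_into W P y)) (at (P q)) v"
proof -
  define W' where "W' = (SOME W. sheet W \<and> q \<in> W)"
  have W': "sheet W'" "q \<in> W'"
    using someI[of "\<lambda>W. sheet W \<and> q \<in> W" W] assms by (auto simp: W'_def)
  have "open (P ` (W \<inter> W'))" using assms W' by (intro open_map) (auto simp: open_sheet)
  then have "frechet_derivative (\<lambda>y. g (inv_into W' P y)) (at (P q)) =
      frechet_derivative (\<lambda>y. g (inv_into W P y)) (at (P q))"
    by (rule frechet_derivative_cong_open) (use assms W' inv_subset in auto)
  then show ?thesis unfolding base_deriv_def W'_def by simp
qed

lemma base_deriv_cong:
  assumes "open U" "q \<in> U" "\<And>p. p \<in> U \<Longrightarrow> f p = g p"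
  shows "base_deriv v f q = base_deriv v g q"
proof -
  obtain W where W: "sheet W" "q \<in> W" "W \<subseteq> U" using ex_sheet[OF assms(1,2)] by blast
  have "frechet_derivative (\<lambda>y. f (inv_into W P y)) (at (P q)) =
      frechet_derivative (\<lambda>y. g (inv_into W P y)) (at (P q))"
    by (rule frechet_derivative_cong_open[OF open_image_sheet[OF W(1)]])
      (use W assms(3) inv_in in blast)+
  then show ?thesis using base_deriv_sheet[OF W(1,2)] by simp
qed

lemma base_Ck_deriv:
  assumes "base_Ck (Suc n) U g"
  shows "base_Ck n U (base_deriv v g)"
  unfolding base_Ck_def
proof (intro allI impI, elim conjE)
  fix W assume W: "sheet W" "W \<subseteq> U"
  have "Ck_on n (P ` W) (\<lambda>y. frechet_derivative (\<lambda>y. g (inv_into W P y)) (at y) v)"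
    using base_Ck_sheet[OF assms W] by simp
  moreover have "frechet_derivative (\<lambda>y. g (inv_into W P y)) (at y) v = base_deriv v g (inv_into W P y)"
    if "y \<in> P ` W" for y
    using base_deriv_sheet[OF W(1) inv_in[OF that], of v g] P_inv[OF that] by simp
  ultimately show "Ck_on n (P ` W) (\<lambda>y. base_deriv v g (inv_into W P y))"
    by (subst Ck_on_cong[OF open_image_sheet[OF W(1)], symmetric]) auto
qed

lemma base_deriv_has_derivative:
  assumes "base_Ck (Suc 0) U g" "sheet W" "W \<subseteq> U" "q \<in> W"
  shows "((\<lambda>y. g (inv_into W P y)) has_derivative (\<lambda>v. base_deriv v g q)) (at (P q))"
proof -
  have "((\<lambda>y. g (inv_into W P y)) has_derivative
      frechet_derivative (\<lambda>y. g (inv_into W P y)) (at (P q))) (at (P q))"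
    by (rule Ck_on_SucD[OF base_Ck_sheet[OF assms(1-3)]]) (use assms(4) in blast)
  then show ?thesis using base_deriv_sheet[OF assms(2,4)] by presburger
qed

lemma base_deriv_eqI:
  assumes "sheet W" "q \<in> W" "((\<lambda>y. g (inv_into W P y)) has_derivative D) (at (P q))"
  shows "base_deriv v g q = D v"
  using base_deriv_sheet[OF assms(1,2)] frechet_derivative_eqI[OF assms(3)] by metis

lemma base_deriv_const: "base_deriv v (\<lambda>q. c) q = 0"
proof -
  obtain W where "sheet W" "q \<in> W" using ex_sheet by blast
  then show ?thesis by (rule base_deriv_eqI) auto
qed

lemma base_deriv_linear:
  assumes "base_Ck (Suc 0) U g" "open U" "q \<in> U"
  shows "linear (\<lambda>v. base_deriv v g q)"
proof -
  obtain W where W: "sheet W" "q \<in> W" "W \<subseteq> U" using ex_sheet[OF assms(2,3)] by blast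
  then show ?thesis
    using base_deriv_has_derivative[OF assms(1) W(1,3,2)] has_derivative_linear by blast
qed

lemma base_deriv_add:
  assumes "base_Ck (Suc 0) U f" "base_Ck (Suc 0) U g" "open U" "q \<in> U"
  shows "base_deriv v (\<lambda>q. f q + g q) q = base_deriv v f q + base_deriv v g q"
proof -
  obtain W where W: "sheet W" "q \<in> W" "W \<subseteq> U" using ex_sheet[OF assms(3,4)] by blast
  show ?thesis
    by (rule base_deriv_eqI[OF W(1,2)
      has_derivative_add[OF base_deriv_has_derivative[OF assms(1) W(1,3,2)]
        base_deriv_has_derivative[OF assms(2) W(1,3,2)]]])
qed

lemma base_deriv_diff:
  assumes "base_Ck (Suc 0) U f" "base_Ck (Suc 0) U g" "open U" "q \<in> U"
  shows "base_deriv v (\<lambda>q. f q - g q) q = base_deriv v f q - base_deriv v g q"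
proof -
  obtain W where W: "sheet W" "q \<in> W" "W \<subseteq> U" using ex_sheet[OF assms(3,4)] by blast
  show ?thesis
    by (rule base_deriv_eqI[OF W(1,2)
      has_derivative_diff[OF base_deriv_has_derivative[OF assms(1) W(1,3,2)]
        base_deriv_has_derivative[OF assms(2) W(1,3,2)]]])
qed

lemma base_deriv_mult:
  assumes "base_Ck (Suc 0) U f" "base_Ck (Suc 0) U g" "open U" "q \<in> U"
  shows "base_deriv v (\<lambda>q. f q * g q) q = f q * base_deriv v g q + base_deriv v f q * g q"
proof -
  obtain W where W: "sheet W" "q \<in> W" "W \<subseteq> U" using ex_sheet[OF assms(3,4)] by blast
  have "((\<lambda>y. f (inv_into W P y) * g (inv_into W P y)) has_derivative
     (\<lambda>v. f q * base_deriv v g q + base_deriv v f q * g q)) (at (P q))"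
    using has_derivative_mult[OF base_deriv_has_derivative[OF assms(1) W(1,3,2)]
        base_deriv_has_derivative[OF assms(2) W(1,3,2)]] inv_P[OF W(1,2)] by simp
  from base_deriv_eqI[OF W(1,2) this] show ?thesis .
qed

lemma base_deriv_minus:
  assumes "base_Ck (Suc 0) U f" "open U" "q \<in> U"
  shows "base_deriv v (\<lambda>q. - f q) q = - base_deriv v f q"
  using base_deriv_diff[OF base_Ck_const[of _ _ 0] assms(1) assms(2,3), of v]
  by (simp add: base_deriv_const)

lemma base_deriv_sum:
  assumes "finite I" "\<And>i. i \<in> I \<Longrightarrow> base_Ck (Suc 0) U (f i)" "open U" "q \<in> U"
  shows "base_deriv v (\<lambda>q. \<Sum>i\<in>I. f i q) q = (\<Sum>i\<in>I. base_deriv v (f i) q)"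
  using assms(1,2)
proof (induction I)
  case (insert i I)
  then show ?case
    using base_deriv_add[OF _ base_Ck_sum assms(3,4), of "f i" I f v] by simp
qed (simp add: base_deriv_const)

lemma base_deriv_P: "base_deriv v (\<lambda>q. P q \<bullet> b) q = v \<bullet> b"
proof -
  obtain W where W: "sheet W" "q \<in> W" using ex_sheet by blast
  have "((\<lambda>y. y \<bullet> b) has_derivative (\<lambda>v. v \<bullet> b)) (at (P q))"
    by (auto intro!: derivative_eq_intros)
  then have "((\<lambda>y. P (inv_into W P y) \<bullet> b) has_derivative (\<lambda>v. v \<bullet> b)) (at (P q))"
    by (rule has_derivative_transform_within_open[OF _ open_image_sheet[OF W(1)]])
      (use W P_inv in auto)
  from base_deriv_eqI[OF W this] show ?thesis .
qed

lemma base_deriv_commute: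
  assumes "base_Ck 2 U g" "open U" "q \<in> U"
  shows "base_deriv v (base_deriv w g) q = base_deriv w (base_deriv v g) q"
proof -
  obtain W where W: "sheet W" "q \<in> W" "W \<subseteq> U" using ex_sheet[OF assms(2,3)] by blast
  let ?g = "\<lambda>y. g (inv_into W P y)"
  have "base_deriv v (base_deriv w g) q =
    frechet_derivative (\<lambda>y. frechet_derivative ?g (at y) w) (at (P q)) v" for v w
    unfolding base_deriv_sheet[OF W(1,2), of v "base_deriv w g"]
  proof (rule fun_cong[OF frechet_derivative_cong_open[OF open_image_sheet[OF W(1)]]])
    fix y assume y: "y \<in> P ` W"
    show "base_deriv w g (inv_into W P y) = frechet_derivative ?g (at y) w"
      using base_deriv_sheet[OF W(1) inv_in[OF y], of w g] P_inv[OF y] by simp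
  qed (use W in simp)
  moreover have "frechet_derivative (\<lambda>y. frechet_derivative ?g (at y) w) (at (P q)) v =
     frechet_derivative (\<lambda>y. frechet_derivative ?g (at y) v) (at (P q)) w"
    using W by (intro frechet_derivative_commute[OF open_image_sheet[OF W(1)]] base_Ck_sheet[OF assms(1)]) auto
  ultimately show ?thesis by simp
qed

text \<open>Over a ball in the image of a sheet, convexity turns a zero derivative into constancy,
  so \<open>g\<close> is locally constant; connectedness does the rest.\<close>

lemma base_deriv_zero_imp_const:
  assumes "connected (UNIV :: 'm set)" "base_Ck (Suc 0) UNIV g" "\<And>v q. base_deriv v g q = 0"
  shows "g p = g q"
proof (rule connected_local_const[OF assms(1)])
  show "\<forall>a\<in>UNIV. \<forall>\<^sub>F b in at a. g a = g b"
  proof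
    fix a
    obtain W where W: "sheet W" "a \<in> W" using ex_sheet by blast
    obtain r where r: "r > 0" "ball (P a) r \<subseteq> P ` W"
      using open_image_sheet[OF W(1)] W(2) open_contains_ball by blast
    have zero: "((\<lambda>y. g (inv_into W P y)) has_derivative (\<lambda>v. 0)) (at y)" if "y \<in> P ` W" for y
      using base_deriv_has_derivative[OF assms(2) W(1) _ inv_in[OF that]] P_inv[OF that] assms(3) by simp
    have "g (inv_into W P y) = g (inv_into W P (P a))" if "y \<in> ball (P a) r" for y
      using r that
      by (intro has_derivative_zero_unique[of "ball (P a) r" "\<lambda>y. g (inv_into W P y)"])
        (auto intro!: has_derivative_at_withinI zero)
    then have "g b = g a" if "b \<in> W \<inter> P -` ball (P a) r" for b
      using that inv_P[OF W(1)] W(2) by force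
    moreover have "open (W \<inter> P -` ball (P a) r)" "a \<in> W \<inter> P -` ball (P a) r"
      using W r(1) open_sheet cont by (auto intro!: open_Int open_vimage simp: continuous_on_eq_continuous_at)
    ultimately show "\<forall>\<^sub>F b in at a. g a = g b"
      unfolding eventually_at_topological by metis
  qed
qed auto

text \<open>Otherwise the image of \<open>P\<close> would be compact and open, hence all of the
  Euclidean space, which is not compact.\<close>

lemma noncompact: "\<not> compact (UNIV :: 'm set)"
proof
  assume "compact (UNIV :: 'm set)"
  then have c: "compact (range P)" by (rule compact_continuous_image[OF cont])
  then have "closed (range P)" "open (range P)" by (auto intro: compact_imp_closed open_map)
  then have "range P = UNIV" using clopen by blast
  then show False using c not_compact_UNIV by simp
qed


section \<open>The base measure\<close>


text \<open>Lebesgue measure pulled back along \<open>P\<close>, with points over the same base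
  point counted separately. It is glued from the sheets by a supremum, just as the Calabi volume is
  glued from the charts.\<close>

definition base_measure :: "'m measure" where
  "base_measure = (SUP W\<in>{W. sheet W}. distr (restrict_space lborel (P ` W)) borel (inv_into W P))"

lemma measurable_inv: "sheet W \<Longrightarrow> inv_into W P \<in> restrict_space lborel (P ` W) \<rightarrow>\<^sub>M borel"
  using borel_measurable_continuous_on_restrict[OF continuous_on_inv]
  by (simp cong: measurable_cong_sets add: sets_restrict_space)

lemma measurable_inv_restrict:
  "sheet W \<Longrightarrow> inv_into W P \<in> restrict_space lborel (P ` W) \<rightarrow>\<^sub>M restrict_space borel W"
  by (rule measurable_restrict_space2[OF _ measurable_inv])
     (simp add: space_restrict_space inv_in Pi_def)

lemma ex_some_sheet: "{W. sheet W} \<noteq> {}"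
  using ex_sheet[OF open_UNIV UNIV_I] by auto

lemma sets_base_measure [simp, measurable_cong]: "sets base_measure = sets borel"
  unfolding base_measure_def by (rule sets_SUP) (use ex_some_sheet in auto)

lemma space_base_measure [simp]: "space base_measure = UNIV"
  using sets_eq_imp_space_eq[OF sets_base_measure] by simp

text \<open>Another sheet \<open>W'\<close> sees only the part of \<open>A\<close> inside
  \<open>W'\<close>, whose image is contained in that of \<open>A\<close>; hence the supremum is
  attained at \<open>W\<close> on subsets of \<open>W\<close>.\<close>

lemma emeasure_base_measure:
  assumes W: "sheet W" and A: "A \<in> sets borel" "A \<subseteq> W"
  shows "emeasure base_measure A = emeasure lborel (P ` A)"
proof -
  let ?m = "\<lambda>W. distr (restrict_space lborel (P ` W)) borel (inv_into W P)"
  have m: "emeasure (?m W') A = emeasure lborel (P ` (A \<inter> W'))"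
    if "sheet W'" "A \<in> sets borel" for W' A
  proof -
    have "emeasure (?m W') A = emeasure (restrict_space lborel (P ` W')) (inv_into W' P -` A \<inter> P ` W')"
      using that by (subst emeasure_distr) (auto simp: measurable_inv space_restrict_space)
    also have "\<dots> = emeasure lborel (inv_into W' P -` A \<inter> P ` W')"
      using open_image_sheet[OF that(1)] by (intro emeasure_restrict_space) auto
    finally show ?thesis using image_eq_vimage[OF that(1)] by simp
  qed
  have "emeasure base_measure A = emeasure (?m W) A"
    unfolding base_measure_def
  proof (rule emeasure_SUP_local[where W=W and ?i0.0=W])
    fix W' A assume A: "W' \<in> {W. sheet W}" "A \<in> sets borel" "A \<subseteq> W"
    then have "P ` A \<in> sets borel" using sheet_image_borel[OF W] by blast
    then show "emeasure (?m W') A \<le> emeasure (?m W) A"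
      using A W by (simp add: m Int_absorb2) (rule emeasure_mono; auto)
  qed (use W A in auto)
  also have "\<dots> = emeasure lborel (P ` A)" using m[OF W A(1)] A(2) by (simp add: Int_absorb2)
  finally show ?thesis .
qed

lemma restrict_base_measure:
  assumes W: "sheet W"
  shows "restrict_space base_measure W =
    distr (restrict_space lborel (P ` W)) (restrict_space borel W) (inv_into W P)"
proof (rule measure_eqI)
  have Wb: "W \<in> sets borel" using W by (auto simp: open_sheet)
  have meas: "inv_into W P \<in> restrict_space lborel (P ` W) \<rightarrow>\<^sub>M restrict_space borel W"
    by (rule measurable_inv_restrict[OF W])
  show "sets (restrict_space base_measure W) =
    sets (distr (restrict_space lborel (P ` W)) (restrict_space borel W) (inv_into W P))"
    by (simp add: sets_restrict_space)
  fix A assume "A \<in> sets (restrict_space base_measure W)"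
  then have A: "A \<in> sets borel" "A \<subseteq> W"
    using Wb by (auto simp: sets_restrict_space_iff)
  have "emeasure (restrict_space base_measure W) A = emeasure lborel (P ` A)"
    using emeasure_base_measure[OF W A] A Wb by (subst emeasure_restrict_space) auto
  also have "P ` A = inv_into W P -` A \<inter> P ` W"
    using image_eq_vimage[OF W, of A] A(2) by (simp add: Int_absorb2)
  also have "emeasure lborel \<dots> = emeasure (restrict_space lborel (P ` W)) (inv_into W P -` A \<inter> P ` W)"
    using open_image_sheet[OF W] by (intro emeasure_restrict_space[symmetric]) auto
  also have "\<dots> = emeasure (distr (restrict_space lborel (P ` W)) (restrict_space borel W) (inv_into W P)) A"
    using A Wb meas by (subst emeasure_distr) (auto simp: space_restrict_space sets_restrict_space_iff)
  finally show "emeasure (restrict_space base_measure W) A =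
    emeasure (distr (restrict_space lborel (P ` W)) (restrict_space borel W) (inv_into W P)) A" .
qed

lemma integral_sheet:
  fixes f :: "'m \<Rightarrow> real"
  assumes W: "sheet W" and f: "f \<in> borel_measurable borel" "\<And>q. q \<notin> W \<Longrightarrow> f q = 0"
  shows "(\<integral>q. f q \<partial>base_measure) = (\<integral>y. indicator (P ` W) y * f (inv_into W P y) \<partial>lborel)"
proof -
  have Wb: "W \<in> sets borel" using W by (auto simp: open_sheet)
  have meas: "inv_into W P \<in> restrict_space lborel (P ` W) \<rightarrow>\<^sub>M restrict_space borel W"
    by (rule measurable_inv_restrict[OF W])
  have "(\<integral>q. f q \<partial>base_measure) = (\<integral>q. indicator W q *\<^sub>R f q \<partial>base_measure)"
    using f(2) by (intro Bochner_Integration.integral_cong) (auto split: split_indicator)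
  also have "\<dots> = (\<integral>q. f q \<partial>restrict_space base_measure W)"
    using Wb by (subst integral_restrict_space) auto
  also have "\<dots> = (\<integral>y. f (inv_into W P y) \<partial>restrict_space lborel (P ` W))"
    unfolding restrict_base_measure[OF W]
    by (rule integral_distr[OF meas]) (use f(1) in \<open>simp add: measurable_restrict_space1\<close>)
  also have "\<dots> = (\<integral>y. indicator (P ` W) y *\<^sub>R f (inv_into W P y) \<partial>lborel)"
    using open_image_sheet[OF W] by (subst integral_restrict_space) auto
  finally show ?thesis by simp
qed

lemma ex_bounded_sheet:
  assumes "open U" "q \<in> U"
  shows "\<exists>W. sheet W \<and> q \<in> W \<and> W \<subseteq> U \<and> bounded (P ` W)"
proof -
  obtain W where W: "sheet W" "q \<in> W" "W \<subseteq> U" using ex_sheet assms by blast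
  let ?W = "W \<inter> P -` ball (P q) 1"
  have "open ?W"
    using W open_sheet cont by (auto intro!: open_Int open_vimage)
  moreover have "bounded (P ` ?W)" by (rule bounded_subset[of "ball (P q) 1"]) auto
  ultimately show ?thesis using W sheet_subset[OF W(1), of ?W] by (intro exI[of _ ?W]) auto
qed

lemma emeasure_compact_finite:
  assumes "compact K"
  shows "emeasure base_measure K < \<infinity>"
proof -
  have "\<exists>W. sheet W \<and> q \<in> W \<and> bounded (P ` W)" for q
    using ex_bounded_sheet[OF open_UNIV UNIV_I] by blast
  then obtain W where W: "\<And>q. sheet (W q)" "\<And>q. q \<in> W q" "\<And>q. bounded (P ` W q)" by metis
  obtain F where F: "finite F" "K \<subseteq> (\<Union>q\<in>F. W q)"
  proof (rule compactE_image[OF assms, of UNIV W])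
    show "open (W q)" for q using W(1) open_sheet by simp
    show "K \<subseteq> (\<Union>q\<in>UNIV. W q)" using W(2) by auto
  qed auto
  have wb: "W q \<in> sets borel" for q using open_sheet[OF W(1)[of q]] by simp
  have "emeasure base_measure K \<le> emeasure base_measure (\<Union>q\<in>F. W q)"
    using F wb by (intro emeasure_mono) auto
  also have "\<dots> \<le> (\<Sum>q\<in>F. emeasure base_measure (W q))"
    using F wb by (intro emeasure_subadditive_finite) auto
  also have "\<dots> < \<infinity>"
  proof -
    have "emeasure base_measure (W q) < \<infinity>" for q
      using emeasure_bounded_finite[OF W(3)[of q]] emeasure_base_measure[OF W(1)[of q] wb] by simp
    then show ?thesis using F(1) by (simp add: less_top[symmetric])
  qed
  finally show ?thesis .
qed

text \<open>Needed to conclude that a continuous function vanishing almost everywhere vanishes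
  identically.\<close>

lemma emeasure_open_pos:
  assumes "open U" "U \<noteq> {}"
  shows "emeasure base_measure U > 0"
proof -
  obtain W where W: "sheet W" "W \<noteq> {}" "W \<subseteq> U"
    using ex_sheet[OF assms(1)] assms(2) by (metis all_not_in_conv)
  have "emeasure lborel (P ` W) > 0"
    using open_not_negligible[OF open_image_sheet[OF W(1)]] W(2) open_image_sheet[OF W(1)]
    by (simp add: negligible_iff_emeasure0 zero_less_iff_neq_zero)
  also have "emeasure lborel (P ` W) = emeasure base_measure W"
    using W by (intro emeasure_base_measure[OF W(1), symmetric]) (auto simp: open_sheet)
  also have "\<dots> \<le> emeasure base_measure U"
    using W assms by (intro emeasure_mono) auto
  finally show ?thesis .
qed

lemma integrable_compact_support:
  fixes f :: "'m \<Rightarrow> real"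
  assumes "continuous_on UNIV f" "compact K" "\<And>q. q \<notin> K \<Longrightarrow> f q = 0"
  shows "integrable base_measure f"
proof -
  have "compact (f ` K)" using assms by (intro compact_continuous_image continuous_on_subset[OF assms(1)]) auto
  then obtain b where b: "\<And>q. q \<in> K \<Longrightarrow> \<bar>f q\<bar> \<le> b"
    using compact_imp_bounded bounded_real by (metis imageI)
  have m: "f \<in> borel_measurable base_measure"
    using borel_measurable_continuous_onI[OF assms(1)] by simp
  show ?thesis
  proof (rule integrableI_bounded_set[where A=K and B=b])
    show "K \<in> sets base_measure" using assms(2) by (simp add: borel_compact)
  qed (use m emeasure_compact_finite assms(2,3) b in auto)
qed


section \<open>Integrals of derivatives of compactly supported functions\<close>

lemma base_deriv_zero_outside:
  assumes "closed K" "\<And>q. q \<notin> K \<Longrightarrow> g q = 0" "q \<notin> K"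
  shows "base_deriv v g q = 0"
proof -
  have "base_deriv v g q = base_deriv v (\<lambda>q. 0) q"
    by (rule base_deriv_cong[of "- K"]) (use assms in auto)
  then show ?thesis by (simp add: base_deriv_const)
qed

text \<open>Extended by zero, \<open>g\<close> becomes a continuously differentiable function
  \<open>G\<close> on the whole Euclidean space. By translation invariance the integral of
  \<open>G (y + t *\<^sub>R v)\<close> does not depend on t, while its derivative at t = 0 is the
  integral of the directional derivative.\<close>

lemma integral_base_deriv_sheet:
  assumes g: "base_Ck (Suc 0) UNIV g" and W: "sheet W" and K: "compact K" "K \<subseteq> W"
    "\<And>q. q \<notin> K \<Longrightarrow> g q = 0"
  shows "(\<integral>q. base_deriv v g q \<partial>base_measure) = 0"
proof -
  define L where "L = P ` K"
  have L: "compact L" unfolding L_def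
    by (rule compact_continuous_image[OF continuous_on_subset[OF cont] K(1)]) simp
  have clK: "closed K" using K(1) compact_imp_closed by blast
  have oL: "open (- L)" using L compact_imp_closed by blast
  define G where "G y = (if y \<in> P ` W then g (inv_into W P y) else 0)" for y
  define G' where "G' y = (if y \<in> P ` W then base_deriv v g (inv_into W P y) else 0)" for y
  have inv_notin: "inv_into W P y \<notin> K" if "y \<in> P ` W" "y \<notin> L" for y
    using that P_inv[OF that(1)] unfolding L_def by (metis imageI)
  have G0: "G y = 0" if "y \<notin> L" for y
    using inv_notin[OF _ that] K(3) by (simp add: G_def)
  have G'0: "G' y = 0" if "y \<notin> L" for y
    using inv_notin[OF _ that] base_deriv_zero_outside[of K g, OF clK K(3)] by (simp add: G'_def)
  have dG: "((\<lambda>s. G (y + s *\<^sub>R v)) has_real_derivative G' (y + s *\<^sub>R v)) (at s)" for y s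
  proof (cases "y + s *\<^sub>R v \<in> P ` W")
    case True
    let ?q = "inv_into W P (y + s *\<^sub>R v)"
    have "((\<lambda>y. g (inv_into W P y)) has_derivative (\<lambda>v. base_deriv v g ?q)) (at (P ?q))"
      by (rule base_deriv_has_derivative[OF g W]) (use inv_in True in auto)
    then have "(G has_derivative (\<lambda>v. base_deriv v g ?q)) (at (y + s *\<^sub>R v))"
      unfolding P_inv[OF True]
      by (rule has_derivative_transform_within_open[OF _ open_image_sheet[OF W]])
        (use True in \<open>auto simp: G_def\<close>)
    from has_derivative_along_line[OF this] show ?thesis using True by (simp add: G'_def)
  next
    case False
    then have "y + s *\<^sub>R v \<in> - L" using K(2) by (auto simp: L_def)
    then have "(G has_derivative (\<lambda>v. 0)) (at (y + s *\<^sub>R v))"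
      by (intro has_derivative_transform_within_open[OF has_derivative_const oL]) (simp_all add: G0)
    from has_derivative_along_line[OF this] show ?thesis using False by (simp add: G'_def)
  qed
  \<comment> \<open>The image of the sheet and the complement of the support are open and cover the
    space, so continuity of the extensions can be checked on each of them.\<close>
  have un: "P ` W \<union> - L = UNIV" using K(2) by (auto simp: L_def)
  have contI: "continuous_on UNIV H" if "continuous_on (P ` W) H" "\<And>y. y \<notin> L \<Longrightarrow> H y = 0" for H :: "'b \<Rightarrow> real"
  proof -
    have "continuous_on (- L) H"
      by (rule continuous_on_eq[OF continuous_on_const]) (simp add: that(2))
    from continuous_on_open_Un[OF open_image_sheet[OF W] oL that(1) this] show ?thesis by (simp add: un)
  qed
  have cG: "continuous_on UNIV G"
  proof (rule contI)
    show "continuous_on (P ` W) G"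
      by (rule continuous_on_eq[OF Ck_on_imp_continuous_on[OF base_Ck_sheet[OF g W]]])
        (auto simp: G_def)
  qed (rule G0)
  have cG': "continuous_on UNIV G'"
  proof (rule contI)
    show "continuous_on (P ` W) G'"
      by (rule continuous_on_eq[OF Ck_on_imp_continuous_on[OF base_Ck_sheet[OF base_Ck_deriv[OF g] W]]])
        (auto simp: G'_def)
  qed (rule G'0)
  have "compact (G' ` L)" by (intro compact_continuous_image continuous_on_subset[OF cG'] L) auto
  then obtain C0 where C0: "\<And>y. y \<in> L \<Longrightarrow> \<bar>G' y\<bar> \<le> C0"
    using compact_imp_bounded bounded_real by (metis imageI)
  define C where "C = max 0 C0"
  have C: "C \<ge> 0" "\<bar>G' y\<bar> \<le> C" for y
    using C0[of y] G'0[of y] by (cases "y \<in> L"; simp add: C_def)+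
  obtain R0 where R0: "\<And>y. y \<in> L \<Longrightarrow> norm y \<le> R0"
    using compact_imp_bounded[OF L] unfolding bounded_iff by blast
  \<comment> \<open>For \<bar>t\<bar> < 1 both \<open>G\<close> and its translate by
    \<open>t *\<^sub>R v\<close> vanish outside this ball, so \<open>w\<close> dominates all
    difference quotients.\<close>
  define w where "w y = C * indicator (cball (0::'b) (R0 + norm v)) y" for y :: 'b
  have intG: "integrable lborel G"
  proof -
    have "integrable lborel (\<lambda>y. indicator L y *\<^sub>R G y)"
      by (rule borel_integrable_compact[OF L continuous_on_subset[OF cG]]) simp
    moreover have "(\<lambda>y. indicator L y *\<^sub>R G y) = G" using G0 by (auto simp: fun_eq_iff split: split_indicator)
    ultimately show ?thesis by simp
  qed
  have bG: "G \<in> borel_measurable borel" by (rule borel_measurable_continuous_onI[OF cG])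
  have trans: "integrable lborel (\<lambda>y. G (y + c)) \<and> (\<integral>y. G (y + c) \<partial>lborel) = (\<integral>y. G y \<partial>lborel)" for c
  proof -
    have d: "distr lborel borel ((+) c) = (lborel :: 'b measure)" by (rule lborel_distr_plus)
    have "integrable (distr lborel borel ((+) c)) G" using intG d by simp
    then have "integrable lborel (\<lambda>y. G (c + y))"
      using bG by (subst (asm) integrable_distr_eq) auto
    moreover have "(\<integral>y. G y \<partial>lborel) = (\<integral>y. G (c + y) \<partial>lborel)"
      by (subst d[symmetric], rule integral_distr) (use bG in auto)
    ultimately show ?thesis by (simp add: add.commute)
  qed
  have "((\<lambda>t. \<integral>y. G (y + t *\<^sub>R v) \<partial>lborel) has_real_derivative (\<integral>y. G' y \<partial>lborel)) (at 0)"
  proof (rule has_real_derivative_integral_lipschitz(2)[where d=1 and w=w])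
    show "integrable lborel w" unfolding w_def
      using emeasure_bounded_finite[OF bounded_cball, of "0::'b" "R0 + norm v"]
      by (intro integrable_mult_right integrable_real_indicator) auto
    fix y t
    show "((\<lambda>t. G (y + t *\<^sub>R v)) has_real_derivative G' y) (at 0)" using dG[of y 0] by simp
    assume t: "\<bar>t - 0\<bar> < (1::real)"
    show "\<bar>G (y + t *\<^sub>R v) - G (y + 0 *\<^sub>R v)\<bar> \<le> \<bar>t - 0\<bar> * w y"
    proof (cases "y \<in> cball 0 (R0 + norm v)")
      case True
      have "norm (G (y + t *\<^sub>R v) - G (y + 0 *\<^sub>R v)) \<le> C * norm (t - 0)"
        by (rule field_differentiable_bound[of UNIV]) (use C(2) dG in auto)
      then show ?thesis using True by (simp add: w_def mult.commute)
    next
      case False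
      have "y \<notin> L" using R0[of y] False norm_ge_zero[of v] by (auto simp del: norm_ge_zero)
      moreover have "y + t *\<^sub>R v \<notin> L"
      proof
        assume "y + t *\<^sub>R v \<in> L"
        then have "norm (y + t *\<^sub>R v) \<le> R0" by (rule R0)
        moreover have "norm y \<le> norm (y + t *\<^sub>R v) + norm (t *\<^sub>R v)"
          using norm_triangle_ineq4[of "y + t *\<^sub>R v" "t *\<^sub>R v"] by simp
        moreover have "norm (t *\<^sub>R v) \<le> norm v" using t by (simp add: mult_left_le_one_le)
        ultimately show False using False by simp
      qed
      ultimately show ?thesis by (simp add: G0 w_def C(1))
    qed
  qed (use trans in auto)
  moreover have "(\<lambda>t. \<integral>y. G (y + t *\<^sub>R v) \<partial>lborel) = (\<lambda>t. \<integral>y. G y \<partial>lborel)" using trans by simp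
  ultimately have z: "(\<integral>y. G' y \<partial>lborel) = 0" using DERIV_unique[OF _ DERIV_const] by fastforce
  have "(\<integral>q. base_deriv v g q \<partial>base_measure) =
      (\<integral>y. indicator (P ` W) y * base_deriv v g (inv_into W P y) \<partial>lborel)"
  proof (rule integral_sheet[OF W])
    show "base_deriv v g \<in> borel_measurable borel"
      using base_Ck_imp_continuous_on[OF base_Ck_deriv[OF g]] by (intro borel_measurable_continuous_onI) auto
    show "base_deriv v g q = 0" if "q \<notin> W" for q
      using base_deriv_zero_outside[of K g, OF clK K(3)] that K(2) by auto
  qed
  also have "\<dots> = (\<integral>y. G' y \<partial>lborel)"
    by (intro Bochner_Integration.integral_cong) (auto simp: G'_def)
  finally show ?thesis using z by simp
qed

text \<open>Squaring removes the kink of \<open>max 0 s\<close> at the origin: the derivative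
  \<open>2 * max 0 s\<close> is continuous there.\<close>

lemma Ck_on_max_square: "Ck_on (Suc 0) UNIV (\<lambda>s::real. (max 0 s)\<^sup>2)"
proof (rule Ck_on_SucI[where f'="\<lambda>s v. (2 * max 0 s) * v"])
  fix s :: real
  have "((\<lambda>s::real. (max 0 s)\<^sup>2) has_real_derivative 2 * max 0 s) (at s)"
  proof (cases s "0::real" rule: linorder_cases)
    case less
    have "((\<lambda>s::real. (max 0 s)\<^sup>2) has_real_derivative 0) (at s)"
      by (rule has_field_derivative_transform_within_open[of "\<lambda>s. 0" 0 s "{..<0}"])
        (use less in simp_all)
    then show ?thesis using less by simp
  next
    case greater
    have "((\<lambda>s::real. s\<^sup>2) has_real_derivative 2 * s) (at s)"
      by (rule derivative_eq_intros refl | simp)+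
    then have "((\<lambda>s::real. (max 0 s)\<^sup>2) has_real_derivative 2 * s) (at s)"
      by (rule has_field_derivative_transform_within_open[of "\<lambda>s. s\<^sup>2" "2 * s" s "{0<..}"])
        (use greater in simp_all)
    then show ?thesis using greater by simp
  next
    case equal
    have "(\<lambda>h::real. max 0 h) \<midarrow>0\<rightarrow> 0" by (rule tendsto_eq_intros | simp)+
    moreover have "\<forall>\<^sub>F h in at (0::real). max 0 h = (max 0 h)\<^sup>2 / h"
      by (auto simp: eventually_at_filter max_def power2_eq_square)
    ultimately have "(\<lambda>h::real. (max 0 h)\<^sup>2 / h) \<midarrow>0\<rightarrow> 0"
      by (rule Lim_transform_eventually)
    then show ?thesis using equal by (simp add: DERIV_def)
  qed
  then show "((\<lambda>s::real. (max 0 s)\<^sup>2) has_derivative (\<lambda>v. 2 * max 0 s * v)) (at s)"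
    by (simp add: has_field_derivative_def)
next
  fix v :: real
  show "Ck_on 0 UNIV (\<lambda>s. 2 * max 0 s * v)" by (auto intro!: continuous_intros)
qed simp

text \<open>A continuously differentiable bump suffices for the partition of unity below.\<close>

lemma ex_bump:
  "\<exists>b L W. base_Ck (Suc 0) UNIV b \<and> (\<forall>p. b p \<ge> 0) \<and> b q > 0 \<and> compact L \<and> sheet W \<and> L \<subseteq> W \<and>
     (\<forall>p. p \<notin> L \<longrightarrow> b p = 0)"
proof -
  obtain W where W: "sheet W" "q \<in> W" using ex_sheet by blast
  obtain r where r: "r > 0" "cball (P q) r \<subseteq> P ` W"
    using open_image_sheet[OF W(1)] W(2) open_contains_cball by blast
  define L where "L = inv_into W P ` cball (P q) r"
  have L: "compact L" unfolding L_def
    by (rule compact_continuous_image[OF continuous_on_subset[OF continuous_on_inv[OF W(1)] r(2)]]) simp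
  have LW: "L \<subseteq> W" unfolding L_def using r(2) inv_in by blast
  define \<beta> where "\<beta> y = (max 0 (r\<^sup>2 - (y - P q) \<bullet> (y - P q)))\<^sup>2" for y
  have C\<beta>: "Ck_on (Suc 0) UNIV \<beta>" unfolding \<beta>_def
    by (rule Ck_on_compose[OF open_UNIV open_UNIV _ _ Ck_on_max_square])
      (intro subset_UNIV Ck_on_diff Ck_on_const Ck_on_id open_UNIV
        Ck_on_bounded_bilinear[OF _ bounded_bilinear_inner])+
  define b where "b p = (if p \<in> W then \<beta> (P p) else 0)" for p
  have \<beta>0: "\<beta> y = 0" if "y \<notin> cball (P q) r" for y
  proof -
    have "r\<^sup>2 \<le> (norm (y - P q))\<^sup>2" using that r(1) by (intro power_mono) (auto simp: dist_norm norm_minus_commute)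
    then show ?thesis by (simp add: \<beta>_def power2_norm_eq_inner)
  qed
  have b0: "b p = 0" if "p \<notin> L" for p
  proof (cases "p \<in> W")
    case True
    then have "P p \<notin> cball (P q) r" using that inv_P[OF W(1)] unfolding L_def by (metis imageI)
    then show ?thesis by (simp add: b_def \<beta>0)
  qed (simp add: b_def)
  have "base_Ck (Suc 0) UNIV b"
  proof (rule base_Ck_open_cover)
    fix p
    show "\<exists>V. open V \<and> p \<in> V \<and> base_Ck (Suc 0) V b"
    proof (cases "p \<in> W")
      case True
      have "base_Ck (Suc 0) W b"
        using base_Ck_cong[of W b "\<lambda>q. \<beta> (P q)"] base_Ck_of_base[OF C\<beta>] by (simp add: b_def)
      then show ?thesis using True open_sheet[OF W(1)] by blast
    next
      case False
      have "base_Ck (Suc 0) (- L) b"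
        using base_Ck_cong[of "- L" b "\<lambda>q. 0"] base_Ck_const by (simp add: b0)
      then show ?thesis using False LW compact_imp_closed[OF L] by blast
    qed
  qed
  moreover have "b q > 0" using W(2) r(1) by (simp add: b_def \<beta>_def)
  moreover have "\<forall>p. b p \<ge> 0" by (simp add: b_def \<beta>_def)
  ultimately show ?thesis using L LW W(1) b0 by blast
qed

text \<open>A partition of unity subordinate to sheets splits \<open>g\<close> into finitely many
  pieces \<open>G q\<close>, each supported in a compact subset of one sheet.\<close>

lemma integral_base_deriv:
  assumes g: "base_Ck (Suc 0) UNIV g" and K: "compact K" "\<And>q. q \<notin> K \<Longrightarrow> g q = 0"
  shows "(\<integral>q. base_deriv v g q \<partial>base_measure) = 0"
proof -
  have clK: "closed K" using K(1) compact_imp_closed by blast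
  obtain b L W where b: "\<And>q. base_Ck (Suc 0) UNIV (b q)" "\<And>q p. b q p \<ge> 0" "\<And>q. b q q > 0"
    and L: "\<And>q. compact (L q)" "\<And>q. sheet (W q)" "\<And>q. L q \<subseteq> W q" "\<And>q p. p \<notin> L q \<Longrightarrow> b q p = (0::real)"
    using ex_bump by metis
  have contb: "continuous_on UNIV (b q)" for q
    using base_Ck_imp_continuous_on[OF b(1)] by simp
  obtain F where F: "finite F" "K \<subseteq> (\<Union>q\<in>F. {p. b q p > 0})"
  proof (rule compactE_image[OF K(1), of UNIV "\<lambda>q. {p. b q p > 0}"])
    show "open {p. b q p > 0}" for q
      using contb[of q] by (intro open_Collect_less continuous_on_const) auto
    show "K \<subseteq> (\<Union>q\<in>UNIV. {p. b q p > 0})" using b(3) by auto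
  qed auto
  define S where "S p = (\<Sum>q\<in>F. b q p)" for p
  have CS: "base_Ck (Suc 0) U S" for U
    unfolding S_def by (rule base_Ck_subset[OF base_Ck_sum[OF b(1)]]) simp
  have S: "S p > 0" if p: "p \<in> K" for p
  proof -
    obtain q where "q \<in> F" "b q p > 0" using F(2) p by auto
    then show ?thesis unfolding S_def using F(1) b(2) by (intro sum_pos2) auto
  qed
  define G where "G q p = g p * b q p / S p" for q p
  \<comment> \<open>The denominator \<open>S\<close> may vanish far from \<open>K\<close>. The open
    sets where \<open>S > 0\<close> and where \<open>g\<close> is known to vanish cover the space,
    because \<open>S > 0\<close> on \<open>K\<close>.\<close>
  have CG: "base_Ck (Suc 0) UNIV (G q)" for q
  proof (rule base_Ck_open_cover)
    fix p
    show "\<exists>V. open V \<and> p \<in> V \<and> base_Ck (Suc 0) V (G q)"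
    proof (cases "p \<in> K")
      case True
      have "open {p. S p > 0}"
        using base_Ck_imp_continuous_on[OF CS open_UNIV] by (intro open_Collect_less continuous_on_const) auto
      moreover have "base_Ck (Suc 0) {p. S p > 0} (G q)" unfolding G_def
        by (intro base_Ck_divide base_Ck_mult base_Ck_subset[OF g] base_Ck_subset[OF b(1)] CS) auto
      ultimately show ?thesis using S[OF True] by blast
    next
      case False
      have "base_Ck (Suc 0) (- K) (G q)"
        using base_Ck_cong[of "- K" "G q" "\<lambda>q. 0"] base_Ck_const by (simp add: G_def K(2))
      then show ?thesis using False clK by blast
    qed
  qed
  have zG: "G q p = 0" if "p \<notin> L q \<inter> K" for q p
    using that L(4) K(2) by (auto simp: G_def)
  have cpt: "compact (L q \<inter> K)" for q using L(1) clK by blast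
  have IG: "(\<integral>p. base_deriv v (G q) p \<partial>base_measure) = 0" for q
    by (rule integral_base_deriv_sheet[OF CG L(2) cpt _ zG]) (use L(3) in auto)
  have g_sum: "g p = (\<Sum>q\<in>F. G q p)" for p
  proof (cases "p \<in> K")
    case True
    have "(\<Sum>q\<in>F. G q p) = g p * (\<Sum>q\<in>F. b q p) / S p"
      by (simp add: G_def sum_distrib_left sum_divide_distrib)
    then show ?thesis using S[OF True] by (simp add: S_def)
  qed (simp add: G_def K(2))
  have "base_deriv v g p = (\<Sum>q\<in>F. base_deriv v (G q) p)" for p
    unfolding g_sum[abs_def] by (rule base_deriv_sum[OF F(1) CG open_UNIV UNIV_I])
  moreover have "integrable base_measure (base_deriv v (G q))" for q
    by (rule integrable_compact_support[OF base_Ck_imp_continuous_on[OF base_Ck_deriv[OF CG] open_UNIV] cpt])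
      (rule base_deriv_zero_outside[of _ "G _", OF compact_imp_closed[OF cpt] zG])
  ultimately show ?thesis by (simp add: IG)
qed


section \<open>Base coordinates of a Calabi surface\<close>


definition time_P :: "real \<times> 'm \<Rightarrow> real \<times> 'b" where
  "time_P z = (fst z, P (snd z))"

text \<open>With this, joint smoothness in time and space, Leibniz' rule and the commutation of time
  with space derivatives are instances of what was proved for a single local homeomorphism.\<close>

lemma etale_time: "etale time_P"
proof
  show "continuous_on UNIV time_P"
    unfolding time_P_def by (intro continuous_intros continuous_on_compose2[OF cont]) auto
next
  fix U :: "(real \<times> 'm) set" assume U: "open U"
  show "open (time_P ` U)"
  proof (rule Topological_Spaces.openI)
    fix z assume "z \<in> time_P ` U"
    then obtain t q where z: "(t, q) \<in> U" "z = (t, P q)" by (force simp: time_P_def)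
    obtain A B where AB': "open A" "open B" "(t, q) \<in> A \<times> B" "A \<times> B \<subseteq> U"
      by (rule open_prod_elim[OF U z(1)])
    then have AB: "open A" "open B" "t \<in> A" "q \<in> B" "A \<times> B \<subseteq> U" by auto
    have "A \<times> P ` B \<subseteq> time_P ` U" using AB(5) by (force simp: time_P_def image_iff)
    then show "\<exists>T. open T \<and> z \<in> T \<and> T \<subseteq> time_P ` U"
      using AB z open_map by (intro exI[of _ "A \<times> P ` B"]) (auto simp: open_Times)
  qed
next
  fix z :: "real \<times> 'm"
  obtain W where "open W" "snd z \<in> W" "inj_on P W" using loc_inj by blast
  then show "\<exists>W. open W \<and> z \<in> W \<and> inj_on time_P W"
    by (intro exI[of _ "UNIV \<times> W"])
      (auto simp: open_Times inj_on_def time_P_def mem_Times_iff prod_eq_iff)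
qed

interpretation time: etale time_P by (rule etale_time)

lemma time_sheet: "open I \<Longrightarrow> sheet W \<Longrightarrow> time.sheet (I \<times> W)"
  unfolding time.sheet_def sheet_def
  by (auto simp: open_Times inj_on_def time_P_def)

lemma image_time_P: "time_P ` (I \<times> W) = I \<times> P ` W"
  by (force simp: time_P_def image_iff)

lemma inv_time_P:
  assumes "open I" "sheet W" "t \<in> I" "y \<in> P ` W"
  shows "inv_into (I \<times> W) time_P (t, y) = (t, inv_into W P y)"
proof -
  have "(t, y) = time_P (t, inv_into W P y)" using P_inv[OF assms(4)] by (simp add: time_P_def)
  then show ?thesis
    using time.inv_P[OF time_sheet[OF assms(1,2)], of "(t, inv_into W P y)"] assms(3) inv_in[OF assms(4)]
    by simp
qed

lemma time_base_CkI:
  assumes "open I" "\<And>q. q \<in> U \<Longrightarrow> \<exists>W. sheet W \<and> q \<in> W \<and>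
    Ck_on n (I \<times> P ` W) (\<lambda>z. g (fst z, inv_into W P (snd z)))"
  shows "time.base_Ck n (I \<times> U) g"
proof (rule time.base_Ck_local)
  fix z assume z: "z \<in> I \<times> U"
  then obtain W where W: "sheet W" "snd z \<in> W" "Ck_on n (I \<times> P ` W) (\<lambda>z. g (fst z, inv_into W P (snd z)))"
    using assms(2)[of "snd z"] by auto
  have "Ck_on n (time_P ` (I \<times> W)) (\<lambda>y. g (inv_into (I \<times> W) time_P y))"
    unfolding image_time_P
    by (rule Ck_on_cong[THEN iffD1, OF _ _ W(3)])
      (use assms(1) W(1) open_image_sheet in \<open>auto simp: open_Times inv_time_P\<close>)
  then show "\<exists>W. time.sheet W \<and> z \<in> W \<and> Ck_on n (time_P ` W) (\<lambda>y. g (inv_into W time_P y))"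
    using time_sheet[OF assms(1) W(1)] z W(2) by (intro exI[of _ "I \<times> W"]) (auto simp: mem_Times_iff)
qed

lemma time_slice:
  assumes g: "time.base_Ck n (I \<times> U) g" and I: "open I" "t \<in> I"
  shows "base_Ck n U (\<lambda>q. g (t, q))"
  unfolding base_Ck_def
proof (intro allI impI, elim conjE)
  fix W assume W: "sheet W" "W \<subseteq> U"
  have "Ck_on n (I \<times> P ` W) (\<lambda>z. g (inv_into (I \<times> W) time_P z))"
    using time.base_Ck_sheet[OF g time_sheet[OF I(1) W(1)]] W(2) image_time_P by auto
  then have "Ck_on n (P ` W) (\<lambda>y. g (inv_into (I \<times> W) time_P (t, y)))"
    using open_Times[OF I(1) open_image_sheet[OF W(1)]] I(2) open_image_sheet[OF W(1)]
    by (intro Ck_on_compose[OF open_image_sheet[OF W(1)] _ _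
      Ck_on_Pair[OF open_image_sheet[OF W(1)] Ck_on_const Ck_on_id]]) auto
  then show "Ck_on n (P ` W) (\<lambda>y. g (t, inv_into W P y))"
    by (rule Ck_on_cong[THEN iffD1, OF open_image_sheet[OF W(1)], rotated])
      (use inv_time_P[OF I(1) W(1) I(2)] in auto)
qed

lemma time_deriv_aux:
  assumes g: "time.base_Ck (Suc 0) (I \<times> U) g" and I: "open I" "t \<in> I" and U: "open U" "q \<in> U"
  obtains W where "sheet W" "q \<in> W" "W \<subseteq> U"
    "((\<lambda>z. g (inv_into (I \<times> W) time_P z)) has_derivative (\<lambda>v. time.base_deriv v g (t, q))) (at (t, P q))"
proof -
  obtain W where W: "sheet W" "q \<in> W" "W \<subseteq> U" using ex_sheet[OF U] by blast
  have "((\<lambda>z. g (inv_into (I \<times> W) time_P z)) has_derivative (\<lambda>v. time.base_deriv v g (t, q)))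
      (at (time_P (t, q)))"
    by (rule time.base_deriv_has_derivative[OF g time_sheet[OF I(1) W(1)]]) (use W I in auto)
  then show ?thesis using that W by (simp add: time_P_def)
qed

lemma time_slice_deriv:
  assumes g: "time.base_Ck (Suc 0) (I \<times> U) g" and I: "open I" "t \<in> I" and U: "open U" "q \<in> U"
  shows "base_deriv v (\<lambda>q. g (t, q)) q = time.base_deriv (0, v) g (t, q)"
proof -
  obtain W where W: "sheet W" "q \<in> W" "W \<subseteq> U" and
    d: "((\<lambda>z. g (inv_into (I \<times> W) time_P z)) has_derivative (\<lambda>v. time.base_deriv v g (t, q))) (at (t, P q))"
    using time_deriv_aux[OF assms] .
  have "((\<lambda>y. (t, y)) has_derivative (\<lambda>v. (0, v))) (at (P q))"
    by (intro has_derivative_Pair has_derivative_const has_derivative_ident)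
  from has_derivative_compose[OF this d]
  have "((\<lambda>y. g (inv_into (I \<times> W) time_P (t, y))) has_derivative
      (\<lambda>v. time.base_deriv (0, v) g (t, q))) (at (P q))" .
  then have "((\<lambda>y. g (t, inv_into W P y)) has_derivative (\<lambda>v. time.base_deriv (0, v) g (t, q))) (at (P q))"
    by (rule has_derivative_transform_within_open[OF _ open_image_sheet[OF W(1)]])
      (use W I inv_time_P in auto)
  from base_deriv_eqI[OF W(1,2) this] show ?thesis .
qed

lemma time_has_real_derivative:
  assumes g: "time.base_Ck (Suc 0) (I \<times> U) g" and I: "open I" "t \<in> I" and U: "open U" "q \<in> U"
  shows "((\<lambda>s. g (s, q)) has_real_derivative time.base_deriv (1, 0) g (t, q)) (at t)"
proof -
  obtain W where W: "sheet W" "q \<in> W" "W \<subseteq> U" and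
    d: "((\<lambda>z. g (inv_into (I \<times> W) time_P z)) has_derivative (\<lambda>v. time.base_deriv v g (t, q))) (at (t, P q))"
    using time_deriv_aux[OF assms] .
  have "((\<lambda>z. g (inv_into (I \<times> W) time_P z)) has_derivative (\<lambda>v. time.base_deriv v g (t, q)))
      (at ((0, P q) + t *\<^sub>R (1, 0)))" using d by simp
  from has_derivative_along_line[OF this]
  have "((\<lambda>s. g (inv_into (I \<times> W) time_P (s, P q))) has_real_derivative time.base_deriv (1, 0) g (t, q)) (at t)"
    by simp
  then show ?thesis
    by (rule has_field_derivative_transform_within_open[OF _ I])
      (use inv_time_P[OF I(1) W(1)] W(2) inv_P[OF W(1,2)] in simp)
qed

end

section \<open>The base projection of a Calabi surface\<close>

lemma bounded_linear_base_point: "bounded_linear base_point"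
  by (rule linear_conv_bounded_linear[THEN iffD1])
    (auto intro!: linearI simp: base_point_def vec_eq_iff forall_2)

lemma base_point_nth [simp]: "base_point p $ 1 = p $ 1" "base_point p $ 2 = p $ 2"
  by (simp_all add: base_point_def)

lemma base_point_eq_0: "base_point p = 0 \<Longrightarrow> p = (p $ 3) *\<^sub>R calabi_normal"
  by (auto simp: vec_eq_iff forall_2 forall_3 base_point_def calabi_normal_def)

lemma smooth_on_bounded_linear:
  "open S \<Longrightarrow> bounded_linear L \<Longrightarrow> smooth_on S f \<Longrightarrow> smooth_on S (\<lambda>u. L (f u))"
  by (simp add: smooth_on_def Ck_on_bounded_linear)

lemma smooth_atlas_chart:
  assumes "smooth_atlas \<A>" "\<kappa> \<in> \<A>"
  shows "open (dom_of \<kappa>)" "open (cod_of \<kappa>)" "homeomorphism (dom_of \<kappa>) (cod_of \<kappa>) (coord \<kappa>) (param \<kappa>)"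
  using assms by (auto simp: smooth_atlas_def)

lemma smooth_atlas_cover:
  assumes "smooth_atlas \<A>"
  obtains \<kappa> where "\<kappa> \<in> \<A>" "q \<in> dom_of \<kappa>"
  using assms unfolding smooth_atlas_def by blast

lemma param_in: "u \<in> cod_of \<kappa> \<Longrightarrow> param \<kappa> u \<in> dom_of \<kappa>"
  by (rule inv_into_into)

lemma coord_param: "u \<in> cod_of \<kappa> \<Longrightarrow> coord \<kappa> (param \<kappa> u) = u"
  by (rule f_inv_into_f)

lemma param_coord:
  assumes "smooth_atlas \<A>" "\<kappa> \<in> \<A>" "q \<in> dom_of \<kappa>"
  shows "param \<kappa> (coord \<kappa> q) = q"
  using smooth_atlas_chart(3)[OF assms(1,2)] assms(3) by (simp add: homeomorphism_def)

locale calabi_base =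
  fixes \<A> :: "'m::t2_space chart set" and x :: "'m \<Rightarrow> real^3"
  assumes atlas: "smooth_atlas \<A>" and surface: "calabi_surface \<A> x"
begin

abbreviation P :: "'m \<Rightarrow> real^2" where "P \<equiv> \<lambda>q. base_point (x q)"

text \<open>The transition map from chart coordinates to base coordinates.\<close>

definition Q :: "'m chart \<Rightarrow> real^2 \<Rightarrow> real^2" where
  "Q \<kappa> u = P (param \<kappa> u)"

lemmas chart = smooth_atlas_chart[OF atlas]
lemmas param_coord' = param_coord[OF atlas]

lemma smooth_Q: "\<kappa> \<in> \<A> \<Longrightarrow> smooth_on (cod_of \<kappa>) (Q \<kappa>)"
  using smooth_on_bounded_linear[OF chart(2) bounded_linear_base_point, of \<kappa> "x \<circ> param \<kappa>"] surface
  unfolding Q_def[abs_def] calabi_surface_def smooth_map_def by (simp add: o_def)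

lemma Q_derivative:
  assumes "\<kappa> \<in> \<A>" "u \<in> cod_of \<kappa>"
  shows "frechet_derivative (Q \<kappa>) (at u) = (\<lambda>v. base_point (frechet_derivative (x \<circ> param \<kappa>) (at u) v))"
proof -
  have "smooth_on (cod_of \<kappa>) (x \<circ> param \<kappa>)"
    using surface assms(1) by (simp add: calabi_surface_def smooth_map_def)
  from bounded_linear.has_derivative[OF bounded_linear_base_point smooth_on_has_derivative[OF this assms(2)]]
  show ?thesis
    by (intro frechet_derivative_eqI) (simp add: Q_def[abs_def])
qed

text \<open>A tangent vector killed by the base projection is a multiple of
  \<open>calabi_normal\<close>; transversality forces the multiple to be zero, and the immersion is
  injective on tangent vectors.\<close>

lemma inj_Q_derivative:
  assumes k: "\<kappa> \<in> \<A>" and u: "u \<in> cod_of \<kappa>"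
  shows "linear (frechet_derivative (Q \<kappa>) (at u))" "inj (frechet_derivative (Q \<kappa>) (at u))"
proof -
  let ?X = "frechet_derivative (x \<circ> param \<kappa>) (at u)"
  show lin: "linear (frechet_derivative (Q \<kappa>) (at u))"
    using smooth_on_has_derivative[OF smooth_Q[OF k] u] has_derivative_linear by blast
  have s: "smooth_on (cod_of \<kappa>) (x \<circ> param \<kappa>)" and X: "inj ?X" "calabi_normal \<notin> range ?X"
    using surface k u by (auto simp: calabi_surface_def smooth_map_def)
  have linX: "linear ?X"
    using smooth_on_has_derivative[OF s u] has_derivative_linear by blast
  have "v = 0" if "frechet_derivative (Q \<kappa>) (at u) v = 0" for v
  proof -
    have "base_point (?X v) = 0" using that Q_derivative[OF k u] by simp
    from base_point_eq_0[OF this] have eq: "?X v = (?X v $ 3) *\<^sub>R calabi_normal" .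
    have "?X v $ 3 = 0"
    proof (rule ccontr)
      assume n: "?X v $ 3 \<noteq> 0"
      have "?X ((1 / (?X v $ 3)) *\<^sub>R v) = (1 / (?X v $ 3)) *\<^sub>R ?X v" by (rule linear_scale[OF linX])
      also have "\<dots> = calabi_normal" using n by (subst (2) eq) simp
      finally show False using X(2) by (metis rangeI)
    qed
    then have "?X v = 0" using eq by simp
    then show "v = 0" using X(1) linear_injective_0[OF linX] by blast
  qed
  then show "inj (frechet_derivative (Q \<kappa>) (at u))" using linear_injective_0[OF lin] by blast
qed

text \<open>A smooth local inverse \<open>r\<close> of \<open>Q \<kappa>\<close> makes
  \<open>param \<kappa> \<circ> r\<close> a local section of \<open>P\<close>. It supplies
  arbitrarily small sheets inside a chart, and the passage from base to chart coordinates on them is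
  smooth.\<close>

lemma chart_local:
  assumes k: "\<kappa> \<in> \<A>" and q: "q \<in> dom_of \<kappa>" "q \<in> U" "open U"
  obtains W r where "open W" "q \<in> W" "W \<subseteq> dom_of \<kappa> \<inter> U" "inj_on P W" "open (P ` W)"
    "smooth_on (P ` W) r" "r ` P ` W \<subseteq> cod_of \<kappa>" "\<And>y. y \<in> P ` W \<Longrightarrow> inv_into W P y = param \<kappa> (r y)"
proof -
  define u where "u = coord \<kappa> q"
  have u: "u \<in> cod_of \<kappa>" "param \<kappa> u = q" using q(1) param_coord'[OF k q(1)] by (auto simp: u_def)
  have hom: "homeomorphism (cod_of \<kappa>) (dom_of \<kappa>) (param \<kappa>) (coord \<kappa>)"
    using chart(3)[OF k] by (rule homeomorphism_sym[THEN iffD1])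
  define N where "N = cod_of \<kappa> \<inter> param \<kappa> -` (U \<inter> dom_of \<kappa>)"
  have N: "open N" "u \<in> N" "N \<subseteq> cod_of \<kappa>"
    using continuous_open_preimage[OF homeomorphism_cont1[OF hom] chart(2)[OF k] open_Int[OF q(3) chart(1)[OF k]]]
      q u unfolding N_def by auto
  have "smooth_on N (Q \<kappa>)" using smooth_Q[OF k] Ck_on_subset[OF _ N(3)] unfolding smooth_on_def by blast
  then obtain U' V r where r: "open U'" "U' \<subseteq> N" "u \<in> U'" "open V" "homeomorphism U' V (Q \<kappa>) r" "smooth_on V r"
    using smooth_local_inverse[OF N(1) _ N(2) inj_Q_derivative(2)[OF k u(1)]] by metis
  define W where "W = param \<kappa> ` U'"
  have UC: "U' \<subseteq> cod_of \<kappa>" using r(2) N(3) by blast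
  have oW: "open W"
  proof -
    have "W = dom_of \<kappa> \<inter> coord \<kappa> -` U'"
    proof (intro equalityI subsetI)
      fix p assume "p \<in> W"
      then show "p \<in> dom_of \<kappa> \<inter> coord \<kappa> -` U'"
        using UC coord_param[of _ \<kappa>] param_in[of _ \<kappa>] unfolding W_def by auto
    next
      fix p assume "p \<in> dom_of \<kappa> \<inter> coord \<kappa> -` U'"
      then show "p \<in> W" using param_coord'[OF k, of p] unfolding W_def by (metis IntE imageI vimageD)
    qed
    then show ?thesis
      using continuous_open_preimage[OF homeomorphism_cont2[OF hom] chart(1)[OF k] r(1)] by simp
  qed
  have PW: "P ` W = V"
    using homeomorphism_image1[OF r(5)] by (simp add: W_def image_image Q_def)
  have rq: "r (P p) = coord \<kappa> p" if p: "p \<in> W" for p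
  proof -
    obtain w where w: "w \<in> U'" "p = param \<kappa> w" using p by (auto simp: W_def)
    then show ?thesis
      using homeomorphism_apply1[OF r(5), of w] UC coord_param[of w \<kappa>] by (auto simp: Q_def)
  qed
  have Wdom: "W \<subseteq> dom_of \<kappa>"
    unfolding W_def by (intro image_subsetI param_in) (use UC in auto)
  have inj: "inj_on P W"
  proof (rule inj_onI)
    fix a b assume ab: "a \<in> W" "b \<in> W" "P a = P b"
    then have "coord \<kappa> a = coord \<kappa> b" using rq by metis
    then show "a = b" using ab(1,2) Wdom param_coord'[OF k, of a] param_coord'[OF k, of b] by auto
  qed
  show ?thesis
  proof (rule that[of W r])
    show "q \<in> W" using r(3) u(2) unfolding W_def by blast
    show "W \<subseteq> dom_of \<kappa> \<inter> U" using r(2) Wdom by (auto simp: W_def N_def)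
    show "r ` P ` W \<subseteq> cod_of \<kappa>" using homeomorphism_image2[OF r(5)] UC PW by simp
    show "inv_into W P y = param \<kappa> (r y)" if y: "y \<in> P ` W" for y
    proof -
      obtain p where p: "p \<in> W" "y = P p" using y by blast
      then show ?thesis using inv_into_f_f[OF inj p(1)] rq[OF p(1)] param_coord'[OF k] Wdom by auto
    qed
  qed (use oW inj PW r in auto)
qed

sublocale etale P
proof
  show "continuous_on UNIV P"
  proof (rule continuous_at_imp_continuous_on, rule ballI)
    fix q :: 'm
    obtain \<kappa> where k: "\<kappa> \<in> \<A>" "q \<in> dom_of \<kappa>" using smooth_atlas_cover[OF atlas] .
    have "continuous_on (dom_of \<kappa>) (\<lambda>q. Q \<kappa> (coord \<kappa> q))"
      using Ck_on_imp_continuous_on[OF smooth_on_imp_Ck_on[OF smooth_Q[OF k(1)]]]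
        homeomorphism_cont1[OF chart(3)[OF k(1)]]
      by (rule continuous_on_compose2) auto
    then have "continuous_on (dom_of \<kappa>) P"
      by (rule continuous_on_eq) (simp add: Q_def param_coord'[OF k(1)])
    then show "isCont P q" using continuous_on_eq_continuous_at[OF chart(1)[OF k(1)]] k(2) by blast
  qed
next
  fix U :: "'m set" assume U: "open U"
  show "open (P ` U)"
  proof (rule Topological_Spaces.openI)
    fix y assume "y \<in> P ` U"
    then obtain q where q: "q \<in> U" "y = P q" by blast
    obtain \<kappa> where k: "\<kappa> \<in> \<A>" "q \<in> dom_of \<kappa>" using smooth_atlas_cover[OF atlas] .
    obtain W where "open (P ` W)" "q \<in> W" "W \<subseteq> dom_of \<kappa> \<inter> U"
      using chart_local[OF k q(1) U] by metis
    then show "\<exists>T. open T \<and> y \<in> T \<and> T \<subseteq> P ` U" using q(2) by (intro exI[of _ "P ` W"]) auto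
  qed
next
  fix q :: 'm
  obtain \<kappa> where k: "\<kappa> \<in> \<A>" "q \<in> dom_of \<kappa>" using smooth_atlas_cover[OF atlas] .
  show "\<exists>W. open W \<and> q \<in> W \<and> inj_on P W"
    using chart_local[OF k UNIV_I open_UNIV] by metis
qed

lemma chart_sheet:
  assumes k: "\<kappa> \<in> \<A>" and q: "q \<in> dom_of \<kappa>"
  obtains W r where "sheet W" "q \<in> W" "W \<subseteq> dom_of \<kappa>" "smooth_on (P ` W) r" "r ` P ` W \<subseteq> cod_of \<kappa>"
    "\<And>y. y \<in> P ` W \<Longrightarrow> inv_into W P y = param \<kappa> (r y)"
  using chart_local[OF k q UNIV_I open_UNIV] unfolding sheet_def by (metis inf_top_right)

lemma smooth_map_imp_base_Ck:
  assumes "smooth_map \<A> g"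
  shows "base_Ck n U g"
proof (rule base_Ck_subset[of _ UNIV])
  show "base_Ck n UNIV g"
  proof (rule base_Ck_local)
    fix q
    obtain \<kappa> where k: "\<kappa> \<in> \<A>" "q \<in> dom_of \<kappa>" using smooth_atlas_cover[OF atlas] .
    obtain W r where W: "sheet W" "q \<in> W" "smooth_on (P ` W) r" "r ` P ` W \<subseteq> cod_of \<kappa>"
      "\<And>y. y \<in> P ` W \<Longrightarrow> inv_into W P y = param \<kappa> (r y)"
      using chart_sheet[OF k] by metis
    have "Ck_on n (P ` W) (\<lambda>y. (g \<circ> param \<kappa>) (r y))"
    proof (rule Ck_on_compose[OF open_image_sheet[OF W(1)] chart(2)[OF k(1)] W(4) smooth_on_imp_Ck_on[OF W(3)]])
      show "Ck_on n (cod_of \<kappa>) (g \<circ> param \<kappa>)"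
        using assms k(1) by (simp add: smooth_map_def smooth_on_imp_Ck_on)
    qed
    then have "Ck_on n (P ` W) (\<lambda>y. g (inv_into W P y))"
      by (rule Ck_on_cong[THEN iffD1, OF open_image_sheet[OF W(1)], rotated]) (simp add: W(5))
    then show "\<exists>W. sheet W \<and> q \<in> W \<and> Ck_on n (P ` W) (\<lambda>y. g (inv_into W P y))"
      using W by blast
  qed
qed simp

interpretation time: etale time_P by (rule etale_time)

lemma smooth_family_imp_base_Ck:
  fixes F :: "real \<Rightarrow> 'm \<Rightarrow> real^3"
  assumes I: "open I" and F: "\<And>\<kappa>. \<kappa> \<in> \<A> \<Longrightarrow> smooth_on (I \<times> cod_of \<kappa>) (\<lambda>(t, u). F t (param \<kappa> u))"
  shows "time.base_Ck n (I \<times> U) (\<lambda>z. F (fst z) (snd z) $ k)"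
proof (rule time_base_CkI[OF I])
  fix q
  obtain \<kappa> where k: "\<kappa> \<in> \<A>" "q \<in> dom_of \<kappa>" using smooth_atlas_cover[OF atlas] .
  obtain W r where W: "sheet W" "q \<in> W" "smooth_on (P ` W) r" "r ` P ` W \<subseteq> cod_of \<kappa>"
    "\<And>y. y \<in> P ` W \<Longrightarrow> inv_into W P y = param \<kappa> (r y)"
    using chart_sheet[OF k] by metis
  have o: "open (I \<times> P ` W)" using I open_image_sheet[OF W(1)] by (simp add: open_Times)
  have r: "Ck_on n (I \<times> P ` W) (\<lambda>z. r (snd z))"
    by (rule Ck_on_compose[OF o open_image_sheet[OF W(1)] _ Ck_on_linear[OF o bounded_linear_snd]
      smooth_on_imp_Ck_on[OF W(3)]]) auto
  have "Ck_on n (I \<times> P ` W) (\<lambda>z. (\<lambda>(t, u). F t (param \<kappa> u)) (fst z, r (snd z)))"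
    by (rule Ck_on_compose[OF o _ _ Ck_on_Pair[OF o Ck_on_linear[OF o bounded_linear_fst] r]
       smooth_on_imp_Ck_on[OF F[OF k(1)]]]) (use W(4) I chart(2)[OF k(1)] in \<open>auto simp: open_Times\<close>)
  then have "Ck_on n (I \<times> P ` W) (\<lambda>z. F (fst z) (param \<kappa> (r (snd z))) $ k)"
    by (intro Ck_on_nth o) simp
  then have "Ck_on n (I \<times> P ` W) (\<lambda>z. F (fst (fst z, inv_into W P (snd z))) (snd (fst z, inv_into W P (snd z))) $ k)"
    by (rule Ck_on_cong[THEN iffD1, OF o, rotated]) (use W(5) in auto)
  then show "\<exists>W. sheet W \<and> q \<in> W \<and>
    Ck_on n (I \<times> P ` W) (\<lambda>z. F (fst (fst z, inv_into W P (snd z))) (snd (fst z, inv_into W P (snd z))) $ k)"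
    using W by blast
qed


section \<open>The Calabi metric and its volume in base coordinates\<close>


abbreviation D :: "2 \<Rightarrow> ('m \<Rightarrow> real) \<Rightarrow> 'm \<Rightarrow> real" where
  "D i g \<equiv> base_deriv (axis i 1) g"

text \<open>Jacobian determinant of the base projection of \<open>X\<close> in the base coordinates
  of \<open>x\<close>; it is the denominator in Cramer's rule below.\<close>

definition jac :: "('m \<Rightarrow> real^3) \<Rightarrow> 'm \<Rightarrow> real" where
  "jac X q = D 1 (\<lambda>q. X q $ 1) q * D 2 (\<lambda>q. X q $ 2) q - D 2 (\<lambda>q. X q $ 1) q * D 1 (\<lambda>q. X q $ 2) q"

text \<open>The coefficients \<open>\<Gamma>\<^sup>1\<^sub>i\<^sub>j\<close>, \<open>\<Gamma>\<^sup>2\<^sub>i\<^sub>j\<close> of the induced connection, by Cramer's rule from the first two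
  components of \<open>X\<^sub>i\<^sub>j = \<Gamma>\<^sup>k\<^sub>i\<^sub>j X\<^sub>k + G\<^sub>i\<^sub>j Y\<close>; the third one then gives the metric.\<close>

definition chr1 :: "('m \<Rightarrow> real^3) \<Rightarrow> 2 \<Rightarrow> 2 \<Rightarrow> 'm \<Rightarrow> real" where
  "chr1 X i j q = (D i (D j (\<lambda>q. X q $ 1)) q * D 2 (\<lambda>q. X q $ 2) q
     - D i (D j (\<lambda>q. X q $ 2)) q * D 2 (\<lambda>q. X q $ 1) q) / jac X q"

definition chr2 :: "('m \<Rightarrow> real^3) \<Rightarrow> 2 \<Rightarrow> 2 \<Rightarrow> 'm \<Rightarrow> real" where
  "chr2 X i j q = (D i (D j (\<lambda>q. X q $ 2)) q * D 1 (\<lambda>q. X q $ 1) q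
     - D i (D j (\<lambda>q. X q $ 1)) q * D 1 (\<lambda>q. X q $ 2) q) / jac X q"

definition gmet :: "('m \<Rightarrow> real^3) \<Rightarrow> 2 \<Rightarrow> 2 \<Rightarrow> 'm \<Rightarrow> real" where
  "gmet X i j q = D i (D j (\<lambda>q. X q $ 3)) q
     - chr1 X i j q * D 1 (\<lambda>q. X q $ 3) q - chr2 X i j q * D 2 (\<lambda>q. X q $ 3) q"

definition gdet :: "('m \<Rightarrow> real^3) \<Rightarrow> 'm \<Rightarrow> real" where
  "gdet X q = gmet X 1 1 q * gmet X 2 2 q - (gmet X 1 2 q)\<^sup>2"

text \<open>The density of the Calabi area of \<open>X\<close> with respect to
  \<open>base_measure\<close>.\<close>

definition rho :: "('m \<Rightarrow> real^3) \<Rightarrow> 'm \<Rightarrow> real" where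
  "rho X q = sqrt (gdet X q)"

abbreviation Q' :: "'m chart \<Rightarrow> real^2 \<Rightarrow> real^2 \<Rightarrow> real^2" where
  "Q' \<kappa> u \<equiv> frechet_derivative (Q \<kappa>) (at u)"

lemma base_deriv_eq_D:
  assumes "base_Ck (Suc 0) UNIV g"
  shows "base_deriv v g q = v $ 1 * D 1 g q + v $ 2 * D 2 g q"
  using linear_vec2[OF base_deriv_linear[OF assms open_UNIV UNIV_I[of q]], where v=v] by simp

lemma chart_chain:
  assumes g: "base_Ck (Suc 0) UNIV g" and k: "\<kappa> \<in> \<A>" and u: "u \<in> cod_of \<kappa>"
  shows "((\<lambda>u. g (param \<kappa> u)) has_derivative (\<lambda>v. base_deriv (Q' \<kappa> u v) g (param \<kappa> u))) (at u)"
proof -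
  obtain W r where W: "sheet W" "param \<kappa> u \<in> W"
    using chart_sheet[OF k param_in[OF u]] by metis
  define N where "N = cod_of \<kappa> \<inter> param \<kappa> -` W"
  have N: "open N" "u \<in> N"
    using continuous_open_preimage[OF homeomorphism_cont2[OF chart(3)[OF k]] chart(2)[OF k] open_sheet[OF W(1)]]
      u W(2) unfolding N_def by auto
  have "((\<lambda>y. g (inv_into W P y)) has_derivative (\<lambda>v. base_deriv v g (param \<kappa> u))) (at (Q \<kappa> u))"
    using base_deriv_has_derivative[OF g W(1) subset_UNIV W(2)] by (simp add: Q_def)
  from has_derivative_compose[OF smooth_on_has_derivative[OF smooth_Q[OF k] u] this]
  have "((\<lambda>u. g (inv_into W P (Q \<kappa> u))) has_derivative (\<lambda>v. base_deriv (Q' \<kappa> u v) g (param \<kappa> u))) (at u)" .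
  then show ?thesis
    by (rule has_derivative_transform_within_open[OF _ N])
      (simp add: Q_def inv_P[OF W(1)] N_def)
qed

lemma surface_base_Ck:
  assumes "calabi_surface \<A> X"
  shows "base_Ck n U (\<lambda>q. X q $ k)"
proof (rule smooth_map_imp_base_Ck)
  show "smooth_map \<A> (\<lambda>q. X q $ k)"
    unfolding smooth_map_def
  proof
    fix \<kappa> assume k: "\<kappa> \<in> \<A>"
    then have "smooth_on (cod_of \<kappa>) (X \<circ> param \<kappa>)"
      using assms by (simp add: calabi_surface_def smooth_map_def)
    from smooth_on_bounded_linear[OF chart(2)[OF k] bounded_linear_vec_nth this]
    show "smooth_on (cod_of \<kappa>) ((\<lambda>q. X q $ k) \<circ> param \<kappa>)" by (simp add: o_def)
  qed
qed

lemma chart_first_derivative: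
  assumes X: "calabi_surface \<A> X" and k: "\<kappa> \<in> \<A>" and u: "u \<in> cod_of \<kappa>"
  shows "frechet_derivative (X \<circ> param \<kappa>) (at u) w $ k =
    Q' \<kappa> u w $ 1 * D 1 (\<lambda>q. X q $ k) (param \<kappa> u) + Q' \<kappa> u w $ 2 * D 2 (\<lambda>q. X q $ k) (param \<kappa> u)"
proof -
  have s: "smooth_on (cod_of \<kappa>) (X \<circ> param \<kappa>)"
    using X k by (simp add: calabi_surface_def smooth_map_def)
  have 1: "((\<lambda>u. X (param \<kappa> u) $ k) has_derivative (\<lambda>w. frechet_derivative (X \<circ> param \<kappa>) (at u) w $ k)) (at u)"
    using bounded_linear.has_derivative[OF bounded_linear_vec_nth smooth_on_has_derivative[OF s u]]
    by (simp add: o_def)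
  show ?thesis
    using trans[OF fun_cong[OF has_derivative_unique[OF 1 chart_chain[OF surface_base_Ck[OF X] k u]], of w]
      base_deriv_eq_D[OF surface_base_Ck[OF X]]] .
qed

text \<open>Second derivatives of the coordinate change \<open>Q \<kappa>\<close> multiply only
  first derivatives of \<open>X\<close>. That part is tangential and will not contribute to the
  metric.\<close>

lemma chart_second_derivative:
  assumes X: "calabi_surface \<A> X" and k: "\<kappa> \<in> \<A>" and u: "u \<in> cod_of \<kappa>"
  defines "Q2 \<equiv> \<lambda>v w. frechet_derivative (\<lambda>u'. Q' \<kappa> u' w) (at u) v"
  shows "frechet_derivative (\<lambda>u'. frechet_derivative (X \<circ> param \<kappa>) (at u') w) (at u) v $ k =
    (\<Sum>i\<in>UNIV. Q2 v w $ i * D i (\<lambda>q. X q $ k) (param \<kappa> u)) +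
    (\<Sum>j\<in>UNIV. \<Sum>i\<in>UNIV. Q' \<kappa> u v $ j * Q' \<kappa> u w $ i * D j (D i (\<lambda>q. X q $ k)) (param \<kappa> u))"
    (is "?S v $ k = ?R")
proof -
  let ?q = "param \<kappa> u"
  have s: "smooth_on (cod_of \<kappa>) (\<lambda>u'. frechet_derivative (X \<circ> param \<kappa>) (at u') w)"
    using X k by (intro smooth_on_frechet_derivative) (simp add: calabi_surface_def smooth_map_def)
  have 1: "((\<lambda>u'. frechet_derivative (X \<circ> param \<kappa>) (at u') w $ k) has_derivative (\<lambda>v. ?S v $ k)) (at u)"
    using bounded_linear.has_derivative[OF bounded_linear_vec_nth smooth_on_has_derivative[OF s u]] .
  have q2: "((\<lambda>u'. Q' \<kappa> u' w $ i) has_derivative (\<lambda>v. Q2 v w $ i)) (at u)" for i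
    unfolding Q2_def
    using bounded_linear.has_derivative[OF bounded_linear_vec_nth
      smooth_on_has_derivative[OF smooth_on_frechet_derivative[OF smooth_Q[OF k]] u]] .
  have d: "((\<lambda>u. D i (\<lambda>q. X q $ k) (param \<kappa> u)) has_derivative
      (\<lambda>v. base_deriv (Q' \<kappa> u v) (D i (\<lambda>q. X q $ k)) ?q)) (at u)" for i
    by (rule chart_chain[OF base_Ck_deriv[OF surface_base_Ck[OF X]] k u])
  have "((\<lambda>u'. Q' \<kappa> u' w $ 1 * D 1 (\<lambda>q. X q $ k) (param \<kappa> u') + Q' \<kappa> u' w $ 2 * D 2 (\<lambda>q. X q $ k) (param \<kappa> u'))
      has_derivative (\<lambda>v. (Q' \<kappa> u w $ 1 * base_deriv (Q' \<kappa> u v) (D 1 (\<lambda>q. X q $ k)) ?q + Q2 v w $ 1 * D 1 (\<lambda>q. X q $ k) ?q) +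
        (Q' \<kappa> u w $ 2 * base_deriv (Q' \<kappa> u v) (D 2 (\<lambda>q. X q $ k)) ?q + Q2 v w $ 2 * D 2 (\<lambda>q. X q $ k) ?q))) (at u)"
    by (intro has_derivative_add has_derivative_mult q2 d)
  then have "((\<lambda>u'. frechet_derivative (X \<circ> param \<kappa>) (at u') w $ k)
      has_derivative (\<lambda>v. (Q' \<kappa> u w $ 1 * base_deriv (Q' \<kappa> u v) (D 1 (\<lambda>q. X q $ k)) ?q + Q2 v w $ 1 * D 1 (\<lambda>q. X q $ k) ?q) +
        (Q' \<kappa> u w $ 2 * base_deriv (Q' \<kappa> u v) (D 2 (\<lambda>q. X q $ k)) ?q + Q2 v w $ 2 * D 2 (\<lambda>q. X q $ k) ?q))) (at u)"
    by (rule has_derivative_transform_within_open[OF _ chart(2)[OF k] u])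
      (simp add: chart_first_derivative[OF X k])
  from fun_cong[OF has_derivative_unique[OF 1 this], of v]
  show ?thesis
    unfolding base_deriv_eq_D[OF base_Ck_deriv[OF surface_base_Ck[OF X]], of "Q' \<kappa> u v"]
    by (simp add: sum_2 algebra_simps o_def)
qed

text \<open>If the Jacobian vanished, some nonzero tangent direction would be mapped by
  \<open>X\<close> to a vertical vector, against immersivity and transversality. This covers every
  surface \<open>F t\<close>, not only \<open>x\<close>.\<close>

lemma surface_nondegenerate:
  assumes X: "calabi_surface \<A> X"
  shows "jac X q \<noteq> 0"
proof
  assume J: "jac X q = 0"
  obtain \<kappa> where k: "\<kappa> \<in> \<A>" "q \<in> dom_of \<kappa>" using smooth_atlas_cover[OF atlas] .
  define u where "u = coord \<kappa> q"
  have u: "u \<in> cod_of \<kappa>" "param \<kappa> u = q" using k param_coord'[OF k] by (auto simp: u_def)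
  let ?X = "frechet_derivative (X \<circ> param \<kappa>) (at u)"
  have Xp: "inj ?X" "calabi_normal \<notin> range ?X" and s: "smooth_on (cod_of \<kappa>) (X \<circ> param \<kappa>)"
    using X k(1) u by (auto simp: calabi_surface_def smooth_map_def)
  have linX: "linear ?X" using smooth_on_has_derivative[OF s u(1)] has_derivative_linear by blast
  have surjQ: "surj (Q' \<kappa> u)"
    using inj_Q_derivative[OF k(1) u(1)] linear_inj_imp_surj by blast
  define p where "p i k = D i (\<lambda>q. X q $ k) q" for i k
  have J': "p 1 1 * p 2 2 - p 2 1 * p 1 2 = 0" using J by (simp add: jac_def p_def)
  \<comment> \<open>A nonzero kernel vector of a singular matrix; the cases make sure that the row
    it is read off from is nonzero.\<close>
  have "\<exists>c1 c2. (c1 \<noteq> 0 \<or> c2 \<noteq> 0) \<and> c1 * p 1 1 + c2 * p 2 1 = 0 \<and> c1 * p 1 2 + c2 * p 2 2 = 0"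
  proof (cases "p 1 1 = 0 \<and> p 2 1 = 0")
    case True
    show ?thesis
    proof (cases "p 1 2 = 0 \<and> p 2 2 = 0")
      case True
      then show ?thesis using \<open>p 1 1 = 0 \<and> p 2 1 = 0\<close> by (intro exI[of _ 1] exI[of _ 0]) auto
    next
      case False
      then show ?thesis using True by (intro exI[of _ "p 2 2"] exI[of _ "- p 1 2"]) auto
    qed
  next
    case False
    then show ?thesis using J' by (intro exI[of _ "p 2 1"] exI[of _ "- p 1 1"]) (auto simp: algebra_simps)
  qed
  then obtain c1 c2 where c: "c1 \<noteq> 0 \<or> c2 \<noteq> 0" "c1 * p 1 1 + c2 * p 2 1 = 0" "c1 * p 1 2 + c2 * p 2 2 = 0"
    by blast
  obtain z where z: "Q' \<kappa> u z = vector [c1, c2]" using surjQ by (metis surj_def)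
  have "z \<noteq> 0"
    proof
      assume "z = 0"
      then have "vector [c1, c2] = (0::real^2)"
        using z linear_0[OF inj_Q_derivative(1)[OF k(1) u(1)]] by simp
      then show False using c(1) by (auto simp: vec_eq_iff forall_2)
    qed
  then have nz: "?X z \<noteq> 0" using Xp(1) linear_injective_0[OF linX] by blast
  have "base_point (?X z) = 0"
    using c(2,3) chart_first_derivative[OF X k(1) u(1), of z] z u(2)
    by (simp add: vec_eq_iff forall_2 p_def)
  from base_point_eq_0[OF this] have eq: "?X z = (?X z $ 3) *\<^sub>R calabi_normal" .
  then have n: "?X z $ 3 \<noteq> 0" using nz by (metis scaleR_zero_left)
  have "?X ((1 / (?X z $ 3)) *\<^sub>R z) = (1 / (?X z $ 3)) *\<^sub>R ?X z" by (rule linear_scale[OF linX])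
  also have "\<dots> = calabi_normal" using n by (subst (2) eq) simp
  finally show False using Xp(2) by (metis rangeI)
qed

lemma surface_gauss:
  assumes X: "calabi_surface \<A> X" and k: "k = 1 \<or> k = 2"
  shows "D i (D j (\<lambda>q. X q $ k)) q = chr1 X i j q * D 1 (\<lambda>q. X q $ k) q + chr2 X i j q * D 2 (\<lambda>q. X q $ k) q"
proof -
  note J = surface_nondegenerate[OF X, of q]
  have "jac X q * D i (D j (\<lambda>q. X q $ k)) q =
    jac X q * (chr1 X i j q * D 1 (\<lambda>q. X q $ k) q + chr2 X i j q * D 2 (\<lambda>q. X q $ k) q)"
    using k J unfolding chr1_def chr2_def
    by (auto simp: distrib_left) (auto simp: jac_def algebra_simps)
  then show ?thesis using J by simp
qed

text \<open>The metric is a tensor: passing from base to chart coordinates only inserts the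
  derivative of \<open>Q \<kappa>\<close> in both slots, because its second derivative is absorbed
  by the tangential part.\<close>

lemma calabi_metric_eq:
  assumes X: "calabi_surface \<A> X" and k: "\<kappa> \<in> \<A>" and u: "u \<in> cod_of \<kappa>"
  shows "calabi_metric (X \<circ> param \<kappa>) u v w =
    (\<Sum>j\<in>UNIV. \<Sum>i\<in>UNIV. Q' \<kappa> u v $ j * Q' \<kappa> u w $ i * gmet X j i (param \<kappa> u))"
  unfolding calabi_metric_def
proof (rule the_equality)
  let ?q = "param \<kappa> u"
  let ?X = "frechet_derivative (X \<circ> param \<kappa>) (at u)"
  let ?S = "frechet_derivative (\<lambda>u'. frechet_derivative (X \<circ> param \<kappa>) (at u') w) (at u) v"
  let ?g = "\<Sum>j\<in>UNIV. \<Sum>i\<in>UNIV. Q' \<kappa> u v $ j * Q' \<kappa> u w $ i * gmet X j i ?q"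
  have n: "calabi_normal \<notin> range ?X" and s: "smooth_on (cod_of \<kappa>) (X \<circ> param \<kappa>)"
    using X k u by (auto simp: calabi_surface_def smooth_map_def)
  have linX: "linear ?X" using smooth_on_has_derivative[OF s u] has_derivative_linear by blast
  define Q2 where "Q2 = frechet_derivative (\<lambda>u'. Q' \<kappa> u' w) (at u) v"
  \<comment> \<open>Base coordinates of the tangential remainder: the second derivative of the
    coordinate change plus the connection coefficients.\<close>
  define c where "c = (vector [Q2 $ 1 + (\<Sum>j\<in>UNIV. \<Sum>i\<in>UNIV. Q' \<kappa> u v $ j * Q' \<kappa> u w $ i * chr1 X j i ?q),
    Q2 $ 2 + (\<Sum>j\<in>UNIV. \<Sum>i\<in>UNIV. Q' \<kappa> u v $ j * Q' \<kappa> u w $ i * chr2 X j i ?q)] :: real^2)"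
  have "surj (Q' \<kappa> u)"
    using inj_Q_derivative[OF k u] linear_inj_imp_surj by blast
  then obtain z where z: "Q' \<kappa> u z = c" by (metis surj_def)
  have S: "?S $ k = (Q2 $ 1 * D 1 (\<lambda>q. X q $ k) ?q + Q2 $ 2 * D 2 (\<lambda>q. X q $ k) ?q) +
    (\<Sum>j\<in>UNIV. \<Sum>i\<in>UNIV. Q' \<kappa> u v $ j * Q' \<kappa> u w $ i * D j (D i (\<lambda>q. X q $ k)) ?q)" for k
    unfolding chart_second_derivative[OF X \<open>\<kappa> \<in> \<A>\<close> u] Q2_def by (simp add: sum_2)
  have Z: "?X z $ k = c $ 1 * D 1 (\<lambda>q. X q $ k) ?q + c $ 2 * D 2 (\<lambda>q. X q $ k) ?q" for k
    unfolding chart_first_derivative[OF X \<open>\<kappa> \<in> \<A>\<close> u] z by simp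
  have 3: "D j (D i (\<lambda>q. X q $ 3)) ?q = chr1 X j i ?q * D 1 (\<lambda>q. X q $ 3) ?q +
     chr2 X j i ?q * D 2 (\<lambda>q. X q $ 3) ?q + gmet X j i ?q" for i j
    by (simp add: gmet_def)
  have "?S - ?g *\<^sub>R calabi_normal = ?X z"
    unfolding vec_eq_iff forall_3 vector_minus_component vector_scaleR_component S Z
    by (simp add: calabi_normal_def surface_gauss[OF X] 3 c_def sum_2 algebra_simps)
  then show "?S - ?g *\<^sub>R calabi_normal \<in> range ?X" by simp
  fix g assume "?S - g *\<^sub>R calabi_normal \<in> range ?X"
  then obtain z' where "?S - g *\<^sub>R calabi_normal = ?X z'" by blast
  \<comment> \<open>Uniqueness: two admissible values would differ by a multiple of the normal lying
    in the tangent plane.\<close>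
  moreover have "(g - ?g) *\<^sub>R calabi_normal = (?S - ?g *\<^sub>R calabi_normal) - (?S - g *\<^sub>R calabi_normal)"
    by (simp only: scaleR_left_diff_distrib) simp
  ultimately have "(g - ?g) *\<^sub>R calabi_normal = ?X (z - z')"
    unfolding \<open>?S - ?g *\<^sub>R calabi_normal = ?X z\<close> linear_diff[OF linX, of z z'] by (simp only:)
  then have eq: "(1 / (g - ?g)) *\<^sub>R ((g - ?g) *\<^sub>R calabi_normal) = ?X ((1 / (g - ?g)) *\<^sub>R (z - z'))"
    unfolding linear_scale[OF linX] by (simp only:)
  show "g = ?g"
  proof (rule ccontr)
    assume "g \<noteq> ?g"
    then have "g - ?g \<noteq> 0" by simp
    then have "(1 / (g - ?g)) *\<^sub>R ((g - ?g) *\<^sub>R calabi_normal) = calabi_normal"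
      unfolding scaleR_scaleR by (simp only: divide_self_if nonzero_divide_mult_cancel_right times_divide_eq_left mult_1_left if_False scaleR_one)
    from trans[OF sym[OF this] eq] have "calabi_normal \<in> range ?X" by (rule range_eqI)
    with n show False by (rule notE)
  qed
qed

lemma gmet_sym:
  assumes X: "calabi_surface \<A> X"
  shows "gmet X 2 1 q = gmet X 1 2 q"
proof -
  have "D 2 (D 1 (\<lambda>q. X q $ k)) q = D 1 (D 2 (\<lambda>q. X q $ k)) q" for k
    by (rule base_deriv_commute[OF surface_base_Ck[OF X] open_UNIV UNIV_I])
  then show ?thesis by (simp add: gmet_def chr1_def chr2_def)
qed

lemma gmet_pos:
  assumes X: "calabi_surface \<A> X"
  shows "gmet X 1 1 q > 0" "gdet X q > 0"
proof -
  obtain \<kappa> where k: "\<kappa> \<in> \<A>" "q \<in> dom_of \<kappa>" using smooth_atlas_cover[OF atlas] .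
  define u where "u = coord \<kappa> q"
  have u: "u \<in> cod_of \<kappa>" "param \<kappa> u = q" using k param_coord'[OF k] by (auto simp: u_def)
  have surjQ: "surj (Q' \<kappa> u)"
    using inj_Q_derivative[OF k(1) u(1)] linear_inj_imp_surj by blast
  have pos: "a * a * gmet X 1 1 q + 2 * a * b * gmet X 1 2 q + b * b * gmet X 2 2 q > 0" if "a \<noteq> 0 \<or> b \<noteq> 0" for a b
  proof -
    obtain z where z: "Q' \<kappa> u z = vector [a, b]" using surjQ by (metis surj_def)
    have "z \<noteq> 0"
    proof
      assume "z = 0"
      then have "vector [a, b] = (0::real^2)"
        using z linear_0[OF inj_Q_derivative(1)[OF k(1) u(1)]] by simp
      then show False using that by (auto simp: vec_eq_iff forall_2)
    qed
    then have "calabi_metric (X \<circ> param \<kappa>) u z z > 0"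
      using X k(1) u(1) by (auto simp: calabi_surface_def)
    then show ?thesis
      unfolding calabi_metric_eq[OF X k(1) u(1)] z u(2) by (simp add: sum_2 gmet_sym[OF X] algebra_simps)
  qed
  show 1: "gmet X 1 1 q > 0" using pos[of 1 0] by simp
  \<comment> \<open>The value of the quadratic form at the vector with components -G12 and G11 is
    G11 times the determinant.\<close>
  have "0 < gmet X 1 1 q * gdet X q"
    using pos[of "- gmet X 1 2 q" "gmet X 1 1 q"] 1 by (simp add: gdet_def power2_eq_square algebra_simps)
  then show "gdet X q > 0" using 1 by (simp add: zero_less_mult_iff)
qed

text \<open>The Gram matrix is congruent to \<open>gmet\<close> through the derivative of
  \<open>Q \<kappa>\<close>. The factor \<bar>det DQ\<bar> that comes out of the root is the chart
  density of the base measure, which leaves \<open>rho\<close>.\<close>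

lemma sqrt_det_calabi_gram:
  assumes X: "calabi_surface \<A> X" and k: "\<kappa> \<in> \<A>" and u: "u \<in> cod_of \<kappa>"
  shows "sqrt (det (calabi_gram (X \<circ> param \<kappa>) u)) = rho X (param \<kappa> u) * \<bar>det (matrix (Q' \<kappa> u))\<bar>"
proof -
  have "det (calabi_gram (X \<circ> param \<kappa>) u) = (det (matrix (Q' \<kappa> u)))\<^sup>2 * gdet X (param \<kappa> u)"
    unfolding det_matrix_2 unfolding calabi_gram_def det_2
    by (simp add: calabi_metric_eq[OF X k u] sum_2 gmet_sym[OF X] gdet_def power2_eq_square algebra_simps)
  then show ?thesis by (simp add: real_sqrt_mult rho_def)
qed

lemma rho_base_Ck:
  assumes X: "calabi_surface \<A> X"
  shows "base_Ck n U (rho X)"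
  unfolding rho_def[abs_def] gdet_def gmet_def chr1_def chr2_def jac_def
  by (intro base_Ck_sqrt base_Ck_diff base_Ck_mult base_Ck_divide base_Ck_power2 base_Ck_deriv surface_base_Ck[OF X])
    (use surface_nondegenerate[OF X] gmet_pos(2)[OF X] in
      \<open>simp_all add: gdet_def gmet_def chr1_def chr2_def jac_def\<close>)

lemma rho_measurable: "calabi_surface \<A> X \<Longrightarrow> rho X \<in> borel_measurable borel"
  using base_Ck_imp_continuous_on[OF rho_base_Ck open_UNIV] by (intro borel_measurable_continuous_onI)

section \<open>The Calabi volume as a density against the base measure\<close>

lemma measurable_param:
  assumes "\<kappa> \<in> \<A>"
  shows "param \<kappa> \<in> restrict_space lborel (cod_of \<kappa>) \<rightarrow>\<^sub>M borel"
  using borel_measurable_continuous_on_restrict[OF homeomorphism_cont2[OF chart(3)[OF assms]]]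
  by (simp cong: measurable_cong_sets add: sets_restrict_space)

lemma measurable_jacobian:
  assumes "\<kappa> \<in> \<A>"
  shows "(\<lambda>u. \<bar>det (matrix (Q' \<kappa> u))\<bar>) \<in> borel_measurable (restrict_space lborel (cod_of \<kappa>))"
proof -
  have "continuous_on (cod_of \<kappa>) (\<lambda>u. Q' \<kappa> u v $ i)" for v i
    by (rule Ck_on_imp_continuous_on[OF Ck_on_nth[OF chart(2)[OF assms]
      smooth_on_imp_Ck_on[OF smooth_on_frechet_derivative[OF smooth_Q[OF assms]]]]])
  then have "continuous_on (cod_of \<kappa>) (\<lambda>u. \<bar>det (matrix (Q' \<kappa> u))\<bar>)"
    unfolding det_matrix_2
    by (intro continuous_on_rabs continuous_on_diff continuous_on_mult)
  from borel_measurable_continuous_on_restrict[OF this] show ?thesis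
    by (simp cong: measurable_cong_sets add: sets_restrict_space)
qed

text \<open>In each chart the base measure has the density \<open>\<bar>det DQ\<bar>\<close>, by the change of variables formula.\<close>

lemma chart_base_measure:
  assumes k: "\<kappa> \<in> \<A>" and W: "sheet W" "W \<subseteq> dom_of \<kappa>" and S: "S \<in> sets borel" "S \<subseteq> W"
  shows "emeasure base_measure S =
    emeasure (distr (density (restrict_space lborel (cod_of \<kappa>)) (\<lambda>u. ennreal \<bar>det (matrix (Q' \<kappa> u))\<bar>)) borel (param \<kappa>)) S"
proof -
  let ?B = "param \<kappa> -` S \<inter> cod_of \<kappa>"
  have cod: "cod_of \<kappa> \<in> sets borel" using chart(2)[OF k] by auto
  have B: "?B \<in> sets (restrict_space lborel (cod_of \<kappa>))"
    using measurable_sets[OF measurable_param[OF k] S(1)] by (simp add: space_restrict_space)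
  then have Bb: "?B \<in> sets borel" using cod by (auto simp: sets_restrict_space_iff)
  have QB: "Q \<kappa> ` ?B = P ` S"
  proof -
    have "q \<in> param \<kappa> ` ?B" if "q \<in> S" for q
    proof (rule image_eqI[of _ _ "coord \<kappa> q"])
      have "q \<in> dom_of \<kappa>" using that S(2) W(2) by blast
      then show "q = param \<kappa> (coord \<kappa> q)" "coord \<kappa> q \<in> ?B" using param_coord'[OF k] that by auto
    qed
    then have "param \<kappa> ` ?B = S" by auto
    moreover have "Q \<kappa> ` ?B = P ` (param \<kappa> ` ?B)" by (simp add: Q_def[abs_def] image_image)
    ultimately show ?thesis by simp
  qed
  have inj: "inj_on (Q \<kappa>) ?B"
  proof (rule inj_onI)
    fix a b assume ab: "a \<in> ?B" "b \<in> ?B" "Q \<kappa> a = Q \<kappa> b"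
    then have "param \<kappa> a = param \<kappa> b"
      using W(1) S(2) unfolding sheet_def Q_def inj_on_def by (metis IntD1 subsetD vimageD)
    then show "a = b" using ab coord_param by (metis IntD2)
  qed
  have meas: "(\<lambda>u. indicator ?B u * \<bar>det (matrix (Q' \<kappa> u))\<bar>) \<in> borel_measurable borel"
  proof -
    have "(\<lambda>u. indicator ?B u *\<^sub>R \<bar>det (matrix (Q' \<kappa> u))\<bar>) \<in> borel_measurable borel"
    proof (subst borel_measurable_restrict_space_iff[symmetric])
      show "?B \<inter> space borel \<in> sets borel" using Bb by simp
      have "(\<lambda>u. \<bar>det (matrix (Q' \<kappa> u))\<bar>) \<in> borel_measurable (restrict_space borel (cod_of \<kappa>))"
        using measurable_jacobian[OF k] by (simp cong: measurable_cong_sets add: sets_restrict_space)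
      then show "(\<lambda>u. \<bar>det (matrix (Q' \<kappa> u))\<bar>) \<in> borel_measurable (restrict_space borel ?B)"
        by (rule measurable_restrict_mono) auto
    qed
    then show ?thesis by simp
  qed
  have "emeasure base_measure S = emeasure lborel (Q \<kappa> ` ?B)"
    using emeasure_base_measure[OF W(1) S] QB by simp
  also have "\<dots> = (\<integral>\<^sup>+u. indicator ?B u * ennreal \<bar>det (matrix (Q' \<kappa> u))\<bar> \<partial>lborel)"
  proof (rule emeasure_lborel_image[OF Bb _ _ inj meas])
    show "Q \<kappa> ` ?B \<in> sets borel" using QB sheet_image_borel[OF W(1) S] by simp
    show "(Q \<kappa> has_derivative Q' \<kappa> u) (at u)" if "u \<in> ?B" for u
      using smooth_on_has_derivative[OF smooth_Q[OF k]] that by blast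
  qed
  also have "\<dots> = (\<integral>\<^sup>+u. ennreal \<bar>det (matrix (Q' \<kappa> u))\<bar> * indicator ?B u \<partial>restrict_space lborel (cod_of \<kappa>))"
    using cod by (subst nn_integral_restrict_space) (auto intro!: nn_integral_cong split: split_indicator)
  also have "\<dots> = emeasure (density (restrict_space lborel (cod_of \<kappa>)) (\<lambda>u. ennreal \<bar>det (matrix (Q' \<kappa> u))\<bar>)) ?B"
    using B measurable_jacobian[OF k] by (subst emeasure_density) auto
  also have "\<dots> = emeasure (distr (density (restrict_space lborel (cod_of \<kappa>)) (\<lambda>u. ennreal \<bar>det (matrix (Q' \<kappa> u))\<bar>)) borel (param \<kappa>)) S"
    using S measurable_param[OF k] by (subst emeasure_distr) (auto simp: space_restrict_space)
  finally show ?thesis .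
qed

text \<open>The chart density factors into the Jacobian and \<open>rho\<close>. The Jacobian part,
  pushed forward by \<open>param \<kappa>\<close>, agrees with \<open>base_measure\<close> on
  subsets of the sheet, so only \<open>rho\<close> remains under the integral.\<close>

lemma chart_volume_eq:
  assumes X: "calabi_surface \<A> X" and k: "\<kappa> \<in> \<A>" and W: "sheet W" "W \<subseteq> dom_of \<kappa>"
    and S: "S \<in> sets borel" "S \<subseteq> W"
  shows "emeasure (chart_volume \<kappa> X) S = (\<integral>\<^sup>+q. ennreal (rho X q) * indicator S q \<partial>base_measure)"
proof -
  let ?R = "restrict_space lborel (cod_of \<kappa>)"
  let ?J = "\<lambda>u. ennreal \<bar>det (matrix (Q' \<kappa> u))\<bar>"
  let ?N = "distr (density ?R ?J) borel (param \<kappa>)"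
  have mJ[measurable]: "?J \<in> borel_measurable ?R" using measurable_jacobian[OF k] by simp
  have mp[measurable]: "param \<kappa> \<in> ?R \<rightarrow>\<^sub>M borel" by (rule measurable_param[OF k])
  have mr[measurable]: "rho X \<in> borel_measurable borel" by (rule rho_measurable[OF X])
  have ms[measurable]: "S \<in> sets borel" by (rule S)
  have Wb: "W \<in> sets borel" using W by (simp add: open_sheet)
  have "chart_volume \<kappa> X = distr (density ?R (\<lambda>u. ?J u * ennreal (rho X (param \<kappa> u)))) borel (param \<kappa>)"
    unfolding chart_volume_def
  proof (rule arg_cong[where f="\<lambda>M. distr M borel (param \<kappa>)"], rule density_cong)
    have eq: "ennreal (sqrt (det (calabi_gram (X \<circ> param \<kappa>) u))) = ?J u * ennreal (rho X (param \<kappa> u))"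
      if "u \<in> space ?R" for u
      using sqrt_det_calabi_gram[OF X k, of u] that
      by (simp add: space_restrict_space ennreal_mult'' mult.commute)
    then show "AE u in ?R. ennreal (sqrt (det (calabi_gram (X \<circ> param \<kappa>) u))) = ?J u * ennreal (rho X (param \<kappa> u))"
      by simp
    show m: "(\<lambda>u. ?J u * ennreal (rho X (param \<kappa> u))) \<in> borel_measurable ?R" by measurable
    show "(\<lambda>u. ennreal (sqrt (det (calabi_gram (X \<circ> param \<kappa>) u)))) \<in> borel_measurable ?R"
      using m by (rule measurable_cong[THEN iffD2, rotated]) (rule eq)
  qed
  then have "emeasure (chart_volume \<kappa> X) S =
      emeasure (density ?R (\<lambda>u. ?J u * ennreal (rho X (param \<kappa> u)))) (param \<kappa> -` S \<inter> cod_of \<kappa>)"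
    using S by (simp add: emeasure_distr space_restrict_space)
  also have "\<dots> = (\<integral>\<^sup>+u. ?J u * (ennreal (rho X (param \<kappa> u)) * indicator S (param \<kappa> u)) \<partial>?R)"
    using measurable_sets[OF mp S(1)]
    by (subst emeasure_density)
      (auto simp: space_restrict_space intro!: nn_integral_cong split: split_indicator)
  also have "\<dots> = (\<integral>\<^sup>+u. ennreal (rho X (param \<kappa> u)) * indicator S (param \<kappa> u) \<partial>density ?R ?J)"
    using measurable_jacobian[OF k] by (subst nn_integral_density) auto
  also have "\<dots> = (\<integral>\<^sup>+q. ennreal (rho X q) * indicator S q \<partial>?N)"
    by (subst nn_integral_distr) auto
  also have "\<dots> = (\<integral>\<^sup>+q. ennreal (rho X q) * indicator S q \<partial>restrict_space ?N W)"
    using Wb S(2) by (subst nn_integral_restrict_space) (auto intro!: nn_integral_cong split: split_indicator)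
  also have "restrict_space ?N W = restrict_space base_measure W"
  proof (rule measure_eqI)
    show "sets (restrict_space ?N W) = sets (restrict_space base_measure W)"
      by (simp add: sets_restrict_space)
    fix A assume "A \<in> sets (restrict_space ?N W)"
    then have A: "A \<in> sets borel" "A \<subseteq> W" using Wb by (auto simp: sets_restrict_space_iff)
    then show "emeasure (restrict_space ?N W) A = emeasure (restrict_space base_measure W) A"
      using Wb chart_base_measure[OF k W A] by (simp add: emeasure_restrict_space)
  qed
  also have "(\<integral>\<^sup>+q. ennreal (rho X q) * indicator S q \<partial>restrict_space base_measure W) =
      (\<integral>\<^sup>+q. ennreal (rho X q) * indicator S q \<partial>base_measure)"
    using Wb S(2) by (subst nn_integral_restrict_space) (auto intro!: nn_integral_cong split: split_indicator)
  finally show ?thesis .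
qed

text \<open>A competing chart \<mu> measures only the part of a set inside its own domain, so on
  subsets of a sheet contained in the domain of \<kappa> the supremum is attained at
  \<kappa>.\<close>

lemma calabi_volume_sheet:
  assumes X: "calabi_surface \<A> X" and k: "\<kappa> \<in> \<A>" and W: "sheet W" "W \<subseteq> dom_of \<kappa>"
    and S: "S \<in> sets borel" "S \<subseteq> W"
  shows "emeasure (calabi_volume \<A> X) S = (\<integral>\<^sup>+q. ennreal (rho X q) * indicator S q \<partial>base_measure)"
proof -
  let ?N = "density base_measure (\<lambda>q. ennreal (rho X q))"
  have mr[measurable]: "rho X \<in> borel_measurable borel" by (rule rho_measurable[OF X])
  have N: "emeasure ?N A = (\<integral>\<^sup>+q. ennreal (rho X q) * indicator A q \<partial>base_measure)" if "A \<in> sets borel" for A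
    using that by (subst emeasure_density) auto
  have "emeasure (calabi_volume \<A> X) S = emeasure ?N S"
    unfolding calabi_volume_def
  proof (rule emeasure_SUP_local[where W=W and ?i0.0=\<kappa>, OF _ _ _ k _ S])
    fix \<mu> A assume m: "\<mu> \<in> \<A>" and A: "A \<in> sets borel" "A \<subseteq> W"
    let ?A = "A \<inter> dom_of \<mu>"
    have A': "?A \<in> sets borel" using A chart(1)[OF m] by auto
    have V: "sheet (W \<inter> dom_of \<mu>)" using W(1) chart(1)[OF m] by (intro sheet_subset[OF W(1)]) (auto simp: open_sheet)
    have "param \<mu> -` A \<inter> cod_of \<mu> = param \<mu> -` ?A \<inter> cod_of \<mu>" using param_in[of _ \<mu>] by auto
    then have "emeasure (chart_volume \<mu> X) A = emeasure (chart_volume \<mu> X) ?A"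
      unfolding chart_volume_def using A A' measurable_param[OF m]
      by (simp add: emeasure_distr space_restrict_space)
    also have "\<dots> = emeasure ?N ?A"
      using chart_volume_eq[OF X m V _ A'] A N[OF A'] by auto
    also have "\<dots> \<le> emeasure ?N A" using A A' by (intro emeasure_mono) auto
    finally show "emeasure (chart_volume \<mu> X) A \<le> emeasure ?N A" .
  next
    fix A assume A: "A \<in> sets borel" "A \<subseteq> W"
    show "emeasure (chart_volume \<kappa> X) A = emeasure ?N A"
      using chart_volume_eq[OF X k W A] N[OF A(1)] by simp
  qed (auto simp: chart_volume_def)
  then show ?thesis using N S by simp
qed

lemma calabi_volume_compact:
  assumes X: "calabi_surface \<A> X" and K: "compact K"
  shows "measure (calabi_volume \<A> X) K = (\<integral>q. indicator K q * rho X q \<partial>base_measure)"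
proof -
  let ?N = "density base_measure (\<lambda>q. ennreal (rho X q))"
  let ?V = "calabi_volume \<A> X"
  have mr[measurable]: "rho X \<in> borel_measurable borel" by (rule rho_measurable[OF X])
  have mK[measurable]: "K \<in> sets borel" using K by (simp add: borel_compact)
  have N: "emeasure ?N A = (\<integral>\<^sup>+q. ennreal (rho X q) * indicator A q \<partial>base_measure)" if "A \<in> sets borel" for A
    using that by (subst emeasure_density) auto
  obtain \<kappa>0 where "\<kappa>0 \<in> \<A>" using smooth_atlas_cover[OF atlas] by metis
  then have sV: "sets ?V = sets borel"
    unfolding calabi_volume_def by (intro sets_SUP) (auto simp: chart_volume_def)
  have "\<exists>W. sheet W \<and> q \<in> W \<and> (\<forall>S. S \<in> sets borel \<and> S \<subseteq> W \<longrightarrow> emeasure ?V S = emeasure ?N S)" for q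
  proof -
    obtain \<kappa> where k: "\<kappa> \<in> \<A>" "q \<in> dom_of \<kappa>" using smooth_atlas_cover[OF atlas] .
    obtain W where W: "sheet W" "q \<in> W" "W \<subseteq> dom_of \<kappa>" using ex_sheet[OF chart(1)[OF k(1)] k(2)] by blast
    then show ?thesis using calabi_volume_sheet[OF X k(1) W(1,3)] N by auto
  qed
  then obtain W where W: "\<And>q. sheet (W q)" "\<And>q. q \<in> W q"
    "\<And>q S. S \<in> sets borel \<Longrightarrow> S \<subseteq> W q \<Longrightarrow> emeasure ?V S = emeasure ?N S" by metis
  \<comment> \<open>Finitely many sheets are peeled off one at a time; the part of \<open>S\<close>
    outside the current sheet is covered by the remaining ones.\<close>
  have step: "S \<in> sets borel \<Longrightarrow> S \<subseteq> (\<Union>q\<in>F. W q) \<Longrightarrow> emeasure ?V S = emeasure ?N S" if "finite F" for F S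
    using that
  proof (induction F arbitrary: S)
    case (insert q F)
    have wb: "W q \<in> sets borel" using open_sheet[OF W(1)] by simp
    have S: "S \<inter> W q \<in> sets borel" "S - W q \<in> sets borel" "(S \<inter> W q) \<inter> (S - W q) = {}"
      "S = (S \<inter> W q) \<union> (S - W q)"
      using insert.prems wb by auto
    have "emeasure ?V S = emeasure ?V (S \<inter> W q) + emeasure ?V (S - W q)"
      using plus_emeasure[of "S \<inter> W q" ?V "S - W q"] S sV by simp
    also have "\<dots> = emeasure ?N (S \<inter> W q) + emeasure ?N (S - W q)"
      using W(3)[OF S(1) Int_lower2] insert.IH[OF S(2)] insert.prems by auto
    also have "\<dots> = emeasure ?N S"
      using plus_emeasure[of "S \<inter> W q" ?N "S - W q"] S by simp
    finally show ?case .
  qed simp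
  obtain F where F: "finite F" "K \<subseteq> (\<Union>q\<in>F. W q)"
  proof (rule compactE_image[OF K, of UNIV W])
    show "open (W q)" for q using W(1) open_sheet by simp
    show "K \<subseteq> (\<Union>q\<in>UNIV. W q)" using W(2) by auto
  qed auto
  have nn: "rho X q \<ge> 0" for q using gmet_pos(2)[OF X, of q] by (simp add: rho_def)
  have "measure ?V K = enn2real (\<integral>\<^sup>+q. ennreal (rho X q) * indicator K q \<partial>base_measure)"
    using step[OF F(1) mK F(2)] N[OF mK] by (simp add: measure_def)
  also have "\<dots> = enn2real (\<integral>\<^sup>+q. ennreal (indicator K q * rho X q) \<partial>base_measure)"
    by (intro arg_cong[where f=enn2real] nn_integral_cong) (simp split: split_indicator)
  also have "\<dots> = (\<integral>q. indicator K q * rho X q \<partial>base_measure)"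
    using nn by (intro integral_eq_nn_integral[symmetric]) auto
  finally show ?thesis .
qed


section \<open>Variation of the metric\<close>


text \<open>All orders at once, because \<open>D\<close> lowers the order and the class has to be
  closed under it.\<close>

definition sm :: "('m \<Rightarrow> real) \<Rightarrow> bool" where
  "sm f \<longleftrightarrow> (\<forall>n. base_Ck n UNIV f)"

lemma sm_D: "sm f \<Longrightarrow> sm (D i f)"
  by (auto simp: sm_def intro: base_Ck_deriv)

lemma sm_const: "sm (\<lambda>q. c)"
  by (auto simp: sm_def intro: base_Ck_const)

lemma sm_add: "sm f \<Longrightarrow> sm g \<Longrightarrow> sm (\<lambda>q. f q + g q)"
  by (auto simp: sm_def intro: base_Ck_add)

lemma sm_diff: "sm f \<Longrightarrow> sm g \<Longrightarrow> sm (\<lambda>q. f q - g q)"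
  by (auto simp: sm_def intro: base_Ck_diff)

lemma sm_minus: "sm f \<Longrightarrow> sm (\<lambda>q. - f q)"
  by (auto simp: sm_def intro: base_Ck_minus)

lemma sm_mult: "sm f \<Longrightarrow> sm g \<Longrightarrow> sm (\<lambda>q. f q * g q)"
  by (auto simp: sm_def intro: base_Ck_mult)

lemma sm_power2: "sm f \<Longrightarrow> sm (\<lambda>q. (f q)\<^sup>2)"
  by (auto simp: sm_def intro: base_Ck_power2)

lemma sm_divide: "sm f \<Longrightarrow> sm g \<Longrightarrow> (\<And>q. g q \<noteq> 0) \<Longrightarrow> sm (\<lambda>q. f q / g q)"
  by (auto simp: sm_def intro: base_Ck_divide)

lemma sm_sum: "(\<And>i. i \<in> I \<Longrightarrow> sm (f i)) \<Longrightarrow> sm (\<lambda>q. \<Sum>i\<in>I. f i q)"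
  by (auto simp: sm_def intro: base_Ck_sum)

lemmas sm_intros = sm_D sm_const sm_add sm_diff sm_minus sm_mult sm_power2 sm_sum

lemma sm_C1: "sm f \<Longrightarrow> base_Ck (Suc 0) UNIV f"
  by (simp add: sm_def)

lemma D_const: "D i (\<lambda>q. c) = (\<lambda>q. 0)"
  by (rule ext) (rule base_deriv_const)

lemma D_add: "sm f \<Longrightarrow> sm g \<Longrightarrow> D i (\<lambda>q. f q + g q) = (\<lambda>q. D i f q + D i g q)"
  by (rule ext) (rule base_deriv_add[OF sm_C1 sm_C1 open_UNIV UNIV_I])

lemma D_diff: "sm f \<Longrightarrow> sm g \<Longrightarrow> D i (\<lambda>q. f q - g q) = (\<lambda>q. D i f q - D i g q)"
  by (rule ext) (rule base_deriv_diff[OF sm_C1 sm_C1 open_UNIV UNIV_I])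

lemma D_minus: "sm f \<Longrightarrow> D i (\<lambda>q. - f q) = (\<lambda>q. - D i f q)"
  by (rule ext) (rule base_deriv_minus[OF sm_C1 open_UNIV UNIV_I])

lemma D_mult: "sm f \<Longrightarrow> sm g \<Longrightarrow> D i (\<lambda>q. f q * g q) = (\<lambda>q. f q * D i g q + D i f q * g q)"
  by (rule ext) (rule base_deriv_mult[OF sm_C1 sm_C1 open_UNIV UNIV_I])

lemma D_21: "sm f \<Longrightarrow> D 2 (D 1 f) = D 1 (D 2 f)"
  by (rule ext, rule base_deriv_commute[OF _ open_UNIV UNIV_I]) (simp add: sm_def)

lemmas D_simps = D_const D_add D_diff D_minus D_mult D_21

section \<open>Lie derivatives, divergences and the polarized determinant\<close>

definition adv :: "(2 \<Rightarrow> 'm \<Rightarrow> real) \<Rightarrow> ('m \<Rightarrow> real) \<Rightarrow> 'm \<Rightarrow> real" where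
  "adv \<xi> f q = \<xi> 1 q * D 1 f q + \<xi> 2 q * D 2 f q"

definition dvg :: "(2 \<Rightarrow> 'm \<Rightarrow> real) \<Rightarrow> 'm \<Rightarrow> real" where
  "dvg \<xi> q = D 1 (\<xi> 1) q + D 2 (\<xi> 2) q"

text \<open>The Lie derivative of a density of weight one, which is a divergence and so integrates
  to zero when \<xi> has compact support.\<close>

definition flux :: "(2 \<Rightarrow> 'm \<Rightarrow> real) \<Rightarrow> ('m \<Rightarrow> real) \<Rightarrow> 'm \<Rightarrow> real" where
  "flux \<xi> f q = D 1 (\<lambda>q. f q * \<xi> 1 q) q + D 2 (\<lambda>q. f q * \<xi> 2 q) q"

text \<open>The Lie derivative of a density of weight two.\<close>

definition Lam :: "(2 \<Rightarrow> 'm \<Rightarrow> real) \<Rightarrow> ('m \<Rightarrow> real) \<Rightarrow> 'm \<Rightarrow> real" where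
  "Lam \<xi> f q = adv \<xi> f q + 2 * dvg \<xi> q * f q"

text \<open>The coordinate expression of the Lie derivative of a covariant tensor \<open>A\<close>
  of rank two along \<xi>.\<close>

definition Lie :: "(2 \<Rightarrow> 'm \<Rightarrow> real) \<Rightarrow> (2 \<Rightarrow> 2 \<Rightarrow> 'm \<Rightarrow> real) \<Rightarrow> 2 \<Rightarrow> 2 \<Rightarrow> 'm \<Rightarrow> real" where
  "Lie \<xi> A i j q = \<xi> 1 q * D 1 (A i j) q + \<xi> 2 q * D 2 (A i j) q
     + A 1 j q * D i (\<xi> 1) q + A 2 j q * D i (\<xi> 2) q
     + A i 1 q * D j (\<xi> 1) q + A i 2 q * D j (\<xi> 2) q"

text \<open>The polarized determinant of symmetric matrices: \<open>pol A A\<close> is twice the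
  determinant of \<open>A\<close>, and \<open>pol H A\<close> is det H times the trace of
  \<open>A\<close> relative to \<open>H\<close>.\<close>

definition pol :: "(2 \<Rightarrow> 2 \<Rightarrow> 'm \<Rightarrow> real) \<Rightarrow> (2 \<Rightarrow> 2 \<Rightarrow> 'm \<Rightarrow> real) \<Rightarrow> 'm \<Rightarrow> real" where
  "pol A C q = A 1 1 q * C 2 2 q + A 2 2 q * C 1 1 q - 2 * A 1 2 q * C 1 2 q"

definition Hs :: "('m \<Rightarrow> real) \<Rightarrow> 2 \<Rightarrow> 2 \<Rightarrow> 'm \<Rightarrow> real" where
  "Hs f i j = D i (D j f)"

lemma sm_flux: "sm (\<xi> 1) \<Longrightarrow> sm (\<xi> 2) \<Longrightarrow> sm f \<Longrightarrow> sm (flux \<xi> f)"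
  unfolding flux_def[abs_def] by (intro sm_intros)

lemma sm_Lie:
  "sm (\<xi> 1) \<Longrightarrow> sm (\<xi> 2) \<Longrightarrow> (\<And>i j. sm (A i j)) \<Longrightarrow> sm (Lie \<xi> A i j)"
  unfolding Lie_def[abs_def] by (intro sm_intros)

lemma sm_pol: "(\<And>i j. sm (A i j)) \<Longrightarrow> (\<And>i j. sm (C i j)) \<Longrightarrow> sm (pol A C)"
  unfolding pol_def[abs_def] by (intro sm_intros)

lemma sm_Hs: "sm f \<Longrightarrow> sm (Hs f i j)"
  unfolding Hs_def by (intro sm_intros)

lemma Hs_sym: "sm f \<Longrightarrow> Hs f 2 1 = Hs f 1 2"
  by (simp add: Hs_def D_21)

lemma Lie_sym: "A 2 1 = A 1 2 \<Longrightarrow> Lie \<xi> A 2 1 = Lie \<xi> A 1 2"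
  by (rule ext) (simp add: Lie_def)

text \<open>The determinant of a symmetric covariant tensor is a density of weight two, so its
  polarization obeys Leibniz' rule for Lie derivatives. Symmetry enters because \<open>pol\<close>
  reads only one off-diagonal entry.\<close>

lemma Lam_pol:
  assumes "\<And>i j. sm (A i j)" "\<And>i j. sm (C i j)" "A 2 1 = A 1 2" "C 2 1 = C 1 2"
  shows "Lam \<xi> (pol A C) q = pol (Lie \<xi> A) C q + pol A (Lie \<xi> C) q"
  by (simp add: Lam_def adv_def dvg_def pol_def[abs_def] Lie_def assms D_simps sm_intros algebra_simps)

lemma flux_eq:
  assumes "sm (\<xi> 1)" "sm (\<xi> 2)" "sm f"
  shows "flux \<xi> f q = adv \<xi> f q + dvg \<xi> q * f q"
  by (simp add: flux_def adv_def dvg_def assms D_simps algebra_simps)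

text \<open>Leibniz' rule for a product of two densities of weight one. Compared with
  \<open>Lam_pol\<close>, it extracts divergences of \<sigma> from Lie derivatives of its
  square.\<close>

lemma Lam_mult:
  assumes "sm (\<xi> 1)" "sm (\<xi> 2)" "sm f" "sm g"
  shows "Lam \<xi> (\<lambda>q. f q * g q) q = f q * flux \<xi> g q + g q * flux \<xi> f q"
  by (simp add: flux_eq assms Lam_def adv_def dvg_def D_simps algebra_simps)

lemma Lam_cmult:
  assumes "sm f"
  shows "Lam \<xi> (\<lambda>q. c * f q) q = c * Lam \<xi> f q"
  by (simp add: assms Lam_def adv_def dvg_def D_simps sm_intros algebra_simps)

lemma pol_add_right: "pol A (\<lambda>i j q. C i j q + E i j q) q = pol A C q + pol A E q"
  and pol_commute: "pol A C q = pol C A q"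
  by (simp_all add: pol_def algebra_simps)

definition fld :: "('m \<Rightarrow> real) \<Rightarrow> ('m \<Rightarrow> real) \<Rightarrow> 2 \<Rightarrow> 'm \<Rightarrow> real" where
  "fld f g k = (if k = 1 then f else g)"

lemma fld_simps [simp]: "fld f g 1 = f" "fld f g 2 = g"
  by (simp_all add: fld_def)

text \<open>The acceleration of the flow of \<open>P\<^sub>t\<close> at \<open>t = 0\<close> as a vector field on the base.\<close>

definition accel :: "('m \<Rightarrow> real) \<Rightarrow> ('m \<Rightarrow> real) \<Rightarrow> ('m \<Rightarrow> real) \<Rightarrow> ('m \<Rightarrow> real) \<Rightarrow> 2 \<Rightarrow> 'm \<Rightarrow> real" where
  "accel \<xi>1 \<xi>2 \<eta>1 \<eta>2 = fld (\<lambda>q. \<eta>1 q - \<xi>1 q * D 1 \<xi>1 q - \<xi>2 q * D 2 \<xi>1 q)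
     (\<lambda>q. \<eta>2 q - \<xi>1 q * D 1 \<xi>2 q - \<xi>2 q * D 2 \<xi>2 q)"

abbreviation h :: "'m \<Rightarrow> real" where "h \<equiv> \<lambda>q. x q $ 3"

text \<open>In base coordinates the variation is \<open>P\<^sub>t = id + t\<xi> + t\<^sup>2\<eta>/2 + \<dots>\<close>, \<open>h\<^sub>t = h + ta + t\<^sup>2b/2 + \<dots>\<close>.
  Writing the surfaces as graphs of \<open>f\<^sub>t = h + t\<phi> + t\<^sup>2\<psi>/2 + \<dots>\<close>, expansion of \<open>h\<^sub>t = f\<^sub>t \<circ> P\<^sub>t\<close> gives
  \<open>\<phi>\<close> and \<open>\<psi>\<close>; the next two lemmas compute the first two derivatives of the pulled back Hessian.\<close>

lemma metric_first_variation:
  assumes sm: "sm h" "sm \<xi>1" "sm \<xi>2" "sm \<phi>"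
    and a: "a = (\<lambda>q. \<phi> q + \<xi>1 q * D 1 h q + \<xi>2 q * D 2 h q)"
  defines "\<xi> \<equiv> fld \<xi>1 \<xi>2"
  shows "D 1 (D 1 a) q - D 1 (D 1 \<xi>1) q * D 1 h q - D 1 (D 1 \<xi>2) q * D 2 h q = Hs \<phi> 1 1 q + Lie \<xi> (Hs h) 1 1 q"
    and "D 1 (D 2 a) q - D 1 (D 2 \<xi>1) q * D 1 h q - D 1 (D 2 \<xi>2) q * D 2 h q = Hs \<phi> 1 2 q + Lie \<xi> (Hs h) 1 2 q"
    and "D 2 (D 2 a) q - D 2 (D 2 \<xi>1) q * D 1 h q - D 2 (D 2 \<xi>2) q * D 2 h q = Hs \<phi> 2 2 q + Lie \<xi> (Hs h) 2 2 q"
  by (simp_all add: a sm D_simps sm_intros Hs_def Lie_def \<xi>_def algebra_simps)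

lemma metric_second_variation:
  assumes sm: "sm h" "sm \<xi>1" "sm \<xi>2" "sm \<eta>1" "sm \<eta>2" "sm \<phi>" "sm \<psi>"
    and a: "a = (\<lambda>q. \<phi> q + \<xi>1 q * D 1 h q + \<xi>2 q * D 2 h q)"
    and b: "b = (\<lambda>q. \<psi> q + 2 * (\<xi>1 q * D 1 \<phi> q + \<xi>2 q * D 2 \<phi> q) + \<eta>1 q * D 1 h q + \<eta>2 q * D 2 h q
      + \<xi>1 q * \<xi>1 q * D 1 (D 1 h) q + 2 * (\<xi>1 q * \<xi>2 q * D 1 (D 2 h) q) + \<xi>2 q * \<xi>2 q * D 2 (D 2 h) q)"
  defines "G2 \<equiv> \<lambda>i j q. D i (D j b) q
      - (D i (D j \<eta>1) q - 2 * (D i (D j \<xi>1) q * D 1 \<xi>1 q + D i (D j \<xi>2) q * D 2 \<xi>1 q)) * D 1 h q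
      - (D i (D j \<eta>2) q - 2 * (D i (D j \<xi>1) q * D 1 \<xi>2 q + D i (D j \<xi>2) q * D 2 \<xi>2 q)) * D 2 h q
      - 2 * (D i (D j \<xi>1) q * D 1 a q + D i (D j \<xi>2) q * D 2 a q)"
    and "R \<equiv> \<lambda>i j q. Hs \<psi> i j q + 2 * Lie (fld \<xi>1 \<xi>2) (Hs \<phi>) i j q
      + Lie (accel \<xi>1 \<xi>2 \<eta>1 \<eta>2) (Hs h) i j q + Lie (fld \<xi>1 \<xi>2) (Lie (fld \<xi>1 \<xi>2) (Hs h)) i j q"
  shows "G2 1 1 q = R 1 1 q" and "G2 1 2 q = R 1 2 q" and "G2 2 2 q = R 2 2 q"
  \<comment> \<open>Once \<open>D_21\<close> has put mixed derivatives in a common order, both sides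
    are the same polynomial in partial derivatives.\<close>
  unfolding G2_def R_def
  by (simp_all add: a b sm D_simps sm_intros Hs_def Lie_def[abs_def] accel_def algebra_simps)

end


section \<open>The extremal equation and the density\<close>

lemma matrix_inv_2:
  fixes A :: "real^2^2"
  assumes d: "det A \<noteq> 0"
  shows "matrix_inv A $ 1 $ 1 = A $ 2 $ 2 / det A" "matrix_inv A $ 1 $ 2 = - A $ 1 $ 2 / det A"
    "matrix_inv A $ 2 $ 1 = - A $ 2 $ 1 / det A" "matrix_inv A $ 2 $ 2 = A $ 1 $ 1 / det A"
proof -
  define B :: "real^2^2" where "B = vector [vector [A $ 2 $ 2 / det A, - A $ 1 $ 2 / det A],
    vector [- A $ 2 $ 1 / det A, A $ 1 $ 1 / det A]]"
  have B: "B $ 1 $ 1 = A $ 2 $ 2 / det A" "B $ 1 $ 2 = - A $ 1 $ 2 / det A"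
    "B $ 2 $ 1 = - A $ 2 $ 1 / det A" "B $ 2 $ 2 = A $ 1 $ 1 / det A"
    by (simp_all add: B_def)
  have AB: "A ** B = mat 1"
    using d by (simp add: vec_eq_iff forall_2 matrix_matrix_mult_def sum_2 mat_def B field_simps)
      (simp add: det_2 algebra_simps)
  have "B ** A = mat 1" using AB matrix_left_right_inverse by blast
  then have "matrix_inv A ** A = mat 1"
    unfolding matrix_inv_def using someI[of "\<lambda>A'. A ** A' = mat 1 \<and> A' ** A = mat 1" B] AB by blast
  then have "matrix_inv A ** (A ** B) = B" by (simp add: matrix_mul_assoc)
  then have "matrix_inv A = B" by (simp add: AB)
  then show "matrix_inv A $ 1 $ 1 = A $ 2 $ 2 / det A" "matrix_inv A $ 1 $ 2 = - A $ 1 $ 2 / det A"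
    "matrix_inv A $ 2 $ 1 = - A $ 2 $ 1 / det A" "matrix_inv A $ 2 $ 2 = A $ 1 $ 1 / det A"
    using B by simp_all
qed

text \<open>With \<open>B = A - (c / 2d) H\<close> the form \<open>4d det A - c\<^sup>2\<close> is \<open>4d det B\<close>, and \<open>B\<close> is orthogonal to the
  positive definite \<open>H\<close>, so that \<open>det B \<le> 0\<close>.\<close>

lemma polar_det_ineq:
  fixes H11 H12 H22 A11 A12 A22 :: real
  assumes H: "H11 > 0" and d: "d = H11 * H22 - H12\<^sup>2" "d > 0"
    and c: "c = H11 * A22 + H22 * A11 - 2 * H12 * A12"
  shows "A11 * A22 - A12\<^sup>2 \<le> c\<^sup>2 / (4 * d)"
    and "A11 * A22 - A12\<^sup>2 = c\<^sup>2 / (4 * d) \<Longrightarrow>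
      A11 = c / (2 * d) * H11 \<and> A12 = c / (2 * d) * H12 \<and> A22 = c / (2 * d) * H22"
proof -
  define m where "m = c / (2 * d)"
  have m: "c = 2 * d * m" using d by (simp add: m_def)
  define B11 B12 B22 where "B11 = A11 - m * H11" and "B12 = A12 - m * H12" and "B22 = A22 - m * H22"
  have A: "A11 = B11 + m * H11" "A12 = B12 + m * H12" "A22 = B22 + m * H22"
    by (simp_all add: B11_def B12_def B22_def)
  have "H11 * B22 + H22 * B11 - 2 * H12 * B12 = c - 2 * m * d"
    by (simp add: B11_def B12_def B22_def c d(1) power2_eq_square algebra_simps)
  then have orth: "H11 * B22 + H22 * B11 - 2 * H12 * B12 = 0" using m by simp
  \<comment> \<open>Orthogonality eliminates \<open>B22\<close>. The determinant of \<open>B\<close>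
    multiplied by the square of \<open>H11\<close> then becomes minus a sum of two squares with
    positive weights, which settles both the sign and the equality case.\<close>
  then have B22: "H11 * B22 = 2 * H12 * B12 - H22 * B11" by simp
  have "A11 * A22 - A12\<^sup>2 = B11 * B22 - B12\<^sup>2 + m * (H11 * B22 + H22 * B11 - 2 * H12 * B12) + m\<^sup>2 * d"
    unfolding A d(1) by (simp add: power2_eq_square algebra_simps)
  moreover have "m\<^sup>2 * d = c\<^sup>2 / (4 * d)" using d(2) by (simp add: m power2_eq_square)
  ultimately have e1: "A11 * A22 - A12\<^sup>2 = B11 * B22 - B12\<^sup>2 + c\<^sup>2 / (4 * d)" using orth by simp
  have "H11\<^sup>2 * (B11 * B22 - B12\<^sup>2) = H11 * (B11 * (H11 * B22)) - H11\<^sup>2 * B12\<^sup>2"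
    by (simp add: power2_eq_square algebra_simps)
  also have "\<dots> = - ((H11 * B12 - H12 * B11)\<^sup>2 + d * B11\<^sup>2)"
    unfolding B22 d(1) by (simp add: power2_eq_square algebra_simps)
  finally have e2: "H11\<^sup>2 * (B11 * B22 - B12\<^sup>2) = - ((H11 * B12 - H12 * B11)\<^sup>2 + d * B11\<^sup>2)" .
  have n: "(H11 * B12 - H12 * B11)\<^sup>2 \<ge> 0" "d * B11\<^sup>2 \<ge> 0" using d(2) by auto
  have "H11\<^sup>2 * (B11 * B22 - B12\<^sup>2) \<le> 0" using e2 n by linarith
  then have "B11 * B22 - B12\<^sup>2 \<le> 0" using H by (simp add: mult_le_0_iff)
  then show "A11 * A22 - A12\<^sup>2 \<le> c\<^sup>2 / (4 * d)" using e1 by simp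
  assume "A11 * A22 - A12\<^sup>2 = c\<^sup>2 / (4 * d)"
  then have "B11 * B22 - B12\<^sup>2 = 0" using e1 by simp
  then have "(H11 * B12 - H12 * B11)\<^sup>2 + d * B11\<^sup>2 = 0" using e2 by simp
  then have z: "(H11 * B12 - H12 * B11)\<^sup>2 = 0" "d * B11\<^sup>2 = 0" using n by linarith+
  then have "B11 = 0" using d(2) by simp
  moreover from this have "B12 = 0" using z(1) H by simp
  moreover from calculation have "B22 = 0" using B22 H by simp
  ultimately show "A11 = c / (2 * d) * H11 \<and> A12 = c / (2 * d) * H12 \<and> A22 = c / (2 * d) * H22"
    using A by (simp add: m_def)
qed

context calabi_base
begin

section \<open>The initial surface in its own base coordinates\<close>

abbreviation H :: "2 \<Rightarrow> 2 \<Rightarrow> 'm \<Rightarrow> real" where "H \<equiv> Hs h"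

abbreviation sg :: "'m \<Rightarrow> real" where "sg \<equiv> rho x"

lemma sm_comp: "sm (\<lambda>q. x q $ k)"
  by (simp add: sm_def surface_base_Ck[OF surface])

lemma sm_H: "sm (H i j)" by (rule sm_Hs[OF sm_comp])

lemma D_P:
  "D 1 (\<lambda>q. x q $ 1) = (\<lambda>q. 1)" "D 2 (\<lambda>q. x q $ 1) = (\<lambda>q. 0)"
  "D 1 (\<lambda>q. x q $ 2) = (\<lambda>q. 0)" "D 2 (\<lambda>q. x q $ 2) = (\<lambda>q. 1)"
  using base_deriv_P[of _ "axis 1 1"] base_deriv_P[of _ "axis 2 1"]
  by (auto simp: inner_axis fun_eq_iff) (auto simp: axis_def)

lemma D_D_P: "D i (D j (\<lambda>q. x q $ 1)) = (\<lambda>q. 0)" "D i (D j (\<lambda>q. x q $ 2)) = (\<lambda>q. 0)"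
proof -
  consider "j = 1" | "j = 2" using exhaust_2 by blast
  then show "D i (D j (\<lambda>q. x q $ 1)) = (\<lambda>q. 0)" "D i (D j (\<lambda>q. x q $ 2)) = (\<lambda>q. 0)"
    by (cases; simp add: D_P D_const)+
qed

text \<open>In its own base coordinates \<open>x\<close> is a graph: two components are the
  coordinates themselves, so the connection coefficients vanish and the metric is the Hessian of
  \<open>h\<close>.\<close>

lemma base_geometry:
  "jac x q = 1" "chr1 x i j q = 0" "chr2 x i j q = 0" "gmet x i j q = H i j q"
  by (simp_all add: jac_def chr1_def chr2_def gmet_def D_P D_D_P Hs_def)

lemma H_pos: "H 1 1 q > 0" "H 1 1 q * H 2 2 q - (H 1 2 q)\<^sup>2 > 0"
  using gmet_pos[OF surface, of q] by (simp_all add: base_geometry gdet_def)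

lemma sg_square: "(sg q)\<^sup>2 = H 1 1 q * H 2 2 q - (H 1 2 q)\<^sup>2"
  using H_pos(2)[of q] by (simp add: rho_def gdet_def base_geometry)

lemma sg_pos: "sg q > 0"
  using gmet_pos(2)[OF surface, of q] by (simp add: rho_def)

lemma sm_sg: "sm sg"
  by (simp add: sm_def rho_base_Ck[OF surface])

lemma pol_HH: "pol H H q = 2 * (sg q)\<^sup>2"
  by (simp add: pol_def sg_square) (simp add: power2_eq_square)

text \<open>\<open>hv \<phi>\<close> is the first variation of the area density under \<open>f \<mapsto> f + t\<phi>\<close>.\<close>

definition hv :: "('m \<Rightarrow> real) \<Rightarrow> 'm \<Rightarrow> real" where
  "hv \<phi> q = pol H (Hs \<phi>) q / (2 * sg q)"

text \<open>On the diagonal this is the second derivative at t = 0 of the area density \<sigma>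
  along h + t\<phi>: two derivatives of \<sigma>\<sigma> = det give \<sigma>\<sigma>'' +
  \<sigma>'\<sigma>' = det D D \<phi>, with \<sigma>' = \<open>hv \<phi>\<close>.\<close>

definition qf :: "('m \<Rightarrow> real) \<Rightarrow> ('m \<Rightarrow> real) \<Rightarrow> 'm \<Rightarrow> real" where
  "qf \<phi> \<psi> q = (pol (Hs \<phi>) (Hs \<psi>) q / 2 - hv \<phi> q * hv \<psi> q) / sg q"

lemma sm_hv: "sm \<phi> \<Longrightarrow> sm (hv \<phi>)"
  unfolding hv_def[abs_def]
  by (intro sm_divide sm_pol sm_H sm_Hs sm_intros sm_sg) (auto simp: sg_pos[THEN less_imp_neq, symmetric])

lemma sm_qf: "sm \<phi> \<Longrightarrow> sm \<psi> \<Longrightarrow> sm (qf \<phi> \<psi>)"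
  unfolding qf_def[abs_def]
  by (intro sm_divide sm_pol sm_H sm_Hs sm_intros sm_hv sm_sg) (auto simp: sg_pos[THEN less_imp_neq, symmetric])

lemma pol_H_hv: "pol H (Hs \<phi>) q = 2 * (sg q * hv \<phi> q)"
  using sg_pos[of q] by (simp add: hv_def)

text \<open>Here \<open>r1\<close> and \<open>r2\<close> play the derivatives of \<sigma>; the last
  two assumptions differentiate twice \<sigma>\<sigma> = det of the metric once and twice. Every
  term containing a Lie derivative is rewritten as \<sigma> times a divergence, up to products that
  cancel against the square of \<open>r1\<close>.\<close>

lemma density_second_variation:
  assumes sm: "sm \<phi>" "sm \<psi>" "sm (\<xi> 1)" "sm (\<xi> 2)" "sm (v 1)" "sm (v 2)"
    and G1: "\<And>i j. G1 i j = (\<lambda>q. Hs \<phi> i j q + Lie \<xi> H i j q)"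
    and G2: "\<And>i j. G2 i j = (\<lambda>q. Hs \<psi> i j q + 2 * Lie \<xi> (Hs \<phi>) i j q + Lie v H i j q + Lie \<xi> (Lie \<xi> H) i j q)"
    and r1: "2 * sg q * r1 = pol H G1 q"
    and r2: "2 * r1\<^sup>2 + 2 * sg q * r2 = pol H G2 q + pol G1 G1 q"
  shows "r2 = hv \<psi> q + qf \<phi> \<phi> q + 2 * flux \<xi> (hv \<phi>) q + flux v sg q + flux \<xi> (flux \<xi> sg) q"
proof -
  note s = sg_pos[of q]
  let ?F = "flux \<xi> sg"
  have smF: "sm ?F" by (intro sm_flux sm sm_sg)
  have smL: "sm (Lie \<xi> H i j)" for i j by (intro sm_Lie sm sm_H)
  have Hsym: "H 2 1 = H 1 2" by (rule Hs_sym[OF sm_comp])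
  have Lsym: "Lie \<xi> H 2 1 = Lie \<xi> H 1 2" by (rule Lie_sym[OF Hsym])
  have HH: "pol H H = (\<lambda>q. 2 * (sg q * sg q))"
    by (rule ext) (simp add: pol_HH power2_eq_square)
  have LamHH: "Lam u (pol H H) q = 4 * (sg q * flux u sg q)" if "sm (u 1)" "sm (u 2)" for u q
    unfolding HH using that by (simp add: Lam_cmult sm_mult sm_sg Lam_mult)
  have LH: "pol H (Lie u H) q = 2 * (sg q * flux u sg q)" if "sm (u 1)" "sm (u 2)" for u q
    using Lam_pol[of H H u q, OF sm_H sm_H Hsym Hsym] LamHH[OF that, of q]
    by (simp add: pol_commute[of _ H])
  \<comment> \<open>The Lie derivative of \<open>pol H (Hs \<phi>)\<close> is computed in two ways:
    through its tensor factors, and as that of a product of the densities \<sigma> and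
    \<open>hv \<phi>\<close>.\<close>
  have cross: "pol H (Lie \<xi> (Hs \<phi>)) q + pol (Hs \<phi>) (Lie \<xi> H) q =
      2 * (sg q * flux \<xi> (hv \<phi>) q + hv \<phi> q * ?F q)"
  proof -
    have "pol H (Hs \<phi>) = (\<lambda>q. 2 * (sg q * hv \<phi> q))" by (rule ext) (rule pol_H_hv)
    then have "Lam \<xi> (pol H (Hs \<phi>)) q = 2 * (sg q * flux \<xi> (hv \<phi>) q + hv \<phi> q * ?F q)"
      using sm by (simp add: Lam_cmult sm_mult sm_sg Lam_mult sm_hv)
    then show ?thesis
      using Lam_pol[of H "Hs \<phi>" \<xi> q, OF sm_H sm_Hs[OF sm(1)] Hsym Hs_sym[OF sm(1)]]
      by (simp add: pol_commute[of _ "Hs \<phi>"])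
  qed
  \<comment> \<open>The same comparison for \<open>pol H (Lie \<xi> H)\<close>, which is twice
    \<sigma> times its own divergence.\<close>
  have LL: "pol H (Lie \<xi> (Lie \<xi> H)) q + pol (Lie \<xi> H) (Lie \<xi> H) q =
      2 * (sg q * flux \<xi> ?F q + ?F q * ?F q)"
  proof -
    have "pol H (Lie \<xi> H) = (\<lambda>q. 2 * (sg q * ?F q))" by (rule ext) (rule LH[OF sm(3,4)])
    then have "Lam \<xi> (pol H (Lie \<xi> H)) q = 2 * (sg q * flux \<xi> ?F q + ?F q * ?F q)"
      using sm by (simp add: Lam_cmult sm_mult sm_sg Lam_mult smF)
    then show ?thesis
      using Lam_pol[of H "Lie \<xi> H" \<xi> q, OF sm_H smL Hsym Lsym] by simp
  qed
  have "2 * sg q * r1 = 2 * sg q * (hv \<phi> q + ?F q)"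
    using r1 pol_add_right[of H "Hs \<phi>" "Lie \<xi> H" q] pol_H_hv[of \<phi> q] LH[OF sm(3,4), of q]
    by (simp add: G1[abs_def] pol_def algebra_simps)
  then have r1': "r1 = hv \<phi> q + ?F q" using s by simp
  have "pol H G2 q + pol G1 G1 q =
     pol H (Hs \<psi>) q + 2 * (pol H (Lie \<xi> (Hs \<phi>)) q + pol (Hs \<phi>) (Lie \<xi> H) q) + pol H (Lie v H) q
      + (pol H (Lie \<xi> (Lie \<xi> H)) q + pol (Lie \<xi> H) (Lie \<xi> H) q) + pol (Hs \<phi>) (Hs \<phi>) q"
    by (simp add: pol_def G1 G2 algebra_simps)
  also have "\<dots> = 2 * (sg q * hv \<psi> q) + 4 * (sg q * flux \<xi> (hv \<phi>) q + hv \<phi> q * ?F q)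
      + 2 * (sg q * flux v sg q) + 2 * (sg q * flux \<xi> ?F q + ?F q * ?F q) + pol (Hs \<phi>) (Hs \<phi>) q"
    unfolding cross LL pol_H_hv LH[OF sm(5,6)] by simp
  finally have "2 * sg q * r2 = 2 * (sg q * hv \<psi> q) + 4 * (sg q * flux \<xi> (hv \<phi>) q + hv \<phi> q * ?F q)
      + 2 * (sg q * flux v sg q) + 2 * (sg q * flux \<xi> ?F q + ?F q * ?F q) + pol (Hs \<phi>) (Hs \<phi>) q
      - 2 * (hv \<phi> q + ?F q)\<^sup>2"
    using r2 r1' by simp
  also have "\<dots> = 2 * sg q * (hv \<psi> q + 2 * flux \<xi> (hv \<phi>) q + flux v sg q + flux \<xi> ?F q)
      + (pol (Hs \<phi>) (Hs \<phi>) q - 2 * (hv \<phi> q * hv \<phi> q))"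
    by (simp add: power2_eq_square algebra_simps)
  also have "pol (Hs \<phi>) (Hs \<phi>) q - 2 * (hv \<phi> q * hv \<phi> q) = 2 * sg q * qf \<phi> \<phi> q"
    using s by (simp add: qf_def)
  finally have "2 * sg q * r2 = 2 * sg q * (hv \<psi> q + qf \<phi> \<phi> q + 2 * flux \<xi> (hv \<phi>) q + flux v sg q + flux \<xi> ?F q)"
    by (simp add: algebra_simps)
  then show ?thesis using s by simp
qed

section \<open>The extremal equation and the vanishing first variation\<close>

lemma partial_deriv_sheet:
  assumes W: "sheet W" and eq: "\<And>z. z \<in> P ` W \<Longrightarrow> f z = g (inv_into W P z)" and z: "z \<in> P ` W"
  shows "partial_deriv i f z = D i g (inv_into W P z)"
proof -
  have "frechet_derivative f (at z) = frechet_derivative (\<lambda>z. g (inv_into W P z)) (at z)"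
    by (rule frechet_derivative_cong_open[OF open_image_sheet[OF W] z eq])
  then show ?thesis
    using base_deriv_sheet[OF W inv_in[OF z], of "axis i 1" g] P_inv[OF z]
    by (simp add: partial_deriv_def)
qed

text \<open>The cofactor matrix of a Hessian is divergence free, so \<open>D\<^sub>i(C\<^sup>i\<^sup>j / \<sigma>) = - W\<^sup>j\<close> with
  \<open>W\<^sup>i = C\<^sup>i\<^sup>j \<sigma>\<^sub>j / \<sigma>\<^sup>2\<close>, and the extremal equation says \<open>D\<^sub>i W\<^sup>i = 0\<close>.\<close>

definition Wx :: "2 \<Rightarrow> 'm \<Rightarrow> real" where
  "Wx = fld (\<lambda>q. (H 2 2 q * D 1 sg q - H 1 2 q * D 2 sg q) / (sg q * sg q))
    (\<lambda>q. (H 1 1 q * D 2 sg q - H 1 2 q * D 1 sg q) / (sg q * sg q))"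

lemma sm_Wx: "sm (Wx 1)" "sm (Wx 2)"
  unfolding Wx_def fld_simps
  by (intro sm_divide sm_intros sm_H sm_sg; use sg_pos in \<open>auto simp: less_imp_neq[symmetric]\<close>)+

text \<open>The inverse of a sheet exhibits a local graph. There sqrt(det) times the inverse Hessian
  is the cofactor matrix over \<sigma>, and the gradient of ln det is twice that of \<sigma> over
  \<sigma>, so the Laplacian is the divergence of twice \<open>Wx\<close>, up to a positive
  factor.\<close>

lemma extremal_divergence:
  assumes "calabi_extremal x"
  shows "D 1 (Wx 1) q + D 2 (Wx 2) q = 0"
proof -
  obtain W where W: "sheet W" "q \<in> W" using ex_sheet by blast
  define f where "f z = h (inv_into W P z)" for z
  let ?y = "P q"
  have y: "?y \<in> P ` W" using W by simp
  have lg: "local_graph x W (P ` W) f"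
    using W inv_P[OF W(1)] unfolding local_graph_def sheet_def f_def
    by (auto simp: bij_betw_def o_def open_map)
  have he: "hessian f z $ i $ j = H i j (inv_into W P z)" if "z \<in> P ` W" for z i j
    using partial_deriv_sheet[OF W(1), of "partial_deriv j f" "D j h"]
      partial_deriv_sheet[OF W(1), of f h] that
    by (simp add: hessian_def Hs_def f_def)
  have Hsym: "H 2 1 = H 1 2" by (rule Hs_sym[OF sm_comp])
  have det: "det (hessian f z) = (sg (inv_into W P z))\<^sup>2" if "z \<in> P ` W" for z
    using that by (simp add: det_2 he sg_square Hsym) (simp add: power2_eq_square)
  have dln: "D j (\<lambda>q. ln ((sg q)\<^sup>2)) q = 2 * D j sg q / sg q" for j q
  proof -
    obtain V where V: "sheet V" "q \<in> V" using ex_sheet by blast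
    have 1: "((\<lambda>y. sg (inv_into V P y)) has_derivative (\<lambda>v. base_deriv v sg q)) (at (P q))"
      by (rule base_deriv_has_derivative[OF sm_C1[OF sm_sg] V(1) subset_UNIV V(2)])
    have "((\<lambda>s. ln (s\<^sup>2)) has_real_derivative 2 / sg q) (at (sg q))"
      using sg_pos[of q] by (auto intro!: derivative_eq_intros simp: power2_eq_square)
    then have "((\<lambda>s. ln (s\<^sup>2)) has_derivative (\<lambda>t. 2 / sg q * t)) (at (sg (inv_into V P (P q))))"
      by (simp only: has_field_derivative_def inv_P[OF V])
    from has_derivative_compose[OF 1 this] show ?thesis
      using base_deriv_eqI[OF V] by fastforce
  qed
  have pln: "partial_deriv j (\<lambda>z. ln (det (hessian f z))) z = 2 * D j sg (inv_into W P z) / sg (inv_into W P z)"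
    if "z \<in> P ` W" for j z
    using partial_deriv_sheet[OF W(1), of "\<lambda>z. ln (det (hessian f z))" "\<lambda>q. ln ((sg q)\<^sup>2)", OF _ that]
      det dln by simp
  have flux_eq: "sqrt (det (hessian f w)) * (\<Sum>j\<in>UNIV. matrix_inv (hessian f w) $ i $ j *
      partial_deriv j (\<lambda>z. ln (det (hessian f z))) w) = 2 * Wx i (inv_into W P w)"
    if w: "w \<in> P ` W" for i w
  proof -
    let ?p = "inv_into W P w"
    have s: "sg ?p > 0" by (rule sg_pos)
    have d: "det (hessian f w) \<noteq> 0" using det[OF w] s by simp
    have sq: "sqrt (det (hessian f w)) = sg ?p" using det[OF w] s by simp
    have "i = 1 \<or> i = 2" using exhaust_2 by blast
    then show ?thesis
      unfolding sq sum_2 pln[OF w]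
      using s
      by (auto simp: matrix_inv_2[OF d] det[OF w] he[OF w] Hsym Wx_def power2_eq_square field_simps)
  qed
  have "laplace_beltrami (hessian f) (\<lambda>z. ln (det (hessian f z))) ?y = 0"
    using assms lg y unfolding calabi_extremal_def by blast
  then have "(\<Sum>i\<in>UNIV. partial_deriv i (\<lambda>w. sqrt (det (hessian f w)) *
      (\<Sum>j\<in>UNIV. matrix_inv (hessian f w) $ i $ j * partial_deriv j (\<lambda>z. ln (det (hessian f z))) w)) ?y) = 0"
    unfolding laplace_beltrami_def using det[OF y] sg_pos[of q] inv_P[OF W] by simp
  moreover have "partial_deriv i (\<lambda>w. sqrt (det (hessian f w)) *
      (\<Sum>j\<in>UNIV. matrix_inv (hessian f w) $ i $ j * partial_deriv j (\<lambda>z. ln (det (hessian f z))) w)) ?y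
      = D i (\<lambda>q. 2 * Wx i q) q" for i
    using partial_deriv_sheet[OF W(1), of _ "\<lambda>q. 2 * Wx i q", OF flux_eq y] inv_P[OF W] by simp
  ultimately have "D 1 (\<lambda>q. 2 * Wx 1 q) q + D 2 (\<lambda>q. 2 * Wx 2 q) q = 0"
    by (simp add: sum_2)
  then show ?thesis using sm_Wx by (simp add: D_simps sm_intros)
qed

lemma sm_continuous: "sm f \<Longrightarrow> continuous_on UNIV f"
  using base_Ck_imp_continuous_on[OF sm_C1 open_UNIV] .

lemma integral_D:
  assumes "sm f" "compact K" "\<And>q. q \<notin> K \<Longrightarrow> f q = 0"
  shows "integrable base_measure (D i f)" "(\<integral>q. D i f q \<partial>base_measure) = 0"
  using integral_base_deriv[OF sm_C1[OF assms(1)] assms(2,3)]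
    integrable_compact_support[OF sm_continuous[OF sm_D[OF assms(1)]] assms(2)]
    base_deriv_zero_outside[of K f, OF compact_imp_closed[OF assms(2)] assms(3)]
  by auto

lemma integral_flux:
  assumes "sm (\<xi> 1)" "sm (\<xi> 2)" "sm f" "compact K" "\<And>q. q \<notin> K \<Longrightarrow> \<xi> 1 q = 0" "\<And>q. q \<notin> K \<Longrightarrow> \<xi> 2 q = 0"
  shows "integrable base_measure (flux \<xi> f)" "(\<integral>q. flux \<xi> f q \<partial>base_measure) = 0"
proof -
  have 1: "sm (\<lambda>q. f q * \<xi> 1 q)" "sm (\<lambda>q. f q * \<xi> 2 q)" using assms by (auto intro: sm_intros)
  note i = integral_D[OF 1(1) assms(4), of 1] integral_D[OF 1(2) assms(4), of 2]
  show "integrable base_measure (flux \<xi> f)" "(\<integral>q. flux \<xi> f q \<partial>base_measure) = 0"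
    unfolding flux_def[abs_def] using i assms(5,6) by auto
qed

text \<open>An extremal surface is critical: \<open>hv \<psi>\<close> is half the divergence of a
  compactly supported field.\<close>

lemma integral_hv:
  assumes ext: "calabi_extremal x" and \<psi>: "sm \<psi>" "compact K" "\<And>q. q \<notin> K \<Longrightarrow> \<psi> q = 0"
  shows "integrable base_measure (hv \<psi>)" "(\<integral>q. hv \<psi> q \<partial>base_measure) = 0"
proof -
  define \<tau> where "\<tau> q = 1 / sg q" for q
  have sm\<tau>: "sm \<tau>" unfolding \<tau>_def[abs_def]
    by (intro sm_divide sm_intros sm_sg) (use sg_pos in \<open>auto simp: less_imp_neq[symmetric]\<close>)
  have D\<tau>: "D i \<tau> q = - (\<tau> q * \<tau> q * D i sg q)" for i q
  proof -
    have "(\<lambda>q. sg q * \<tau> q) = (\<lambda>q. 1)" using sg_pos by (auto simp: \<tau>_def fun_eq_iff less_imp_neq[symmetric])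
    then have "D i (\<lambda>q. sg q * \<tau> q) q = 0" by (simp add: D_const)
    then have "sg q * D i \<tau> q = - (D i sg q * \<tau> q)" using sm\<tau> sm_sg by (simp add: D_mult)
    moreover have "D i \<tau> q = \<tau> q * (sg q * D i \<tau> q)" using sg_pos[of q] by (simp add: \<tau>_def)
    ultimately have "D i \<tau> q = \<tau> q * - (D i sg q * \<tau> q)" by (simp only:)
    then show ?thesis by simp
  qed
  \<comment> \<open>The field consists of the cofactor matrix over \<sigma> applied to the gradient
    of \<psi>, plus \<psi> times \<open>Wx\<close>. Its divergence contains the gradient of \<psi>
    against \<open>Wx\<close> twice, with opposite signs; div \<open>Wx\<close> = 0 removes the
    remaining term of order zero.\<close>
  define Z1 where "Z1 q = \<tau> q * (H 2 2 q * D 1 \<psi> q - H 1 2 q * D 2 \<psi> q) + Wx 1 q * \<psi> q" for q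
  define Z2 where "Z2 q = \<tau> q * (H 1 1 q * D 2 \<psi> q - H 1 2 q * D 1 \<psi> q) + Wx 2 q * \<psi> q" for q
  have smZ: "sm Z1" "sm Z2" unfolding Z1_def[abs_def] Z2_def[abs_def]
    by (intro sm_intros sm\<tau> sm_H sm_Wx \<psi>(1))+
  have Wx: "Wx 1 q = \<tau> q * \<tau> q * (H 2 2 q * D 1 sg q - H 1 2 q * D 2 sg q)"
    "Wx 2 q = \<tau> q * \<tau> q * (H 1 1 q * D 2 sg q - H 1 2 q * D 1 sg q)" for q
    by (simp_all add: Wx_def \<tau>_def)
  have hv: "hv \<psi> q = (D 1 Z1 q + D 2 Z2 q) / 2" for q
  proof -
    have "D 1 Z1 q + D 2 Z2 q = \<tau> q * pol H (Hs \<psi>) q + (D 1 (Wx 1) q + D 2 (Wx 2) q) * \<psi> q"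
      unfolding Z1_def[abs_def] Z2_def[abs_def]
      using \<psi>(1) sm\<tau> sm_Wx sm_H sm_comp
      by (simp add: D_simps sm_intros D\<tau>[of _ q] Wx[of q] pol_def Hs_def algebra_simps)
    also have "\<dots> = \<tau> q * pol H (Hs \<psi>) q" using extremal_divergence[OF ext, of q] by simp
    finally show ?thesis by (simp add: hv_def \<tau>_def)
  qed
  have clK: "closed K" by (rule compact_imp_closed[OF \<psi>(2)])
  have Z0: "Z1 q = 0" "Z2 q = 0" if "q \<notin> K" for q
    using base_deriv_zero_outside[of K \<psi>, OF clK \<psi>(3) that] \<psi>(3)[OF that] by (simp_all add: Z1_def Z2_def)
  show "integrable base_measure (hv \<psi>)" "(\<integral>q. hv \<psi> q \<partial>base_measure) = 0"
    unfolding hv[abs_def]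
    using integral_D[OF smZ(1) \<psi>(2) Z0(1), of 1] integral_D[OF smZ(2) \<psi>(2) Z0(2), of 2] by auto
qed


section \<open>The quadratic form\<close>


lemma test_functionD:
  assumes "\<phi> \<in> test_functions \<A>"
  shows "sm \<phi>" "\<exists>K. compact K \<and> (\<forall>q. q \<notin> K \<longrightarrow> \<phi> q = 0)"
proof -
  show "sm \<phi>" using assms by (auto simp: test_functions_def sm_def intro: smooth_map_imp_base_Ck)
  have "\<phi> q = 0" if "q \<notin> closure {q. \<phi> q \<noteq> 0}" for q
    using that subsetD[OF closure_subset, of q "{q. \<phi> q \<noteq> 0}"] by auto
  moreover have "compact (closure {q. \<phi> q \<noteq> 0})" using assms by (simp only: test_functions_def mem_Collect_eq)
  ultimately show "\<exists>K. compact K \<and> (\<forall>q. q \<notin> K \<longrightarrow> \<phi> q = 0)" by iprover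
qed

lemma Hs_zero_outside:
  assumes "closed K" "\<And>q. q \<notin> K \<Longrightarrow> \<phi> q = 0" "q \<notin> K"
  shows "Hs \<phi> i j q = 0"
  unfolding Hs_def
  by (rule base_deriv_zero_outside[OF assms(1) base_deriv_zero_outside[of K \<phi>, OF assms(1,2)] assms(3)])

lemma hv_zero_outside:
  assumes "closed K" "\<And>q. q \<notin> K \<Longrightarrow> \<phi> q = 0" "q \<notin> K"
  shows "hv \<phi> q = 0"
  using Hs_zero_outside[of K \<phi>, OF assms] by (simp add: hv_def pol_def)

lemma qf_zero_outside:
  assumes "closed K" "\<And>q. q \<notin> K \<Longrightarrow> \<phi> q = 0" "q \<notin> K"
  shows "qf \<phi> \<psi> q = 0"
  using Hs_zero_outside[of K \<phi>, OF assms] hv_zero_outside[of K \<phi>, OF assms] by (simp add: qf_def pol_def)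

lemma integrable_qf:
  assumes "\<phi> \<in> test_functions \<A>" "\<psi> \<in> test_functions \<A>"
  shows "integrable base_measure (qf \<phi> \<psi>)"
proof -
  obtain K where K: "compact K" "\<And>q. q \<notin> K \<Longrightarrow> \<phi> q = 0" using test_functionD(2)[OF assms(1)] by blast
  show ?thesis
    by (rule integrable_compact_support[OF sm_continuous[OF sm_qf] K(1)])
      (use test_functionD(1) assms qf_zero_outside[of K \<phi>, OF compact_imp_closed[OF K(1)] K(2)] in auto)
qed

lemma qf_commute: "qf \<phi> \<psi> q = qf \<psi> \<phi> q"
  by (simp add: qf_def pol_commute[of "Hs \<phi>"] mult.commute)

lemma qf_linear:
  assumes "sm \<phi>" "sm \<psi>"
  shows "qf (\<lambda>q. a * \<phi> q + b * \<psi> q) \<theta> q = a * qf \<phi> \<theta> q + b * qf \<psi> \<theta> q"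
proof -
  have "Hs (\<lambda>q. a * \<phi> q + b * \<psi> q) i j q = a * Hs \<phi> i j q + b * Hs \<psi> i j q" for i j q
    using assms by (simp add: Hs_def D_add D_mult D_const sm_intros)
  then show ?thesis
    using sg_pos[of q] by (simp add: qf_def hv_def pol_def field_simps)
qed

definition Qf :: "('m \<Rightarrow> real) \<Rightarrow> real" where
  "Qf \<phi> = (\<integral>q. qf \<phi> \<phi> q \<partial>base_measure)"

lemma quadratic_form_Qf: "quadratic_form_on (test_functions \<A>) Qf"
  unfolding quadratic_form_on_def
proof (intro exI conjI ballI allI)
  let ?B = "\<lambda>\<phi> \<psi>. \<integral>q. qf \<phi> \<psi> q \<partial>base_measure"
  fix \<phi> \<psi> assume t: "\<phi> \<in> test_functions \<A>" "\<psi> \<in> test_functions \<A>"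
  show "?B \<phi> \<psi> = ?B \<psi> \<phi>" by (simp add: qf_commute[of \<phi>])
  fix \<theta> a b assume "\<theta> \<in> test_functions \<A>"
  then show "?B (\<lambda>q. a * \<phi> q + b * \<psi> q) \<theta> = a * ?B \<phi> \<theta> + b * ?B \<psi> \<theta>"
    using t by (simp add: qf_linear test_functionD(1) integrable_qf)
qed (simp add: Qf_def)

text \<open>With c = \<open>pol H (Hs \<phi>)\<close> and d = \<sigma>\<sigma>, the square of
  \<open>hv \<phi>\<close> is cc/(4d), so \<open>qf\<close> is the difference estimated in
  \<open>polar_det_ineq\<close>, divided by \<sigma>.\<close>

lemma qf_nonpos: "qf \<phi> \<phi> q \<le> 0"
  and qf_eq_0: "qf \<phi> \<phi> q = 0 \<Longrightarrow>
    Hs \<phi> 1 1 q = pol H (Hs \<phi>) q / (2 * (sg q)\<^sup>2) * H 1 1 q \<and>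
    Hs \<phi> 1 2 q = pol H (Hs \<phi>) q / (2 * (sg q)\<^sup>2) * H 1 2 q \<and>
    Hs \<phi> 2 2 q = pol H (Hs \<phi>) q / (2 * (sg q)\<^sup>2) * H 2 2 q" (is "_ \<Longrightarrow> ?C")
proof -
  note s = sg_pos[of q]
  have c: "pol H (Hs \<phi>) q = H 1 1 q * Hs \<phi> 2 2 q + H 2 2 q * Hs \<phi> 1 1 q - 2 * H 1 2 q * Hs \<phi> 1 2 q"
    by (simp add: pol_def)
  note ineq = polar_det_ineq[OF H_pos(1) sg_square _ c]
  have d: "(sg q)\<^sup>2 > 0" using s by simp
  have eq: "qf \<phi> \<phi> q = (Hs \<phi> 1 1 q * Hs \<phi> 2 2 q - (Hs \<phi> 1 2 q)\<^sup>2 - (pol H (Hs \<phi>) q)\<^sup>2 / (4 * (sg q)\<^sup>2)) / sg q"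
  proof -
    have "hv \<phi> q * hv \<phi> q = (pol H (Hs \<phi>) q)\<^sup>2 / (4 * (sg q)\<^sup>2)"
      by (simp add: hv_def power2_eq_square)
    moreover have "pol (Hs \<phi>) (Hs \<phi>) q / 2 = Hs \<phi> 1 1 q * Hs \<phi> 2 2 q - (Hs \<phi> 1 2 q)\<^sup>2"
      by (simp add: pol_def power2_eq_square)
    ultimately show ?thesis by (simp add: qf_def)
  qed
  show "qf \<phi> \<phi> q \<le> 0" using ineq(1)[OF d] s by (simp add: eq divide_nonpos_pos)
  show ?C if "qf \<phi> \<phi> q = 0"
    using ineq(2)[OF d] that s by (simp add: eq)
qed

section \<open>The equality case\<close>

lemma sm_const_of_D:
  assumes "connected (UNIV :: 'm set)" "sm f" "\<And>q. D 1 f q = 0" "\<And>q. D 2 f q = 0"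
  shows "f p = f q"
proof (rule base_deriv_zero_imp_const[OF assms(1) sm_C1[OF assms(2)]])
  show "base_deriv v f q = 0" for v q
    using base_deriv_eq_D[OF sm_C1[OF assms(2)], where v=v and q=q] assms(3,4)[of q] by simp
qed

text \<open>If \<open>D\<^sup>2\<phi> = \<mu> D\<^sup>2h\<close>, then symmetry of the third derivatives puts \<open>(\<mu>\<^sub>2, -\<mu>\<^sub>1)\<close> into the kernel of
  \<open>D\<^sup>2h\<close>, so that \<open>\<mu>\<close> is constant.\<close>

lemma qf_zero_rigid:
  assumes conn: "connected (UNIV :: 'm set)" and \<phi>: "\<phi> \<in> test_functions \<A>"
    and qf0: "\<And>q. qf \<phi> \<phi> q = 0"
  shows "\<phi> q = 0"
proof -
  have sm\<phi>: "sm \<phi>" by (rule test_functionD(1)[OF \<phi>])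
  obtain K where K: "compact K" "\<And>q. q \<notin> K \<Longrightarrow> \<phi> q = 0" using test_functionD(2)[OF \<phi>] by blast
  have clK: "closed K" by (rule compact_imp_closed[OF K(1)])
  \<comment> \<open>A point off the support fixes the constants three times: for \<mu>, for the
    first derivatives of \<phi>, and for \<phi> itself.\<close>
  obtain q0 where q0: "q0 \<notin> K" using K(1) noncompact by (metis UNIV_eq_I)
  define \<mu> where "\<mu> q = pol H (Hs \<phi>) q / (2 * (sg q)\<^sup>2)" for q
  have sm\<mu>: "sm \<mu>" unfolding \<mu>_def[abs_def]
    by (intro sm_divide sm_pol sm_H sm_Hs sm\<phi> sm_intros sm_sg) (use sg_pos in \<open>auto simp: less_imp_neq[symmetric]\<close>)
  have e: "Hs \<phi> 1 1 = (\<lambda>q. \<mu> q * H 1 1 q)" "Hs \<phi> 1 2 = (\<lambda>q. \<mu> q * H 1 2 q)" "Hs \<phi> 2 2 = (\<lambda>q. \<mu> q * H 2 2 q)"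
    using qf_eq_0[OF qf0] by (auto simp: \<mu>_def)
  have third: "D 2 (Hs f 1 1) = D 1 (Hs f 1 2)" "D 2 (Hs f 1 2) = D 1 (Hs f 2 2)" if "sm f" for f
    using that by (simp_all add: Hs_def D_21 sm_D)
  have D\<mu>: "D 1 \<mu> q = 0 \<and> D 2 \<mu> q = 0" for q
  proof -
    have e1: "D 2 \<mu> q * H 1 1 q = D 1 \<mu> q * H 1 2 q"
      using fun_cong[OF third(1)[OF sm\<phi>], of q] fun_cong[OF third(1)[OF sm_comp[of 3]], of q]
      unfolding e by (simp add: D_mult sm\<mu> sm_H)
    have e2: "D 2 \<mu> q * H 1 2 q = D 1 \<mu> q * H 2 2 q"
      using fun_cong[OF third(2)[OF sm\<phi>], of q] fun_cong[OF third(2)[OF sm_comp[of 3]], of q]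
      unfolding e by (simp add: D_mult sm\<mu> sm_H)
    have "D 1 \<mu> q * (H 1 1 q * H 2 2 q - (H 1 2 q)\<^sup>2) = H 1 1 q * (D 1 \<mu> q * H 2 2 q) - H 1 2 q * (D 1 \<mu> q * H 1 2 q)"
      by (simp add: power2_eq_square algebra_simps)
    also have "\<dots> = 0" unfolding e1[symmetric] e2[symmetric] by simp
    finally have "D 1 \<mu> q = 0" using H_pos(2)[of q] by simp
    then show ?thesis using e1 H_pos(1)[of q] by simp
  qed
  have "\<mu> q0 = 0"
    using Hs_zero_outside[of K \<phi>, OF clK K(2) q0] by (simp add: \<mu>_def pol_def)
  then have \<mu>0: "\<mu> q = 0" for q using sm_const_of_D[OF conn sm\<mu>, of q q0] D\<mu> by simp
  have H0: "D i (D j \<phi>) q = 0" for i j q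
  proof -
    have "Hs \<phi> 2 1 q = Hs \<phi> 1 2 q" using Hs_sym[OF sm\<phi>] by simp
    moreover have "i = 1 \<or> i = 2" "j = 1 \<or> j = 2" using exhaust_2 by blast+
    ultimately have "Hs \<phi> i j q = 0" using e \<mu>0 by auto
    then show ?thesis by (simp add: Hs_def)
  qed
  have D0: "D j \<phi> q = 0" for j q
    using sm_const_of_D[OF conn sm_D[OF sm\<phi>], of j q q0] H0
      base_deriv_zero_outside[of K \<phi>, OF clK K(2) q0] by simp
  show ?thesis using sm_const_of_D[OF conn sm\<phi> D0 D0, of q q0] K(2)[OF q0] by simp
qed

text \<open>If the integral of the nonnegative function -\<open>qf\<close> vanishes, the open set
  where \<open>qf\<close> is nonzero has measure zero and is therefore empty; rigidity then
  applies.\<close>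

lemma Qf_negative:
  assumes conn: "connected (UNIV :: 'm set)" and \<phi>: "\<phi> \<in> test_functions \<A>"
  shows "Qf \<phi> \<le> 0" and "Qf \<phi> = 0 \<Longrightarrow> \<phi> q = 0"
proof -
  have i: "integrable base_measure (\<lambda>q. - qf \<phi> \<phi> q)" using integrable_qf[OF \<phi> \<phi>] by simp
  have nn: "(\<integral>q. - qf \<phi> \<phi> q \<partial>base_measure) = - Qf \<phi>" by (simp add: Qf_def)
  have "0 \<le> (\<integral>q. - qf \<phi> \<phi> q \<partial>base_measure)" by (rule integral_nonneg_AE) (simp add: qf_nonpos)
  then show "Qf \<phi> \<le> 0" using nn by simp
  assume "Qf \<phi> = 0"
  then have "AE q in base_measure. - qf \<phi> \<phi> q = 0"
    using integral_nonneg_eq_0_iff_AE[OF i] nn qf_nonpos by simp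
  moreover have c: "continuous_on UNIV (qf \<phi> \<phi>)"
    using test_functionD(1)[OF \<phi>] by (intro sm_continuous sm_qf)
  have o: "open {q. qf \<phi> \<phi> q \<noteq> 0}" using c by (intro open_Collect_neq continuous_on_const)
  ultimately have "emeasure base_measure {q. qf \<phi> \<phi> q \<noteq> 0} = 0"
    by (subst (asm) AE_iff_measurable[of "{q. qf \<phi> \<phi> q \<noteq> 0}"]) auto
  then have "{q. qf \<phi> \<phi> q \<noteq> 0} = {}" using emeasure_open_pos[OF o] by fastforce
  then show "\<phi> q = 0" by (intro qf_zero_rigid[OF conn \<phi>]) blast
qed

end


section \<open>The second variation\<close>

lemma has_vector_derivative_vecI:
  fixes f :: "real \<Rightarrow> real^'n"
  assumes "\<And>k. ((\<lambda>t. f t $ k) has_real_derivative d $ k) (at a)"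
  shows "(f has_vector_derivative d) (at a)"
  unfolding has_vector_derivative_def
proof (subst has_derivative_componentwise_within, rule ballI)
  fix b :: "real^'n" assume "b \<in> Basis"
  then obtain k where b: "b = axis k 1" by (auto simp: Basis_vec_def)
  show "((\<lambda>t. f t \<bullet> b) has_derivative (\<lambda>t. t *\<^sub>R d \<bullet> b)) (at a)"
  proof -
    have "(\<lambda>t. t *\<^sub>R d \<bullet> b) = (*) (d $ k)" by (auto simp: b inner_axis fun_eq_iff)
    then show ?thesis using assms[of k] by (simp add: b inner_axis has_field_derivative_def)
  qed
qed

context calabi_base
begin

lemma integrable_on_compact:
  assumes f: "continuous_on UNIV f" and K: "compact K"
  shows "integrable base_measure (\<lambda>q. indicator K q * f q :: real)"
proof -
  have "compact (f ` K)" using assms by (intro compact_continuous_image continuous_on_subset[OF f]) auto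
  then obtain b where b: "\<And>q. q \<in> K \<Longrightarrow> \<bar>f q\<bar> \<le> b"
    using compact_imp_bounded bounded_real by (metis imageI)
  have mf: "f \<in> borel_measurable base_measure"
    using borel_measurable_continuous_onI[OF f] by simp
  have mK: "K \<in> sets base_measure" using K by (simp add: borel_compact)
  show ?thesis
  proof (rule integrableI_bounded_set[where A=K and B=b])
    show "(\<lambda>q. indicator K q * f q) \<in> borel_measurable base_measure"
      using mf mK by (intro borel_measurable_times borel_measurable_indicator)
    show "AE q in base_measure. q \<in> K \<longrightarrow> norm (indicator K q * f q) \<le> b" using b by simp
  qed (use mK emeasure_compact_finite[OF K] in auto)
qed

interpretation time: etale time_P by (rule etale_time)

section \<open>Smooth families in time\<close>

definition tsm :: "real set \<Rightarrow> (real \<times> 'm \<Rightarrow> real) \<Rightarrow> bool" where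
  "tsm I g \<longleftrightarrow> (\<forall>n. time.base_Ck n (I \<times> UNIV) g)"

abbreviation T :: "(real \<times> 'm \<Rightarrow> real) \<Rightarrow> real \<times> 'm \<Rightarrow> real" where
  "T g \<equiv> time.base_deriv (1, 0) g"

abbreviation S :: "2 \<Rightarrow> (real \<times> 'm \<Rightarrow> real) \<Rightarrow> real \<times> 'm \<Rightarrow> real" where
  "S i g \<equiv> time.base_deriv (0, axis i 1) g"

context
  fixes I :: "real set"
  assumes I: "open I"
begin

lemma tsm_T: "tsm I g \<Longrightarrow> tsm I (T g)"
  and tsm_S: "tsm I g \<Longrightarrow> tsm I (S i g)"
  by (auto simp: tsm_def intro: time.base_Ck_deriv)

lemma tsm_slice: "tsm I g \<Longrightarrow> t \<in> I \<Longrightarrow> sm (\<lambda>q. g (t, q))"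
  unfolding tsm_def sm_def using time_slice[OF _ I] by blast

lemma D_slice: "tsm I g \<Longrightarrow> t \<in> I \<Longrightarrow> D i (\<lambda>q. g (t, q)) = (\<lambda>q. S i g (t, q))"
  by (rule ext, rule time_slice_deriv[OF _ I _ open_UNIV UNIV_I]) (auto simp: tsm_def)

lemma T_has_derivative: "tsm I g \<Longrightarrow> t \<in> I \<Longrightarrow> ((\<lambda>s. g (s, q)) has_real_derivative T g (t, q)) (at t)"
  by (rule time_has_real_derivative[OF _ I _ open_UNIV UNIV_I]) (auto simp: tsm_def)

lemma open_IU: "open (I \<times> (UNIV :: 'm set))"
  using I by (simp add: open_Times)

lemma T_S: "tsm I g \<Longrightarrow> t \<in> I \<Longrightarrow> T (S i g) (t, q) = S i (T g) (t, q)"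
  by (rule time.base_deriv_commute[OF _ open_IU]) (auto simp: tsm_def)

lemma T_cong:
  assumes "\<And>t q. t \<in> I \<Longrightarrow> f (t, q) = g (t, q)" "t \<in> I"
  shows "T f (t, q) = T g (t, q)"
  by (rule time.base_deriv_cong[OF open_IU]) (use assms in auto)

lemma tsm_continuous: "tsm I g \<Longrightarrow> continuous_on (I \<times> UNIV) g"
  by (rule time.base_Ck_imp_continuous_on[OF _ open_IU, of 0]) (simp add: tsm_def)

lemma tsm_add: "tsm I f \<Longrightarrow> tsm I g \<Longrightarrow> tsm I (\<lambda>z. f z + g z)"
  and tsm_mult: "tsm I f \<Longrightarrow> tsm I g \<Longrightarrow> tsm I (\<lambda>z. f z * g z)"
  by (auto simp: tsm_def intro: time.base_Ck_add time.base_Ck_mult)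

text \<open>Leibniz' rule to second order, in the shape in which it is used for the structure equations
  \<open>l = a b + u v + w\<close>.\<close>

lemma T_bilinear:
  assumes tsm: "tsm I a" "tsm I b" "tsm I u" "tsm I v" "tsm I w"
    and l: "\<And>t q. t \<in> I \<Longrightarrow> l (t, q) = a (t, q) * b (t, q) + u (t, q) * v (t, q) + w (t, q)" and t: "t \<in> I"
  shows "T l (t, q) = a (t, q) * T b (t, q) + T a (t, q) * b (t, q) + u (t, q) * T v (t, q) + T u (t, q) * v (t, q) + T w (t, q)"
      (is ?first)
    and "T (T l) (t, q) = a (t, q) * T (T b) (t, q) + 2 * (T a (t, q) * T b (t, q)) + T (T a) (t, q) * b (t, q)
      + u (t, q) * T (T v) (t, q) + 2 * (T u (t, q) * T v (t, q)) + T (T u) (t, q) * v (t, q) + T (T w) (t, q)"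
      (is ?second)
proof -
  have Tm: "T (\<lambda>z. f z * g z) z = f z * T g z + T f z * g z" if "tsm I f" "tsm I g" "z \<in> I \<times> UNIV" for f g z
    by (rule time.base_deriv_mult[OF _ _ open_IU that(3)]) (use that in \<open>auto simp: tsm_def\<close>)
  have Ta: "T (\<lambda>z. f z + g z) z = T f z + T g z" if "tsm I f" "tsm I g" "z \<in> I \<times> UNIV" for f g z
    by (rule time.base_deriv_add[OF _ _ open_IU that(3)]) (use that in \<open>auto simp: tsm_def\<close>)
  note rules = Ta Tm tsm_add tsm_mult tsm_T tsm
  \<comment> \<open>Proved at every time in \<open>I\<close>, since this identity is differentiated
    once more.\<close>
  have 1: "T l (s, p) = a (s, p) * T b (s, p) + T a (s, p) * b (s, p) + u (s, p) * T v (s, p) + T u (s, p) * v (s, p) + T w (s, p)"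
    if "s \<in> I" for s p
  proof -
    have "T l (s, p) = T (\<lambda>z. a z * b z + u z * v z + w z) (s, p)" using l that by (rule T_cong)
    then show ?thesis using that by (simp add: rules)
  qed
  show ?first using 1[OF t] .
  have "T (T l) (t, q) = T (\<lambda>z. a z * T b z + T a z * b z + u z * T v z + T u z * v z + T w z) (t, q)"
    using 1 t by (rule T_cong)
  then show ?second using t by (simp add: rules)
qed

end

section \<open>A fixed admissible variation\<close>

context
  fixes \<epsilon> K F \<phi>
  assumes adm: "admissible_variation \<A> x \<epsilon> K F" and np: "normal_part \<A> x F \<phi>"
    and extremal: "calabi_extremal x" and \<phi>: "\<phi> \<in> test_functions \<A>"
begin

definition J :: "real set" where "J = {-\<epsilon><..<\<epsilon>}"

lemma J: "open J" "0 \<in> J" "compact K" "closed K" and F0: "F 0 = x"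
  and surfF: "t \<in> J \<Longrightarrow> calabi_surface \<A> (F t)" and FK: "t \<in> J \<Longrightarrow> q \<notin> K \<Longrightarrow> F t q = x q"
  using adm compact_imp_closed by (auto simp: J_def admissible_variation_def)

definition cc :: "3 \<Rightarrow> real \<times> 'm \<Rightarrow> real" where "cc k z = F (fst z) (snd z) $ k"

lemma tsm_cc: "tsm J (cc k)"
  using adm smooth_family_imp_base_Ck[OF J(1)]
  by (simp add: tsm_def cc_def[abs_def] J_def admissible_variation_def)

lemma D_F: "t \<in> J \<Longrightarrow> D i (\<lambda>q. F t q $ k) q = S i (cc k) (t, q)"
  using D_slice[OF J(1) tsm_cc, of t i k] by (simp add: cc_def fun_eq_iff)

lemma D_D_F: "t \<in> J \<Longrightarrow> D i (D j (\<lambda>q. F t q $ k)) q = S i (S j (cc k)) (t, q)"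
proof -
  assume t: "t \<in> J"
  have "D j (\<lambda>q. F t q $ k) = (\<lambda>q. S j (cc k) (t, q))" using D_F[OF t] by (rule ext)
  then show ?thesis using D_slice[OF J(1) tsm_S[OF J(1) tsm_cc] t] by simp
qed

lemma tsm_cong:
  assumes "tsm J f" "\<And>t q. t \<in> J \<Longrightarrow> g (t, q) = f (t, q)"
  shows "tsm J g"
  using assms(1) time.base_Ck_cong[of "J \<times> UNIV" g f] assms(2) by (auto simp: tsm_def)

text \<open>Every \<open>F t\<close> is a Calabi surface, so the Jacobian in the denominators never
  vanishes and the determinant under the root stays positive.\<close>

lemma tsm_geometry:
  "tsm J (\<lambda>z. jac (F (fst z)) (snd z))"
  "tsm J (\<lambda>z. chr1 (F (fst z)) i j (snd z))"
  "tsm J (\<lambda>z. chr2 (F (fst z)) i j (snd z))"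
  "tsm J (\<lambda>z. gmet (F (fst z)) i j (snd z))"
  "tsm J (\<lambda>z. rho (F (fst z)) (snd z))"
proof -
  note c = tsm_cc tsm_S[OF J(1)]
  have sub: "tsm J f \<Longrightarrow> tsm J g \<Longrightarrow> tsm J (\<lambda>z. f z - g z)" for f g
    by (auto simp: tsm_def intro: time.base_Ck_diff)
  have div: "tsm J f \<Longrightarrow> tsm J g \<Longrightarrow> (\<And>z. z \<in> J \<times> UNIV \<Longrightarrow> g z \<noteq> 0) \<Longrightarrow> tsm J (\<lambda>z. f z / g z)" for f g
    by (auto simp: tsm_def intro: time.base_Ck_divide)
  have sqr: "tsm J f \<Longrightarrow> (\<And>z. z \<in> J \<times> UNIV \<Longrightarrow> f z > 0) \<Longrightarrow> tsm J (\<lambda>z. sqrt (f z))" for f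
    by (auto simp: tsm_def intro: time.base_Ck_sqrt)
  show jac: "tsm J (\<lambda>z. jac (F (fst z)) (snd z))"
    by (rule tsm_cong[of "\<lambda>z. S 1 (cc 1) z * S 2 (cc 2) z - S 2 (cc 1) z * S 1 (cc 2) z"])
      (auto simp: jac_def D_F intro!: sub tsm_mult[OF J(1)] c)
  have jnz: "jac (F (fst z)) (snd z) \<noteq> 0" if "z \<in> J \<times> UNIV" for z
    using surface_nondegenerate[OF surfF] that by auto
  show c1: "tsm J (\<lambda>z. chr1 (F (fst z)) i j (snd z))" for i j
    by (rule tsm_cong[of "\<lambda>z. (S i (S j (cc 1)) z * S 2 (cc 2) z - S i (S j (cc 2)) z * S 2 (cc 1) z) / jac (F (fst z)) (snd z)"],
      intro div sub tsm_mult[OF J(1)] c jac jnz) (simp_all add: chr1_def D_F D_D_F)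
  show c2: "tsm J (\<lambda>z. chr2 (F (fst z)) i j (snd z))" for i j
    by (rule tsm_cong[of "\<lambda>z. (S i (S j (cc 2)) z * S 1 (cc 1) z - S i (S j (cc 1)) z * S 1 (cc 2) z) / jac (F (fst z)) (snd z)"],
      intro div sub tsm_mult[OF J(1)] c jac jnz) (simp_all add: chr2_def D_F D_D_F)
  show g: "tsm J (\<lambda>z. gmet (F (fst z)) i j (snd z))" for i j
    by (rule tsm_cong[of "\<lambda>z. S i (S j (cc 3)) z - chr1 (F (fst z)) i j (snd z) * S 1 (cc 3) z
        - chr2 (F (fst z)) i j (snd z) * S 2 (cc 3) z"],
      intro sub tsm_mult[OF J(1)] c c1 c2) (simp_all add: gmet_def D_F D_D_F)
  have gd: "tsm J (\<lambda>z. gdet (F (fst z)) (snd z))"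
    unfolding gdet_def power2_eq_square by (intro sub tsm_mult[OF J(1)] g)
  show "tsm J (\<lambda>z. rho (F (fst z)) (snd z))"
    unfolding rho_def by (intro sqr gd) (use gmet_pos(2)[OF surfF] in auto)
qed

text \<open>Initial velocity of the components of \<open>F\<close>: the indices 1 and 2 give the
  base field \<xi>, the index 3 the velocity of the height. \<open>eta\<close> is the corresponding
  acceleration.\<close>

definition xi :: "3 \<Rightarrow> 'm \<Rightarrow> real" where "xi k q = T (cc k) (0, q)"
definition eta :: "3 \<Rightarrow> 'm \<Rightarrow> real" where "eta k q = T (T (cc k)) (0, q)"

lemma sm_xi: "sm (xi k)"
  using tsm_slice[OF J(1) tsm_T[OF J(1) tsm_cc] J(2)] by (simp add: xi_def[abs_def])

lemma sm_eta: "sm (eta k)"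
  using tsm_slice[OF J(1) tsm_T[OF J(1) tsm_T[OF J(1) tsm_cc]] J(2)] by (simp add: eta_def[abs_def])

lemma T_eq_0: "tsm J g \<Longrightarrow> (\<And>t. t \<in> J \<Longrightarrow> g (t, q) = c) \<Longrightarrow> t \<in> J \<Longrightarrow> T g (t, q) = 0"
proof -
  assume g: "tsm J g" "\<And>t. t \<in> J \<Longrightarrow> g (t, q) = c" "t \<in> J"
  have "((\<lambda>s. g (s, q)) has_real_derivative 0) (at t)"
    by (rule has_field_derivative_transform_within_open[OF DERIV_const[of c] J(1) g(3)]) (simp add: g(2))
  then show ?thesis using T_has_derivative[OF J(1) g(1,3), of q] DERIV_unique by blast
qed

lemma xi_eta_outside: "q \<notin> K \<Longrightarrow> xi k q = 0" "q \<notin> K \<Longrightarrow> eta k q = 0"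
proof -
  assume q: "q \<notin> K"
  have 0: "T (cc k) (t, q) = 0" if "t \<in> J" for t
    by (rule T_eq_0[OF tsm_cc _ that, where c="x q $ k"]) (simp add: cc_def FK q)
  then show "xi k q = 0" using J(2) by (simp add: xi_def)
  show "eta k q = 0"
    unfolding eta_def by (rule T_eq_0[OF tsm_T[OF J(1) tsm_cc] _ J(2), where c=0]) (rule 0)
qed

text \<open>Subtracting \<phi> times the normal makes the velocity tangent to the graph of
  \<open>h\<close>, and the height of a tangent vector is the derivative of \<open>h\<close> along
  its base part.\<close>

lemma phi_eq: "\<phi> q = xi 3 q - xi 1 q * D 1 h q - xi 2 q * D 2 h q"
proof -
  obtain \<kappa> where k: "\<kappa> \<in> \<A>" "q \<in> dom_of \<kappa>" using smooth_atlas_cover[OF atlas] .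
  define u where "u = coord \<kappa> q"
  have u: "u \<in> cod_of \<kappa>" "param \<kappa> u = q" using k param_coord'[OF k] by (auto simp: u_def)
  have "((\<lambda>t. F t q) has_vector_derivative (\<chi> k. xi k q)) (at 0)"
    by (rule has_vector_derivative_vecI)
      (use T_has_derivative[OF J(1) tsm_cc J(2)] in \<open>simp add: xi_def cc_def\<close>)
  then have vd: "vector_derivative (\<lambda>t. F t q) (at 0) = (\<chi> k. xi k q)" by (rule vector_derivative_at)
  have "(\<chi> k. xi k q) - \<phi> q *\<^sub>R calabi_normal \<in> range (frechet_derivative (x \<circ> param \<kappa>) (at u))"
    using np k unfolding normal_part_def u_def vd[symmetric] by blast
  then obtain z where z: "(\<chi> k. xi k q) - \<phi> q *\<^sub>R calabi_normal = frechet_derivative (x \<circ> param \<kappa>) (at u) z"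
    by blast
  note c = chart_first_derivative[OF surface k(1) u(1), of z, folded z, unfolded u(2)]
  show ?thesis
    using c[of 1] c[of 2] c[of 3] by (simp add: calabi_normal_def D_P)
qed

text \<open>The second time derivative of the graph functions, obtained by solving the expansion of
  h_t = f_t \<circ> P_t at second order. Defined by this formula, it needs no construction of the
  functions f_t.\<close>

definition psi :: "'m \<Rightarrow> real" where
  "psi q = eta 3 q - 2 * (xi 1 q * D 1 \<phi> q + xi 2 q * D 2 \<phi> q) - eta 1 q * D 1 h q - eta 2 q * D 2 h q
    - xi 1 q * xi 1 q * D 1 (D 1 h) q - 2 * (xi 1 q * xi 2 q * D 1 (D 2 h) q) - xi 2 q * xi 2 q * D 2 (D 2 h) q"

abbreviation "XX \<equiv> fld (xi 1) (xi 2)"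
abbreviation "VV \<equiv> accel (xi 1) (xi 2) (eta 1) (eta 2)"

lemma sm_phi: "sm \<phi>" by (rule test_functionD(1)[OF \<phi>])

lemma sm_psi: "sm psi"
  unfolding psi_def[abs_def] by (intro sm_intros sm_xi sm_eta sm_phi sm_comp)

lemma sm_VV: "sm (VV 1)" "sm (VV 2)"
  unfolding accel_def fld_simps by (intro sm_intros sm_xi sm_eta)+

text \<open>Time and base derivatives are directional derivatives for the same local homeomorphism
  \<open>time_P\<close>, so they commute; at time zero only base derivatives of velocity and
  acceleration remain.\<close>

lemma T_D_D: "T (S i (S j (cc k))) (0, q) = D i (D j (xi k)) q"
  and T_T_D_D: "T (T (S i (S j (cc k)))) (0, q) = D i (D j (eta k)) q"
  and T_D: "T (S j (cc k)) (0, q) = D j (xi k) q"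
proof -
  note J1 = J(1)
  have TS: "T (S j g) (t, q) = S j (T g) (t, q)" if "tsm J g" "t \<in> J" for j g t q
    by (rule T_S[OF J1 that])
  have TTS: "T (T (S j g)) (t, q) = S j (T (T g)) (t, q)" if g: "tsm J g" and t: "t \<in> J" for j g t q
  proof -
    have "T (T (S j g)) (t, q) = T (S j (T g)) (t, q)"
      by (rule T_cong[OF J1 _ t]) (rule TS[OF g])
    then show ?thesis using TS[OF tsm_T[OF J1 g] t] by simp
  qed
  have Sc: "S i f (t, q) = S i g (t, q)" if "\<And>t q. t \<in> J \<Longrightarrow> f (t, q) = g (t, q)" "t \<in> J" for i f g t q
    by (rule time.base_deriv_cong[OF open_IU[OF J1]]) (use that in auto)
  have D1: "D j (xi k) = (\<lambda>q. S j (T (cc k)) (0, q))" for j k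
    using D_slice[OF J1 tsm_T[OF J1 tsm_cc] J(2)] by (simp add: xi_def[abs_def])
  have D2: "D j (eta k) = (\<lambda>q. S j (T (T (cc k))) (0, q))" for j k
    using D_slice[OF J1 tsm_T[OF J1 tsm_T[OF J1 tsm_cc]] J(2)] by (simp add: eta_def[abs_def])
  show "T (S j (cc k)) (0, q) = D j (xi k) q" by (simp add: D1 TS[OF tsm_cc J(2)])
  have "T (S i (S j (cc k))) (0, q) = S i (T (S j (cc k))) (0, q)" by (rule TS[OF tsm_S[OF J1 tsm_cc] J(2)])
  also have "\<dots> = S i (S j (T (cc k))) (0, q)" by (rule Sc[OF _ J(2)]) (rule TS[OF tsm_cc])
  also have "\<dots> = D i (D j (xi k)) q"
    unfolding D1 D_slice[OF J1 tsm_S[OF J1 tsm_T[OF J1 tsm_cc]] J(2)] ..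
  finally show "T (S i (S j (cc k))) (0, q) = D i (D j (xi k)) q" .
  have "T (T (S i (S j (cc k)))) (0, q) = S i (T (T (S j (cc k)))) (0, q)" by (rule TTS[OF tsm_S[OF J1 tsm_cc] J(2)])
  also have "\<dots> = S i (S j (T (T (cc k)))) (0, q)" by (rule Sc[OF _ J(2)]) (rule TTS[OF tsm_cc])
  also have "\<dots> = D i (D j (eta k)) q"
    unfolding D2 D_slice[OF J1 tsm_S[OF J1 tsm_T[OF J1 tsm_T[OF J1 tsm_cc]]] J(2)] ..
  finally show "T (T (S i (S j (cc k)))) (0, q) = D i (D j (eta k)) q" .
qed

abbreviation gg :: "2 \<Rightarrow> 2 \<Rightarrow> real \<times> 'm \<Rightarrow> real" where "gg i j \<equiv> \<lambda>z. gmet (F (fst z)) i j (snd z)"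
abbreviation rr :: "real \<times> 'm \<Rightarrow> real" where "rr \<equiv> \<lambda>z. rho (F (fst z)) (snd z)"

text \<open>Differentiating \<open>X\<^sub>i\<^sub>j = \<Gamma>\<^sup>k\<^sub>i\<^sub>j X\<^sub>k + G\<^sub>i\<^sub>j Y\<close> twice in time, where \<open>\<Gamma> = 0\<close> at \<open>t = 0\<close>.\<close>

lemma T_gmet:
  "T (gg i j) (0, q) = D i (D j (xi 3)) q - D i (D j (xi 1)) q * D 1 h q - D i (D j (xi 2)) q * D 2 h q"
  "T (T (gg i j)) (0, q) = D i (D j (eta 3)) q
      - (D i (D j (eta 1)) q - 2 * (D i (D j (xi 1)) q * D 1 (xi 1) q + D i (D j (xi 2)) q * D 2 (xi 1) q)) * D 1 h q
      - (D i (D j (eta 2)) q - 2 * (D i (D j (xi 1)) q * D 1 (xi 2) q + D i (D j (xi 2)) q * D 2 (xi 2) q)) * D 2 h q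
      - 2 * (D i (D j (xi 1)) q * D 1 (xi 3) q + D i (D j (xi 2)) q * D 2 (xi 3) q)" (is ?second)
proof -
  let ?a = "\<lambda>z. chr1 (F (fst z)) i j (snd z)" and ?u = "\<lambda>z. chr2 (F (fst z)) i j (snd z)"
  have t0: "tsm J (\<lambda>z. 0)" by (simp add: tsm_def time.base_Ck_const)
  have z: "T (\<lambda>z. 0) = (\<lambda>z. 0)" by (rule ext) (rule time.base_deriv_const)
  have c0: "chr1 (F 0) i j q = 0" "chr2 (F 0) i j q = 0" by (simp_all add: F0 base_geometry)
  have s0: "S i (cc k) (0, q) = D i (\<lambda>q. x q $ k) q" for i k using D_F[OF J(2)] F0 by simp
  have eq: "S i (S j (cc k)) (t, q) = ?a (t, q) * S 1 (cc k) (t, q) + ?u (t, q) * S 2 (cc k) (t, q)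
      + (\<lambda>z. 0) (t, q)" if k: "k = 1 \<or> k = 2" and t: "t \<in> J" for k t q
    using surface_gauss[OF surfF[OF t] k, of i j q] t by (simp add: D_F D_D_F)
  have eq3: "S i (S j (cc 3)) (t, q) = ?a (t, q) * S 1 (cc 3) (t, q) + ?u (t, q) * S 2 (cc 3) (t, q)
      + gg i j (t, q)" if t: "t \<in> J" for t q
    using t by (simp add: gmet_def D_F D_D_F)
  note tt = tsm_geometry(2) tsm_S[OF J(1) tsm_cc] tsm_geometry(3) tsm_S[OF J(1) tsm_cc]
  note e1 = T_bilinear[OF J(1) tt t0 eq[of 1] J(2), of q]
  note e2 = T_bilinear[OF J(1) tt t0 eq[of 2] J(2), of q]
  note e3 = T_bilinear[OF J(1) tt tsm_geometry(4) eq3 J(2), of q]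
  \<comment> \<open>At time zero the two base components have the identity as Jacobian matrix, so
    their structure equations can be solved directly for the derivatives of the connection
    coefficients; the height equation then yields the metric.\<close>
  have a: "T ?a (0, q) = D i (D j (xi 1)) q" "T ?u (0, q) = D i (D j (xi 2)) q"
    using e1(1) e2(1) by (simp_all add: c0 s0 D_P T_D_D z)
  have aa: "T (T ?a) (0, q) = D i (D j (eta 1)) q - 2 * (D i (D j (xi 1)) q * D 1 (xi 1) q + D i (D j (xi 2)) q * D 2 (xi 1) q)"
    "T (T ?u) (0, q) = D i (D j (eta 2)) q - 2 * (D i (D j (xi 1)) q * D 1 (xi 2) q + D i (D j (xi 2)) q * D 2 (xi 2) q)"
    using e1(2) e2(2) by (simp_all add: c0 s0 D_P T_T_D_D T_D a z)
  show "T (gg i j) (0, q) = D i (D j (xi 3)) q - D i (D j (xi 1)) q * D 1 h q - D i (D j (xi 2)) q * D 2 h q"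
    using e3(1) by (simp add: c0 s0 T_D_D a)
  show ?second using e3(2) by (simp add: c0 s0 T_T_D_D T_D a aa)
qed

lemma T_T_rho:
  "T (T rr) (0, q) = hv psi q + qf \<phi> \<phi> q + 2 * flux XX (hv \<phi>) q + flux VV sg q + flux XX (flux XX sg) q"
proof -
  have a: "xi 3 = (\<lambda>q. \<phi> q + xi 1 q * D 1 h q + xi 2 q * D 2 h q)" using phi_eq by (auto simp: fun_eq_iff)
  have b: "eta 3 = (\<lambda>q. psi q + 2 * (xi 1 q * D 1 \<phi> q + xi 2 q * D 2 \<phi> q) + eta 1 q * D 1 h q + eta 2 q * D 2 h q
      + xi 1 q * xi 1 q * D 1 (D 1 h) q + 2 * (xi 1 q * xi 2 q * D 1 (D 2 h) q) + xi 2 q * xi 2 q * D 2 (D 2 h) q)"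
    by (auto simp: fun_eq_iff psi_def)
  define G1 where "G1 i j = (\<lambda>q. Hs \<phi> i j q + Lie XX H i j q)" for i j
  define G2 where "G2 i j = (\<lambda>q. Hs psi i j q + 2 * Lie XX (Hs \<phi>) i j q + Lie VV H i j q + Lie XX (Lie XX H) i j q)" for i j
  note sms = sm_comp[of 3] sm_xi[of 1] sm_xi[of 2]
  have g1: "T (gg 1 1) (0, q) = G1 1 1 q" "T (gg 1 2) (0, q) = G1 1 2 q" "T (gg 2 2) (0, q) = G1 2 2 q"
    unfolding T_gmet G1_def using metric_first_variation[OF sms sm_phi a, of q] by simp_all
  have g2: "T (T (gg 1 1)) (0, q) = G2 1 1 q" "T (T (gg 1 2)) (0, q) = G2 1 2 q" "T (T (gg 2 2)) (0, q) = G2 2 2 q"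
    unfolding T_gmet G2_def
    using metric_second_variation[OF sms sm_eta[of 1] sm_eta[of 2] sm_phi sm_psi a b, of q] by blast+
  have t0: "tsm J (\<lambda>z. 0)" by (simp add: tsm_def time.base_Ck_const)
  have z: "T (\<lambda>z. 0) = (\<lambda>z. 0)" by (rule ext) (rule time.base_deriv_const)
  have z0: "F 0 = x" by (rule F0)
  \<comment> \<open>The product \<open>gg 1 1 * gg 2 2\<close> is expanded by Leibniz' rule in two
    ways, as it stands and as \<open>rr * rr\<close> plus the square of \<open>gg 1 2\<close>.
    Comparing them differentiates the area density without differentiating a square root.\<close>
  have l1: "(\<lambda>z. gg 1 1 z * gg 2 2 z) (t, q) = rr (t, q) * rr (t, q) + gg 1 2 (t, q) * gg 1 2 (t, q) + (\<lambda>z. 0) (t, q)"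
    if t: "t \<in> J" for t q
  proof -
    have "rho (F t) q * rho (F t) q = gdet (F t) q"
      using gmet_pos(2)[OF surfF[OF t], of q] by (simp add: rho_def)
    then show ?thesis by (simp add: gdet_def power2_eq_square)
  qed
  have l2: "(\<lambda>z. gg 1 1 z * gg 2 2 z) (t, q) = gg 1 1 (t, q) * gg 2 2 (t, q) + (\<lambda>z. 0) (t, q) * (\<lambda>z. 0) (t, q) + (\<lambda>z. 0) (t, q)"
    if t: "t \<in> J" for t q by simp
  note A = T_bilinear[OF J(1) tsm_geometry(5,5,4,4) t0 l1 J(2), of q]
  note B = T_bilinear[OF J(1) tsm_geometry(4,4) t0 t0 t0 l2 J(2), of q]
  show ?thesis
  proof (rule density_second_variation[where ?G1.0=G1 and ?G2.0=G2 and ?r1.0="T rr (0, q)"])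
    show "2 * sg q * T rr (0, q) = pol H G1 q"
      using A(1) B(1) by (simp add: z z0 base_geometry g1 pol_def algebra_simps)
    show "2 * (T rr (0, q))\<^sup>2 + 2 * sg q * T (T rr) (0, q) = pol H G2 q + pol G1 G1 q"
      using A(2) B(2) by (simp add: z z0 base_geometry g1 g2 pol_def power2_eq_square algebra_simps)
  qed (simp_all add: sm_phi sm_psi sm_xi sm_VV G1_def G2_def)
qed

lemma integral_T_T_rho: "(\<integral>q. indicator K q * T (T rr) (0, q) \<partial>base_measure) = Qf \<phi>"
proof -
  have phi0: "\<phi> q = 0" if "q \<notin> K" for q using phi_eq[of q] xi_eta_outside[OF that] by simp
  have psi0: "psi q = 0" if "q \<notin> K" for q using xi_eta_outside[OF that] by (simp add: psi_def)
  have X0: "XX 1 q = 0" "XX 2 q = 0" if "q \<notin> K" for q using xi_eta_outside[OF that] by simp_all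
  have V0: "VV 1 q = 0" "VV 2 q = 0" if "q \<notin> K" for q using xi_eta_outside[OF that] by (simp_all add: accel_def)
  have smX: "sm (XX 1)" "sm (XX 2)" using sm_xi by simp_all
  have fl0: "flux \<zeta> f q = 0" if "q \<notin> K" "\<And>q. q \<notin> K \<Longrightarrow> \<zeta> 1 q = 0" "\<And>q. q \<notin> K \<Longrightarrow> \<zeta> 2 q = 0" for \<zeta> f q
    unfolding flux_def
    using base_deriv_zero_outside[of K "\<lambda>q. f q * \<zeta> 1 q" q] base_deriv_zero_outside[of K "\<lambda>q. f q * \<zeta> 2 q" q] J(4) that
    by simp
  let ?E = "\<lambda>q. hv psi q + qf \<phi> \<phi> q + 2 * flux XX (hv \<phi>) q + flux VV sg q + flux XX (flux XX sg) q"
  have "indicator K q * T (T rr) (0, q) = ?E q" for q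
  proof (cases "q \<in> K")
    case False
    then show ?thesis
      using hv_zero_outside[of K psi, OF J(4) psi0 False] qf_zero_outside[of K \<phi>, OF J(4) phi0 False]
        fl0[of q XX, OF False X0] fl0[of q VV, OF False V0] by simp
  qed (simp add: T_T_rho)
  then have "(\<integral>q. indicator K q * T (T rr) (0, q) \<partial>base_measure) = (\<integral>q. ?E q \<partial>base_measure)" by simp
  moreover note i = integral_hv[OF extremal sm_psi J(3) psi0] integral_flux[OF smX sm_hv[OF sm_phi] J(3) X0]
    integral_flux[OF sm_VV sm_sg J(3) V0] integral_flux[OF smX sm_flux[OF smX sm_sg] J(3) X0] integrable_qf[OF \<phi> \<phi>]
  ultimately show ?thesis by (simp add: Qf_def)
qed

text \<open>The time derivative is bounded on a compact time interval times \<open>K\<close>, which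
  supplies the Lipschitz constant for differentiation under the integral. The indicator stays
  because \<open>g\<close>, such as the area density, need not vanish off \<open>K\<close>.\<close>

lemma integral_T:
  assumes g: "tsm J g" and t: "t \<in> J"
  shows "((\<lambda>t. \<integral>q. indicator K q * g (t, q) \<partial>base_measure) has_real_derivative
    (\<integral>q. indicator K q * T g (t, q) \<partial>base_measure)) (at t)"
proof -
  obtain d where d: "d > 0" "cball t d \<subseteq> J" using J(1) t open_contains_cball by blast
  have "compact (T g ` (cball t d \<times> K))"
    using d by (intro compact_continuous_image continuous_on_subset[OF tsm_continuous[OF J(1) tsm_T[OF J(1) g]]]
      compact_Times compact_cball J(3)) auto
  from compact_imp_bounded[OF this] obtain C where "\<forall>y\<in>T g ` (cball t d \<times> K). \<bar>y\<bar> \<le> C"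
    unfolding bounded_real by (elim exE)
  then have C: "\<bar>T g (s, q)\<bar> \<le> C" if "s \<in> cball t d" "q \<in> K" for s q
    by (rule bspec) (intro imageI SigmaI that)
  show ?thesis
  proof (rule has_real_derivative_integral_lipschitz(2)[OF d(1), where w="\<lambda>q. indicator K q * C"])
    fix s assume s: "\<bar>s - t\<bar> < d"
    then have sJ: "s \<in> J" using d(2) by (auto simp: dist_real_def)
    show "integrable base_measure (\<lambda>q. indicator K q * g (s, q))"
      by (rule integrable_on_compact[OF sm_continuous[OF tsm_slice[OF J(1) g sJ]] J(3)])
    fix q
    have "norm (g (s, q) - g (t, q)) \<le> C * norm (s - t)" if "q \<in> K"
    proof (rule field_differentiable_bound[of "cball t d"])
      show "((\<lambda>s. g (s, q)) has_field_derivative T g (r, q)) (at r within cball t d)" if "r \<in> cball t d" for r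
        using T_has_derivative[OF J(1) g, of r q] d(2) that has_field_derivative_at_within by blast
    qed (use C that s d in \<open>auto simp: dist_real_def\<close>)
    then show "\<bar>indicator K q * g (s, q) - indicator K q * g (t, q)\<bar> \<le> \<bar>s - t\<bar> * (indicator K q * C)"
      by (auto split: split_indicator simp: mult.commute)
  next
    fix q
    show "((\<lambda>s. indicator K q * g (s, q)) has_real_derivative indicator K q * T g (t, q)) (at t)"
      by (rule DERIV_cmult[OF T_has_derivative[OF J(1) g t]])
    show "integrable base_measure (\<lambda>q. indicator K q * C)"
      by (rule integrable_on_compact[OF continuous_on_const J(3)])
  qed
qed

lemma second_variation:
  "has_second_derivative (\<lambda>t. measure (calabi_volume \<A> (F t)) K) (Qf \<phi>) 0"
  unfolding has_second_derivative_def
proof (intro exI conjI)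
  let ?V' = "\<lambda>t. \<integral>q. indicator K q * T rr (t, q) \<partial>base_measure"
  show "\<forall>\<^sub>F t in nhds 0. ((\<lambda>t. measure (calabi_volume \<A> (F t)) K) has_real_derivative ?V' t) (at t)"
    unfolding eventually_nhds
  proof (intro exI[of _ J] conjI ballI J)
    fix t assume t: "t \<in> J"
    show "((\<lambda>t. measure (calabi_volume \<A> (F t)) K) has_real_derivative ?V' t) (at t)"
    proof (rule has_field_derivative_transform_within_open[OF integral_T[OF tsm_geometry(5) t] J(1) t])
      show "(\<integral>q. indicator K q * rr (s, q) \<partial>base_measure) = measure (calabi_volume \<A> (F s)) K" if "s \<in> J" for s
        using calabi_volume_compact[OF surfF[OF that] J(3)] by simp
    qed
  qed
  show "(?V' has_real_derivative Qf \<phi>) (at 0)"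
    using integral_T[OF tsm_T[OF J(1) tsm_geometry(5)] J(2)] unfolding integral_T_T_rho .
qed

end

end

text \<open>The witness is \<open>Qf\<close>, built from \<open>x\<close> alone; this is why a
  single form serves all variations.\<close>

theorem theorem1p1:
  fixes \<A> :: "'m::{t2_space, second_countable_topology} chart set"
    and x :: "'m \<Rightarrow> real^3"
  assumes "smooth_atlas \<A>"
    and "connected (UNIV :: 'm set)"
    and "calabi_surface \<A> x"
    and "calabi_extremal x"
  shows "\<exists>Q. quadratic_form_on (test_functions \<A>) Q \<and>
             (\<forall>\<phi>\<in>test_functions \<A>. Q \<phi> \<le> 0 \<and> (Q \<phi> = 0 \<longrightarrow> (\<forall>q. \<phi> q = 0))) \<and>
             (\<forall>\<epsilon> K F \<phi>.
                admissible_variation \<A> x \<epsilon> K F \<and> \<phi> \<in> test_functions \<A> \<and> normal_part \<A> x F \<phi> \<longrightarrow>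
                has_second_derivative (\<lambda>t. measure (calabi_volume \<A> (F t)) K) (Q \<phi>) 0)"
proof -
  interpret calabi_base \<A> x using assms by unfold_locales
  show ?thesis
    using quadratic_form_Qf Qf_negative[OF assms(2)] second_variation[OF _ _ assms(4)] by blast
qed

end
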